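(* Let $0<n<d$, $K$ an odd kernel as in the context, $\tilde P\subset\mathbb{R}^n$ a cube, $A:\mathbb{R}^n\to\mathbb{R}^{d-n}$ a Lipschitz function supported in $\tilde P$, $\Gamma=\{(\tilde x,A(\tilde x)):\tilde x\in\mathbb{R}^n\}$, and $\mu:=f\mathcal{H}^n_\Gamma$ where $f(x)=1$ for $\tilde x\notin\tilde P$ and $C_0^{-1}\le f(x)\le C_0$ for $\tilde x\in\tilde P$, for some constant $C_0>0$. For $x\in\Gamma$ define $S\mu(x)^2:=\sup_{\{\epsilon_m\}}\sum_{j\in\mathbb{Z}}\sum_{m\in\mathbb{Z}:\,\epsilon_m,\epsilon_{m+1}\in I_j}|(K\varphi^{\epsilon_m}_{\epsilon_{m+1}}*\mu)(x)|^2$, where $I_j=[2^{-j-1},2^{-j})$ and the supremum is over all decreasing sequences of positive numbers $\{\epsilon_m\}_{m\in\mathbb{Z}}$. Then $\|S\mu\|^2_{L^2(\mu)}\le C\sum_{Q\in\mathcal{D}}\big(\alpha_\mu(Q)^2+\beta_{2,\mu}(Q)^2\big)\mu(Q)$, where $C>0$ depends only on $C_0,n,d,K$ and $\mathrm{Lip}(A)$.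
   Context: For $x\in\mathbb{R}^d$, $\tilde x$ denotes its first $n$ coordinates. $K:\mathbb{R}^d\setminus\{0\}\to\mathbb{R}$ is odd and satisfies $|K(x)|\le C|x|^{-n}$, $|\nabla K(x)|\le C|x|^{-n-1}$, $|\nabla^2K(x)|\le C|x|^{-n-2}$. Fix a non-decreasing $\mathcal{C}^2$ function $\varphi_{\mathbb{R}}:[0,\infty)\to[0,\infty)$ with $\chi_{[3\sqrt n,\infty)}\le\varphi_{\mathbb{R}}\le\chi_{[2.1\sqrt n,\infty)}$, set $\varphi_\epsilon(x):=\varphi_{\mathbb{R}}(|\tilde x|/\epsilon)$, $\varphi^\delta_\epsilon:=\varphi_\epsilon-\varphi_\delta$ for $0<\epsilon\le\delta$, and $(K\varphi^\delta_\epsilon*\mu)(x):=\int\varphi^\delta_\epsilon(x-y)K(x-y)\,d\mu(y)$. A v-cube is $Q=\tilde Q\times\mathbb{R}^{d-n}$ with $\tilde Q\subset\mathbb{R}^n$ a cube; $\ell(Q)$, $\tilde z_Q$ are the side length and center of $\tilde Q$, $\lambda Q:=\lambda\tilde Q\times\mathbb{R}^{d-n}$. $\mathcal{D}:=\{\tilde Q\times\mathbb{R}^{d-n}:\tilde Q$ a standard dyadic cube of $\mathbb{R}^n\}$. Fix a constant $C_\Gamma>10\sqrt n(1+\mathrm{Lip}(A))$. For a v-cube $Q$: $\beta_{2,\mu}(Q):=\inf_L\big(\ell(Q)^{-n}\int_{C_\Gamma Q}(\mathrm{dist}(y,L)/\ell(Q))^2d\mu(y)\big)^{1/2}$, infimum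 over affine $n$-planes $L$; with $B_Q:=B(\tilde z_Q,C_\Gamma\ell(Q))\times\mathbb{R}^{d-n}$ and $\mathrm{dist}_F(\sigma,\nu):=\sup\{|\int g\,d\sigma-\int g\,d\nu|:\mathrm{Lip}(g)\le1,\operatorname{supp}g\subset F\}$, $\alpha_\mu(Q):=\ell(Q)^{-n-1}\inf_{c\ge0,L}\mathrm{dist}_{B_Q}(\mu,c\mathcal{H}^n_L)$ if $Q$ meets $\operatorname{supp}\mu$, and $0$ otherwise. *)

theory Defs
  imports "HOL-Analysis.Analysis"
begin

definition hausdorff_content :: "nat \<Rightarrow> real \<Rightarrow> 'a::metric_space set \<Rightarrow> ennreal" where
  "hausdorff_content s \<delta> E =
     (INF U \<in> {U :: nat \<Rightarrow> 'a set. E \<subseteq> (\<Union>i. U i) \<and> (\<forall>i. bounded (U i) \<and> diameter (U i) \<le> \<delta>)}.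
        (\<Sum>i. ennreal (unit_ball_vol (real s) * (diameter (U i) / 2) ^ s)))"

definition hausdorff_outer :: "nat \<Rightarrow> 'a::metric_space set \<Rightarrow> ennreal" where
  "hausdorff_outer s E = (SUP \<delta> \<in> {0<..}. hausdorff_content s \<delta> E)"

definition hausdorff_measure :: "nat \<Rightarrow> 'a::metric_space measure" where
  "hausdorff_measure s = measure_of UNIV (sets borel) (hausdorff_outer s)"

definition restrict_to :: "'a measure \<Rightarrow> 'a set \<Rightarrow> 'a measure" where
  "restrict_to M L = density M (indicator L)"

definition lip :: "('a::metric_space \<Rightarrow> 'b::metric_space) \<Rightarrow> real" where
  "lip g = Sup {dist (g x) (g y) / dist x y | x y. x \<noteq> y}"

section \<open>Points of R^d = R^n x R^(d-n); the tilde projection is fst\<close>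

definition CZ_kernel :: "nat \<Rightarrow> real \<Rightarrow> ('d::euclidean_space \<Rightarrow> real) \<Rightarrow> bool" where
  "CZ_kernel n c K \<longleftrightarrow>
     (\<forall>x. x \<noteq> 0 \<longrightarrow> K (- x) = - K x) \<and>
     (\<exists>G :: 'd \<Rightarrow> 'd. \<exists>H :: 'd \<Rightarrow> 'd \<Rightarrow> 'd. \<forall>x. x \<noteq> 0 \<longrightarrow>
        (K has_derivative (\<lambda>h. G x \<bullet> h)) (at x) \<and>
        (G has_derivative H x) (at x) \<and>
        \<bar>K x\<bar> \<le> c / norm x ^ n \<and>
        norm (G x) \<le> c / norm x ^ (n + 1) \<and>
        onorm (H x) \<le> c / norm x ^ (n + 2))"

definition cutoff_profile :: "nat \<Rightarrow> (real \<Rightarrow> real) \<Rightarrow> bool" where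
  "cutoff_profile n \<phi> \<longleftrightarrow>
     mono_on {0..} \<phi> \<and>
     (\<forall>t\<ge>0. (if t \<ge> 3 * sqrt n then 1 else 0) \<le> \<phi> t \<and> \<phi> t \<le> (if t \<ge> 2.1 * sqrt n then 1 else 0)) \<and>
     (\<exists>\<phi>' \<phi>''. (\<forall>t\<ge>0. (\<phi> has_real_derivative \<phi>' t) (at t within {0..}) \<and>
                       (\<phi>' has_real_derivative \<phi>'' t) (at t within {0..})) \<and>
                continuous_on {0..} \<phi>'')"

text \<open>(K phi^delta_eps * mu)(x), for 0 < eps <= delta; phi_eps(x) = phi(|x~|/eps).\<close>
definition trunc_conv ::
  "(real \<Rightarrow> real) \<Rightarrow> ((real^'n) \<times> (real^'m) \<Rightarrow> real) \<Rightarrow> ((real^'n) \<times> (real^'m)) measure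
    \<Rightarrow> real \<Rightarrow> real \<Rightarrow> (real^'n) \<times> (real^'m) \<Rightarrow> real" where
  "trunc_conv \<phi> K \<mu> \<epsilon> \<delta> x =
     (\<integral> y. (\<phi> (norm (fst (x - y)) / \<epsilon>) - \<phi> (norm (fst (x - y)) / \<delta>)) * K (x - y) \<partial>\<mu>)"

definition dyI :: "int \<Rightarrow> real set" where
  "dyI j = {2 powr (- real_of_int j - 1) ..< 2 powr (- real_of_int j)}"

definition S_sq ::
  "(real \<Rightarrow> real) \<Rightarrow> ((real^'n) \<times> (real^'m) \<Rightarrow> real) \<Rightarrow> ((real^'n) \<times> (real^'m)) measure
    \<Rightarrow> (real^'n) \<times> (real^'m) \<Rightarrow> ennreal" where
  "S_sq \<phi> K \<mu> x =
     (SUP \<epsilon> \<in> {\<epsilon> :: int \<Rightarrow> real. (\<forall>m. 0 < \<epsilon> m) \<and> (\<forall>m. \<epsilon> (m + 1) < \<epsilon> m)}.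
        (\<integral>\<^sup>+ j. (\<integral>\<^sup>+ m. (if \<epsilon> m \<in> dyI j \<and> \<epsilon> (m + 1) \<in> dyI j
                           then ennreal ((trunc_conv \<phi> K \<mu> (\<epsilon> (m + 1)) (\<epsilon> m) x)\<^sup>2) else 0)
                  \<partial>count_space UNIV) \<partial>count_space UNIV))"

definition hcube :: "real^'n \<Rightarrow> real \<Rightarrow> (real^'n) set" where
  "hcube c l = {x. \<forall>i. c $ i - l / 2 \<le> x $ i \<and> x $ i < c $ i + l / 2}"

definition ccube :: "real^'n \<Rightarrow> real \<Rightarrow> (real^'n) set" where
  "ccube c l = {x. \<forall>i. \<bar>x $ i - c $ i\<bar> \<le> l / 2}"

text \<open>A v-cube is represented by (center of Q~, side length l(Q)); lambda Q scales the side.\<close>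
definition vcube :: "(real^'n) \<times> real \<Rightarrow> real \<Rightarrow> ((real^'n) \<times> (real^'m)) set" where
  "vcube Q s = {x. fst x \<in> hcube (fst Q) (s * snd Q)}"

definition dyadic_vcubes :: "((real^'n) \<times> real) set" where
  "dyadic_vcubes = {((\<chi> i. (real_of_int (k i) + 1/2) * 2 powr (- real_of_int j)), 2 powr (- real_of_int j))
                     | j k. True}"

definition B_Q :: "real \<Rightarrow> (real^'n) \<times> real \<Rightarrow> ((real^'n) \<times> (real^'m)) set" where
  "B_Q C\<Gamma> Q = {x. dist (fst x) (fst Q) < C\<Gamma> * snd Q}"

definition nplanes :: "nat \<Rightarrow> ('a::euclidean_space) set set" where
  "nplanes n = {L. affine L \<and> aff_dim L = int n}"

definition ennsqrt :: "ennreal \<Rightarrow> ennreal" where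
  "ennsqrt x = (if x = \<infinity> then \<infinity> else ennreal (sqrt (enn2real x)))"

definition beta2 :: "real \<Rightarrow> ((real^'n) \<times> (real^'m)) measure \<Rightarrow> (real^'n) \<times> real \<Rightarrow> ennreal" where
  "beta2 C\<Gamma> \<mu> Q = (INF L \<in> nplanes CARD('n).
     ennsqrt (ennreal (1 / snd Q ^ CARD('n)) *
        (\<integral>\<^sup>+ y \<in> vcube Q C\<Gamma>. ennreal ((infdist y L / snd Q)\<^sup>2) \<partial>\<mu>)))"

definition dist_F :: "'a::euclidean_space set \<Rightarrow> 'a measure \<Rightarrow> 'a measure \<Rightarrow> ennreal" where
  "dist_F F \<sigma> \<nu> = (SUP g \<in> {g :: 'a \<Rightarrow> real. 1-lipschitz_on UNIV g \<and> closure {x. g x \<noteq> 0} \<subseteq> F}.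
      (if integrable \<sigma> g \<and> integrable \<nu> g
       then ennreal \<bar>(\<integral> x. g x \<partial>\<sigma>) - (\<integral> x. g x \<partial>\<nu>)\<bar> else \<infinity>))"

definition measure_support :: "'a::metric_space measure \<Rightarrow> 'a set" where
  "measure_support \<mu> = {x. \<forall>r>0. emeasure \<mu> (ball x r) > 0}"

definition alpha :: "real \<Rightarrow> ((real^'n) \<times> (real^'m)) measure \<Rightarrow> (real^'n) \<times> real \<Rightarrow> ennreal" where
  "alpha C\<Gamma> \<mu> Q =
     (if vcube Q 1 \<inter> measure_support \<mu> \<noteq> {} then
        ennreal (1 / snd Q ^ (CARD('n) + 1)) *
        (INF cL \<in> {(c, L). c \<ge> (0::real) \<and> L \<in> nplanes CARD('n)}.
           dist_F (B_Q C\<Gamma> Q) \<mu>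
             (density (hausdorff_measure CARD('n)) (\<lambda>x. ennreal (fst cL) * indicator (snd cL) x)))
      else 0)"

end

theory Submission imports Defs begin

text \<open>
  Fix \<open>x \<in> Q\<close> with \<open>l = \<ell>(Q)\<close> and truncation radii \<open>\<epsilon> < \<delta>\<close> in \<open>[l/2, l)\<close>. The truncated kernel has size
  \<open>O(\<eta> l^-n)\<close> and Lipschitz constant \<open>O(\<eta> l^-(n+1))\<close> with \<open>\<eta> = (\<delta> - \<epsilon>) / l\<close>. Given \<open>(c, L)\<close>, replacing
  \<open>\<mu>\<close> by the plane measure \<open>c H^n|L\<close> costs \<open>\<eta>\<close> times the normalised distance \<open>a\<close> of the two measures.
  Since the kernel is odd and the plane measure is invariant under the point reflection in the point
  of \<open>L\<close> closest to \<open>x\<close>, the remaining integral is at most \<open>\<eta> dist(x, L) / l\<close>. The \<open>\<eta>\<close>'s of one scale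
  have sum at most 1, so the square function at that scale is \<open>O(min(1, a + dist(x, L) / l)^2)\<close>.

  It remains to bound the mean square over \<open>Q\<close> of this by \<open>a^2 + b^2\<close>, where \<open>b\<close> is the mean square
  distance of \<open>\<mu>\<close> to a plane \<open>L'\<close>. If \<open>a\<close> or \<open>b\<close> is not small this is trivial. Otherwise most points
  of the graph over \<open>Q\<close> lie within \<open>O(a l)\<close> of \<open>L\<close> and \<open>O(b l)\<close> of \<open>L'\<close>; this bounds the slope of \<open>L'\<close>,
  and for every \<open>x\<close> there are two such points whose midpoint \<open>m\<close> lies vertically above or below \<open>x\<close>.
  Then \<open>|x - m|\<close> is \<open>O(dist(x, L') + b l)\<close>, hence \<open>dist(x, L)\<close> is \<open>O(a l + b l + dist(x, L'))\<close>.
  The square function itself is not known to be measurable, so sums and integrals are only exchanged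
  for the measurable majorants, taken as infima over countably many planes.
\<close>

subsection \<open>Hausdorff measure\<close>

lemma sets_hausdorff_measure [simp, measurable_cong]: "sets (hausdorff_measure s) = sets borel"
  unfolding hausdorff_measure_def
  using sets.sigma_sets_eq[of "borel :: 'a measure"] by simp

lemma space_hausdorff_measure [simp]: "space (hausdorff_measure s) = UNIV"
  by (simp add: hausdorff_measure_def)

lemma emeasure_hausdorff_measure:
  assumes "measure_space UNIV (sets borel) (hausdorff_outer s :: 'a::metric_space set \<Rightarrow> ennreal)"
    and "E \<in> sets borel"
  shows "emeasure (hausdorff_measure s) (E::'a set) = hausdorff_outer s E"
  using assms sets.sigma_sets_eq[of "borel :: 'a measure"]
  unfolding hausdorff_measure_def by (simp add: emeasure_measure_of_conv)

text \<open>If the Hausdorff outer measure were not countably additive on Borel sets, \<open>measure_of\<close> would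
  return the null measure; splitting on this avoids Caratheodory's criterion below.\<close>

lemma emeasure_hausdorff_measure_degenerate:
  assumes "\<not> measure_space UNIV (sets borel) (hausdorff_outer s :: 'a::metric_space set \<Rightarrow> ennreal)"
  shows "emeasure (hausdorff_measure s) (E::'a set) = 0"
  using assms sets.sigma_sets_eq[of "borel :: 'a measure"]
  unfolding hausdorff_measure_def by (simp add: emeasure_measure_of_conv)

text \<open>In both exceptional cases, failure of countable additivity and a non-Borel set, the left
  side is 0. Upper bounds for the measure can therefore be read off from covers.\<close>

lemma emeasure_hausdorff_measure_le:
  fixes E :: "'a::metric_space set"
  shows "emeasure (hausdorff_measure s) E \<le> hausdorff_outer s E"
proof (cases "measure_space UNIV (sets borel) (hausdorff_outer s :: 'a set \<Rightarrow> ennreal) \<and> E \<in> sets borel")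
  case True
  then show ?thesis by (simp add: emeasure_hausdorff_measure)
next
  case False
  then show ?thesis
    using emeasure_hausdorff_measure_degenerate[of s E] emeasure_notin_sets[of E "hausdorff_measure s"]
    by (metis sets_hausdorff_measure zero_le)
qed

lemma bounded_diameter_le:
  fixes S :: "'a::metric_space set"
  assumes "0 \<le> d" and "\<And>x y. x \<in> S \<Longrightarrow> y \<in> S \<Longrightarrow> dist x y \<le> d"
  shows "bounded S \<and> diameter S \<le> d"
  using assms by (auto simp: bounded_two_points diameter_def intro: cSUP_least)

text \<open>The images of the sets of a cover form a cover with no larger diameters. The maps of
  interest are point reflections and the projection \<open>fst\<close>.\<close>

lemma hausdorff_outer_nonexpansive_image:
  fixes g :: "'a::metric_space \<Rightarrow> 'b::metric_space"
  assumes g: "\<And>x y. dist (g x) (g y) \<le> dist x y"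
  shows "hausdorff_outer s (g ` E) \<le> hausdorff_outer s E"
proof -
  have "hausdorff_content s \<delta> (g ` E) \<le> hausdorff_content s \<delta> E" for \<delta>
    unfolding hausdorff_content_def
  proof (rule INF_mono)
    fix U :: "nat \<Rightarrow> 'a set"
    assume U: "U \<in> {U. E \<subseteq> (\<Union>i. U i) \<and> (\<forall>i. bounded (U i) \<and> diameter (U i) \<le> \<delta>)}"
    have *: "bounded (g ` U i) \<and> diameter (g ` U i) \<le> diameter (U i)" for i
    proof (rule bounded_diameter_le)
      show "0 \<le> diameter (U i)" using U by (auto intro: diameter_ge_0)
      fix x y assume "x \<in> g ` U i" "y \<in> g ` U i"
      then obtain x' y' where "x = g x'" "y = g y'" "x' \<in> U i" "y' \<in> U i" by auto
      then show "dist x y \<le> diameter (U i)"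
        using g[of x' y'] diameter_bounded_bound[of "U i" x' y'] U by auto
    qed
    show "\<exists>V\<in>{V. g ` E \<subseteq> (\<Union>i. V i) \<and> (\<forall>i. bounded (V i) \<and> diameter (V i) \<le> \<delta>)}.
        (\<Sum>i. ennreal (unit_ball_vol (real s) * (diameter (V i) / 2) ^ s))
          \<le> (\<Sum>i. ennreal (unit_ball_vol (real s) * (diameter (U i) / 2) ^ s))"
    proof (intro bexI[of _ "\<lambda>i. g ` U i"] suminf_le ennreal_leI mult_left_mono power_mono divide_right_mono)
      show "(\<lambda>i. g ` U i) \<in> {V. g ` E \<subseteq> (\<Union>i. V i) \<and> (\<forall>i. bounded (V i) \<and> diameter (V i) \<le> \<delta>)}"
        using U * by (auto intro: order_trans) (blast)
    qed (use * in \<open>auto intro: diameter_ge_0\<close>)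
  qed
  then show ?thesis
    unfolding hausdorff_outer_def by (intro SUP_mono) blast
qed

text \<open>A point reflection is an involutive isometry, so using the nonexpansive bound twice
  gives equality. The cancellation for odd kernels rests on this symmetry.\<close>

lemma distr_hausdorff_measure_point_reflection:
  fixes q :: "'a::real_normed_vector"
  shows "distr (hausdorff_measure s) borel (\<lambda>y. q - y) = hausdorff_measure s"
proof (rule measure_eqI)
  let ?r = "\<lambda>y. q - y"
  fix E assume "E \<in> sets (distr (hausdorff_measure s) borel ?r)"
  then have E: "E \<in> sets borel" by simp
  have r: "?r \<in> borel_measurable borel"
    by (intro borel_measurable_continuous_onI continuous_intros)
  have inv: "?r -` E = ?r ` E" for E by force
  have rE: "?r ` E \<in> sets borel"
    using measurable_sets[OF r E] by (simp add: inv)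
  have le: "hausdorff_outer s (?r ` F) \<le> hausdorff_outer s F" for F
    by (rule hausdorff_outer_nonexpansive_image) (simp add: dist_norm norm_minus_commute)
  have "hausdorff_outer s (?r ` E) = hausdorff_outer s E"
    using le[of E] le[of "?r ` E"] by (simp add: image_image)
  then have "emeasure (hausdorff_measure s) (?r ` E) = emeasure (hausdorff_measure s) E"
    using emeasure_hausdorff_measure[of s] emeasure_hausdorff_measure_degenerate[of s] E rE by metis
  then show "emeasure (distr (hausdorff_measure s) borel ?r) E = emeasure (hausdorff_measure s) E"
    using E r by (simp add: emeasure_distr inv)
qed simp

section \<open>Covering estimates: comparison with Lebesgue measure, and Lipschitz graphs\<close>

text \<open>Each covering set lies in a ball centred at one of its points whose radius is its
  diameter. Using the diameter instead of half of it accounts for the factor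
  \<open>2 ^ DIM('a)\<close>.\<close>

lemma lborel_le_hausdorff_outer:
  fixes E :: "'a::euclidean_space set"
  assumes E: "E \<in> sets borel"
  shows "emeasure lborel E \<le> 2 ^ DIM('a) * hausdorff_outer DIM('a) E"
proof -
  let ?n = "DIM('a)"
  have pow2: "(2::ennreal) ^ ?n = ennreal (2 ^ ?n)" by (simp add: ennreal_power[symmetric])
  have "emeasure lborel E / 2 ^ ?n \<le> hausdorff_content ?n 1 E"
    unfolding hausdorff_content_def
  proof (intro INF_greatest divide_le_posI_ennreal)
    fix U :: "nat \<Rightarrow> 'a set"
    assume "U \<in> {U. E \<subseteq> (\<Union>i. U i) \<and> (\<forall>i. bounded (U i) \<and> diameter (U i) \<le> 1)}"
    then have U: "E \<subseteq> (\<Union>i. U i)" "\<And>i. bounded (U i)" by auto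
    define c where "c i = (SOME x. x \<in> U i)" for i
    have sub: "U i \<subseteq> cball (c i) (diameter (U i))" for i
      using diameter_bounded_bound[OF U(2)[of i], of "c i"] someI[of "\<lambda>x. x \<in> U i"]
      by (force simp: c_def)
    have d0: "0 \<le> diameter (U i)" for i using U by (simp add: diameter_ge_0)
    have "E \<subseteq> (\<Union>i. cball (c i) (diameter (U i)))" using U(1) sub by blast
    then have "emeasure lborel E \<le> emeasure lborel (\<Union>i. cball (c i) (diameter (U i)))"
      by (intro emeasure_mono) auto
    also have "\<dots> \<le> (\<Sum>i. emeasure lborel (cball (c i) (diameter (U i))))"
      by (intro emeasure_subadditive_countably) auto
    also have "\<dots> = (\<Sum>i. 2 ^ ?n * ennreal (unit_ball_vol (real ?n) * (diameter (U i) / 2) ^ ?n))"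
      using d0 by (intro suminf_cong)
        (simp add: pow2 emeasure_cball ennreal_mult'[symmetric] power_divide)
    also have "\<dots> = 2 ^ ?n * (\<Sum>i. ennreal (unit_ball_vol (real ?n) * (diameter (U i) / 2) ^ ?n))"
      by simp
    finally show "emeasure lborel E \<le> \<dots>" .
  qed (simp add: pow2)
  also have "\<dots> \<le> hausdorff_outer ?n E"
    unfolding hausdorff_outer_def by (intro SUP_upper) auto
  finally have "2 ^ ?n * (emeasure lborel E / 2 ^ ?n) \<le> 2 ^ ?n * hausdorff_outer ?n E"
    by (intro mult_left_mono) auto
  then show ?thesis by (simp add: pow2 ennreal_times_divide mult.commute mult_divide_eq_ennreal)
qed

text \<open>The finite cover is padded with empty sets to a sequence; their terms vanish because
  \<open>0 < s\<close> gives \<open>0 ^ s = 0\<close>.\<close>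

lemma hausdorff_content_le_finite_cover:
  fixes E :: "'a::metric_space set"
  assumes "finite F" and "E \<subseteq> (\<Union>i\<in>F. V i)" and "0 < s" "0 \<le> d" "d \<le> \<delta>"
    and V: "\<And>i x y. i \<in> F \<Longrightarrow> x \<in> V i \<Longrightarrow> y \<in> V i \<Longrightarrow> dist x y \<le> d"
  shows "hausdorff_content s \<delta> E \<le> ennreal (card F * (unit_ball_vol (real s) * (d / 2) ^ s))"
proof -
  obtain e where e: "bij_betw e {..<card F} F"
    using bij_betw_from_nat_into_finite[OF \<open>finite F\<close>] by blast
  define U where "U i = (if i < card F then V (e i) else {})" for i :: nat
  have dU: "bounded (U i) \<and> diameter (U i) \<le> d" for i
  proof (rule bounded_diameter_le)
    fix x y assume "x \<in> U i" "y \<in> U i"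
    then show "dist x y \<le> d"
      using V[of "e i"] e by (auto simp: U_def bij_betw_def split: if_splits)
  qed (rule assms)
  have "E \<subseteq> (\<Union>i. U i)"
  proof
    fix x assume "x \<in> E"
    then obtain j where "j \<in> F" "x \<in> V j" using assms by blast
    moreover then obtain i where "i < card F" "e i = j" using e by (force simp: bij_betw_def)
    ultimately show "x \<in> (\<Union>i. U i)" by (auto simp: U_def intro!: exI[of _ i])
  qed
  then have "hausdorff_content s \<delta> E \<le> (\<Sum>i. ennreal (unit_ball_vol (real s) * (diameter (U i) / 2) ^ s))"
    unfolding hausdorff_content_def using dU assms by (intro INF_lower) (auto intro: order_trans)
  also have "\<dots> = (\<Sum>i<card F. ennreal (unit_ball_vol (real s) * (diameter (U i) / 2) ^ s))"
    using assms by (intro suminf_finite) (auto simp: U_def)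
  also have "\<dots> \<le> (\<Sum>i<card F. ennreal (unit_ball_vol (real s) * (d / 2) ^ s))"
    using dU by (intro sum_mono ennreal_leI mult_left_mono power_mono) (auto intro: diameter_ge_0)
  also have "\<dots> = ennreal (card F * (unit_ball_vol (real s) * (d / 2) ^ s))"
    using assms by (simp add: ennreal_mult' ennreal_of_nat_eq_real_of_nat)
  finally show ?thesis .
qed

lemma norm_le_sqrt_card_component:
  fixes x :: "real^'n"
  assumes "\<And>i. \<bar>x $ i\<bar> \<le> d"
  shows "norm x \<le> sqrt (real CARD('n)) * d"
proof -
  have d: "0 \<le> d" using assms[of undefined] by linarith
  have "norm x = sqrt (\<Sum>i\<in>UNIV. (x $ i)\<^sup>2)" by (simp add: norm_vec_def L2_set_def)
  also have "\<dots> \<le> sqrt (\<Sum>i\<in>(UNIV::'n set). d\<^sup>2)"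
    using assms d by (intro real_sqrt_le_mono sum_mono) (simp add: abs_le_square_iff[symmetric])
  also have "\<dots> = sqrt (real CARD('n)) * d" using d by (simp add: real_sqrt_mult)
  finally show ?thesis .
qed

text \<open>A cube of side \<open>2 * r\<close> about \<open>z\<close> is cut into a grid of mesh
  \<open>2 * r / N\<close>. The graph over one cell has diameter at most
  \<open>(1 + L) * sqrt n\<close> times the mesh, and up to \<open>2 ^ n\<close> the number of cells
  cancels the powers of \<open>N\<close> in the diameters, so the bound is the same for every
  \<delta>.\<close>

lemma hausdorff_outer_graph_le:
  fixes A :: "real^'n \<Rightarrow> real^'m"
  assumes A: "\<And>x y. dist (A x) (A y) \<le> L * dist x y" and L: "0 \<le> L" and r: "0 < r"
  shows "hausdorff_outer CARD('n) {x. snd x = A (fst x) \<and> dist (fst x) z \<le> r}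
    \<le> ennreal (unit_ball_vol (real CARD('n)) * (2 * (1 + L) * sqrt (real CARD('n)) * r) ^ CARD('n))"
    (is "hausdorff_outer ?n ?E \<le> ennreal ?B")
proof -
  let ?c = "(1 + L) * sqrt (real ?n) * (2 * r)"
  have "hausdorff_content ?n \<delta> ?E \<le> ennreal ?B" if \<delta>: "\<delta> > 0" for \<delta>
  proof -
    obtain N :: nat where N: "N > 0" "?c / N \<le> \<delta>"
    proof -
      obtain N :: nat where "?c / \<delta> < N" using reals_Archimedean2 by blast
      note N = \<open>?c / \<delta> < N\<close>
      moreover have "?c / \<delta> \<ge> 0" using L r \<delta> by simp
      ultimately have N: "N > 0" by (metis gr0I not_le of_nat_0)
      moreover have "?c \<le> \<delta> * N" using \<open>?c / \<delta> < N\<close> \<delta> by (simp add: pos_divide_less_eq mult.commute)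
      ultimately have "?c / N \<le> \<delta>" by (simp add: pos_divide_le_eq)
      note N this
      then show ?thesis using that by blast
    qed
    \<comment> \<open>Indices run up to \<open>N\<close> inclusive, since a coordinate equal to
      \<open>z $ i + r\<close> has floor exactly \<open>N\<close>.\<close>
    let ?F = "(UNIV :: 'n set) \<rightarrow>\<^sub>E {..N}"
    define V where "V k = {x :: (real^'n) \<times> (real^'m). snd x = A (fst x) \<and>
        (\<forall>i. real (k i) * (2 * r / N) \<le> fst x $ i - z $ i + r \<and>
             fst x $ i - z $ i + r \<le> real (k i + 1) * (2 * r / N))}" for k :: "'n \<Rightarrow> nat"
    have "hausdorff_content ?n \<delta> ?E
        \<le> ennreal (card ?F * (unit_ball_vol (real ?n) * (?c / N / 2) ^ ?n))"
    proof (rule hausdorff_content_le_finite_cover[where V=V and d="?c / N"])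
      show "finite ?F" by (simp add: finite_PiE)
      show "0 < ?n" "0 \<le> ?c / N" "?c / N \<le> \<delta>" using L r N by auto
      show "?E \<subseteq> (\<Union>k\<in>?F. V k)"
      proof
        fix x assume x: "x \<in> ?E"
        define t where "t i = (fst x $ i - z $ i + r) / (2 * r / N)" for i
        have ab: "\<bar>fst x $ i - z $ i\<bar> \<le> r" for i
          using x component_le_norm_cart[of "fst x - z" i] by (simp add: dist_norm)
        have t0: "0 \<le> t i" and tN: "t i \<le> N" for i
          using ab[of i] r N(1) by (auto simp: t_def pos_divide_le_eq)
        have k: "real (nat \<lfloor>t i\<rfloor>) \<le> t i" "t i \<le> real (nat \<lfloor>t i\<rfloor> + 1)" "nat \<lfloor>t i\<rfloor> \<le> N" for i
          using t0[of i] tN[of i] by linarith+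
        have t: "fst x $ i - z $ i + r = t i * (2 * r / N)" for i
          using r N(1) by (simp add: t_def)
        have "x \<in> V (\<lambda>i. nat \<lfloor>t i\<rfloor>)"
          using x r k unfolding V_def by (auto simp: t intro!: divide_right_mono mult_right_mono simp del: of_nat_Suc of_nat_add)
        then show "x \<in> (\<Union>k\<in>?F. V k)" using k(3) by (intro UN_I[of "\<lambda>i. nat \<lfloor>t i\<rfloor>"]) auto
      qed
      fix k x y assume V: "x \<in> V k" "y \<in> V k"
      have xy: "snd x = A (fst x)" "snd y = A (fst y)" using V by (auto simp: V_def)
      have xyi: "\<bar>(fst x - fst y) $ i\<bar> \<le> 2 * r / N" for i
      proof -
        have "real (k i + 1) * (2 * r / N) = real (k i) * (2 * r / N) + 2 * r / N"
          by (simp only: of_nat_add of_nat_1 distrib_right mult_1_left)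
        then have "real (k i) * (2 * r / N) \<le> fst v $ i - z $ i + r"
          "fst v $ i - z $ i + r \<le> real (k i) * (2 * r / N) + 2 * r / N" if "v \<in> V k" for v
          using that unfolding V_def mem_Collect_eq by metis+
        from this[OF V(1)] this[OF V(2)] show ?thesis by (simp add: abs_le_iff)
      qed
      have "dist x y \<le> dist (fst x) (fst y) + dist (snd x) (snd y)"
        by (metis dist_Pair_Pair prod.collapse real_sqrt_sum_squares_triangle_ineq sqrt_sum_squares_le_sum zero_le_dist)
      also have "\<dots> \<le> (1 + L) * dist (fst x) (fst y)"
        using A[of "fst x" "fst y"] xy by (simp add: algebra_simps)
      also have "\<dots> \<le> (1 + L) * (sqrt (real ?n) * (2 * r / N))"
        using norm_le_sqrt_card_component[of "fst x - fst y", OF xyi] L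
        unfolding dist_norm by (intro mult_left_mono) linarith+
      finally show "dist x y \<le> ?c / N" by simp
    qed
    also have "\<dots> \<le> ennreal ?B"
    proof (rule ennreal_leI)
      have "real (card ?F) = (real N + 1) ^ ?n" by (simp add: card_PiE add.commute)
      also have "\<dots> \<le> (2 * real N) ^ ?n" using N(1) by (intro power_mono) auto
      finally have "card ?F * (unit_ball_vol (real ?n) * (?c / N / 2) ^ ?n)
          \<le> (2 * real N) ^ ?n * (unit_ball_vol (real ?n) * (?c / N / 2) ^ ?n)"
        using L r by (intro mult_right_mono) auto
      also have "\<dots> = unit_ball_vol (real ?n) * (2 * real N * (?c / N / 2)) ^ ?n"
        by (simp only: power_mult_distrib mult_ac)
      also have "2 * real N * (?c / N / 2) = 2 * (1 + L) * sqrt (real ?n) * r"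
        using N(1) by simp
      finally show "card ?F * (unit_ball_vol (real ?n) * (?c / N / 2) ^ ?n) \<le> ?B" .
    qed
    finally show ?thesis .
  qed
  then show ?thesis unfolding hausdorff_outer_def by (intro SUP_least) auto
qed

subsection \<open>The truncated kernel\<close>

text \<open>Continuity on a compact interval provides \<open>M\<close>. The endpoint is the largest
  argument met below: a distance of at most \<open>3 * sqrt n * l\<close> divided by a radius of at
  least \<open>l / 2\<close>.\<close>

lemma cutoff_profile_derivatives:
  assumes "cutoff_profile n \<phi>"
  obtains \<phi>1 \<phi>2 :: "real \<Rightarrow> real" and M :: real
  where "\<And>t. t \<ge> 0 \<Longrightarrow> (\<phi> has_real_derivative \<phi>1 t) (at t within {0..})"
    and "\<And>t. t \<ge> 0 \<Longrightarrow> (\<phi>1 has_real_derivative \<phi>2 t) (at t within {0..})"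
    and "\<And>t. 0 \<le> t \<Longrightarrow> t \<le> 6 * sqrt n \<Longrightarrow> \<bar>\<phi>1 t\<bar> \<le> M"
    and "\<And>t. 0 \<le> t \<Longrightarrow> t \<le> 6 * sqrt n \<Longrightarrow> \<bar>\<phi>2 t\<bar> \<le> M" and "M > 0"
proof -
  obtain \<phi>1 \<phi>2 where d1: "\<And>t. t \<ge> 0 \<Longrightarrow> (\<phi> has_real_derivative \<phi>1 t) (at t within {0..})"
    and d2: "\<And>t. t \<ge> 0 \<Longrightarrow> (\<phi>1 has_real_derivative \<phi>2 t) (at t within {0..})"
    and c2: "continuous_on {0..} \<phi>2"
    using assms unfolding cutoff_profile_def by blast
  have c1: "continuous_on {0..} \<phi>1"
    using d2 by (intro continuous_on_eq_continuous_within[THEN iffD2])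
      (auto intro: DERIV_continuous)
  have "\<exists>B>0. \<forall>t\<in>{0..6 * sqrt n}. \<bar>g t\<bar> \<le> B" if "continuous_on {0..} g" for g :: "real \<Rightarrow> real"
  proof -
    have "bounded (g ` {0..6 * sqrt n})"
      by (intro compact_imp_bounded compact_continuous_image continuous_on_subset[OF that]) auto
    then show ?thesis by (auto simp: bounded_pos)
  qed
  from this[OF c1] this[OF c2] obtain B1 B2
    where "B1 > 0" "\<forall>t\<in>{0..6 * sqrt n}. \<bar>\<phi>1 t\<bar> \<le> B1" "B2 > 0" "\<forall>t\<in>{0..6 * sqrt n}. \<bar>\<phi>2 t\<bar> \<le> B2"
    by blast
  then show thesis
    using that[of \<phi>1 \<phi>2 "max B1 B2"] d1 d2 by (auto simp: le_max_iff_disj)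
qed

definition radial_cutoff :: "(real \<Rightarrow> real) \<Rightarrow> real \<Rightarrow> real \<Rightarrow> real \<Rightarrow> real" where
  "radial_cutoff \<phi> \<epsilon> \<delta> t = \<phi> (t / \<epsilon>) - \<phi> (t / \<delta>)"

definition trunc_kernel ::
  "(real \<Rightarrow> real) \<Rightarrow> ((real^'n) \<times> (real^'m) \<Rightarrow> real) \<Rightarrow> real \<Rightarrow> real \<Rightarrow> (real^'n) \<times> (real^'m) \<Rightarrow> real" where
  "trunc_kernel \<phi> K \<epsilon> \<delta> z = radial_cutoff \<phi> \<epsilon> \<delta> (norm (fst z)) * K z"

text \<open>Near 0 both dilated profiles are 0, and far out both are 1. The first fact keeps the
  truncated kernel away from the singularity, the second confines it to a vertical strip.\<close>

lemma radial_cutoff_eq_0: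
  assumes \<phi>: "cutoff_profile n \<phi>" and e: "0 < \<epsilon>" "\<epsilon> < \<delta>"
  shows "0 \<le> t \<Longrightarrow> t < 2.1 * sqrt n * \<epsilon> \<Longrightarrow> radial_cutoff \<phi> \<epsilon> \<delta> t = 0"
    and "t \<ge> 3 * sqrt n * \<delta> \<Longrightarrow> radial_cutoff \<phi> \<epsilon> \<delta> t = 0"
proof -
  have p: "(if t \<ge> 3 * sqrt n then 1 else 0) \<le> \<phi> t \<and> \<phi> t \<le> (if t \<ge> 2.1 * sqrt n then 1 else 0)"
    if "t \<ge> 0" for t using \<phi> that unfolding cutoff_profile_def by blast
  { assume t: "0 \<le> t" "t < 2.1 * sqrt n * \<epsilon>"
    have "t / \<delta> \<le> t / \<epsilon>" using t e by (intro divide_left_mono) auto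
    moreover have "t / \<epsilon> < 2.1 * sqrt n" using t(2) e by (metis pos_divide_less_eq)
    moreover have "0 \<le> t / \<epsilon>" "0 \<le> t / \<delta>" using t e by auto
    ultimately have "t / \<epsilon> < 2.1 * sqrt n" "t / \<delta> < 2.1 * sqrt n" "0 \<le> t / \<epsilon>" "0 \<le> t / \<delta>"
      by linarith+
    then have "\<phi> (t / \<epsilon>) = 0" "\<phi> (t / \<delta>) = 0"
      using p[of "t / \<epsilon>"] p[of "t / \<delta>"] by (smt (verit))+
    then show "radial_cutoff \<phi> \<epsilon> \<delta> t = 0" by (simp add: radial_cutoff_def) }
  { assume t: "t \<ge> 3 * sqrt n * \<delta>"
    then have t0: "t \<ge> 0" using e by (meson less_eq_real_def mult_nonneg_nonneg order_trans real_sqrt_ge_zero of_nat_0_le_iff zero_le_numeral less_trans)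
    have "t / \<delta> \<le> t / \<epsilon>" using t0 e by (intro divide_left_mono) auto
    moreover have "3 * sqrt n \<le> t / \<delta>" using t e by (simp add: pos_le_divide_eq)
    moreover have "0 \<le> t / \<epsilon>" "0 \<le> t / \<delta>" using t0 e by auto
    ultimately have "3 * sqrt n \<le> t / \<epsilon>" "3 * sqrt n \<le> t / \<delta>" "0 \<le> t / \<epsilon>" "0 \<le> t / \<delta>"
      by linarith+
    then have "\<phi> (t / \<epsilon>) = 1" "\<phi> (t / \<delta>) = 1"
      using p[of "t / \<epsilon>"] p[of "t / \<delta>"] by (smt (verit))+
    then show "radial_cutoff \<phi> \<epsilon> \<delta> t = 0" by (simp add: radial_cutoff_def) }
qed

text \<open>The factor \<open>\<delta> - \<epsilon>\<close> comes from the mean value theorem in the dilation parameter \<open>s = 1 / \<epsilon>\<close>.\<close>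

lemma radial_cutoff_bounds:
  assumes \<phi>: "cutoff_profile n \<phi>"
  shows "\<exists>C>0. \<forall>\<epsilon> \<delta> l t. 0 < l \<and> l / 2 \<le> \<epsilon> \<and> \<epsilon> < \<delta> \<and> \<delta> < l \<and> 0 < t \<longrightarrow>
     \<bar>radial_cutoff \<phi> \<epsilon> \<delta> t\<bar> \<le> C * ((\<delta> - \<epsilon>) / l) \<and>
     (\<exists>D. (radial_cutoff \<phi> \<epsilon> \<delta> has_real_derivative D) (at t) \<and> \<bar>D\<bar> \<le> C * ((\<delta> - \<epsilon>) / l) / l)"
proof -
  obtain \<phi>1 \<phi>2 M where d1: "\<And>t. t \<ge> 0 \<Longrightarrow> (\<phi> has_real_derivative \<phi>1 t) (at t within {0..})"
    and d2: "\<And>t. t \<ge> 0 \<Longrightarrow> (\<phi>1 has_real_derivative \<phi>2 t) (at t within {0..})"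
    and M1: "\<And>t. 0 \<le> t \<Longrightarrow> t \<le> 6 * sqrt n \<Longrightarrow> \<bar>\<phi>1 t\<bar> \<le> M"
    and M2: "\<And>t. 0 \<le> t \<Longrightarrow> t \<le> 6 * sqrt n \<Longrightarrow> \<bar>\<phi>2 t\<bar> \<le> M" and M: "M > 0"
    using cutoff_profile_derivatives[OF \<phi>] by metis
  have D1: "(\<phi> has_real_derivative \<phi>1 t) (at t)" and D2: "(\<phi>1 has_real_derivative \<phi>2 t) (at t)"
    if "t > 0" for t
    using d1[of t] d2[of t] that at_within_interior[of t "{0..}"] by (auto simp: interior_real_atLeast)
  \<comment> \<open>Large enough for the value, which needs \<open>12 * sqrt n * M\<close>, and for
    the derivative, which needs \<open>4 * (6 * sqrt n * M + M)\<close>. Both contain the 4 of the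
    bound \<open>inv'\<close> below.\<close>
  define C where "C = (12 * sqrt n * M + M) * 4"
  have "C > 0" using M by (simp add: C_def add_nonneg_pos)
  moreover have "\<bar>radial_cutoff \<phi> \<epsilon> \<delta> t\<bar> \<le> C * ((\<delta> - \<epsilon>) / l) \<and>
     (\<exists>D. (radial_cutoff \<phi> \<epsilon> \<delta> has_real_derivative D) (at t) \<and> \<bar>D\<bar> \<le> C * ((\<delta> - \<epsilon>) / l) / l)"
    if l: "0 < l" "l / 2 \<le> \<epsilon>" "\<epsilon> < \<delta>" "\<delta> < l" "0 < t" for \<epsilon> \<delta> l t
  proof -
    have e: "0 < \<epsilon>" "0 < \<delta>" using l by linarith+
    have C0: "0 \<le> C * ((\<delta> - \<epsilon>) / l)" using \<open>C > 0\<close> l by simp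
    have der: "(radial_cutoff \<phi> \<epsilon> \<delta> has_real_derivative \<phi>1 (t / \<epsilon>) / \<epsilon> - \<phi>1 (t / \<delta>) / \<delta>) (at t)"
      if "0 < t" for t
      unfolding radial_cutoff_def[abs_def] using that e
      by (auto intro!: derivative_eq_intros DERIV_chain2[OF D1])
    show ?thesis
    proof (cases "t \<le> 3 * sqrt n * l")
      \<comment> \<open>Beyond the outer radius the cutoff vanishes on a neighbourhood of
        \<open>t\<close>, so its derivative is 0 too.\<close>
      case False
      then have far: "\<forall>s>3 * sqrt n * \<delta>. radial_cutoff \<phi> \<epsilon> \<delta> s = 0"
        using radial_cutoff_eq_0(2)[OF \<phi> e(1) l(3)] by auto
      have "3 * sqrt n * \<delta> \<le> 3 * sqrt n * l" using l by (intro mult_left_mono) auto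
      then have t: "t > 3 * sqrt n * \<delta>" using False by linarith
      have "(radial_cutoff \<phi> \<epsilon> \<delta> has_real_derivative 0) (at t)"
        using far t by (intro has_field_derivative_transform_within_open[OF DERIV_const, where S="{3 * sqrt n * \<delta><..}"]) auto
      moreover have "0 \<le> C * ((\<delta> - \<epsilon>) / l) / l" using C0 l(1) by (intro divide_nonneg_nonneg) auto
      ultimately show ?thesis using far t C0 by (metis abs_zero)
    next
      case True
      have inv: "1 / \<delta> < 1 / \<epsilon>" using e l by (simp add: field_simps)
      have s: "0 < t * s" "t * s \<le> 6 * sqrt n" "s \<le> 2 / l" "0 < s" if "1 / \<delta> \<le> s" "s \<le> 1 / \<epsilon>" for s
      proof -
        have "1 / \<epsilon> \<le> 2 / l" using l e by (simp add: field_simps)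
        then show sl: "s \<le> 2 / l" using that by linarith
        have "0 < 1 / \<delta>" using e by simp
        then show s0: "0 < s" using that by linarith
        then show "0 < t * s" using l by simp
        have "t * s \<le> 3 * sqrt n * l * (2 / l)" using True sl s0 l by (intro mult_mono) auto
        then show "t * s \<le> 6 * sqrt n" using l by simp
      qed
      have inv': "1 / \<epsilon> - 1 / \<delta> \<le> 4 * ((\<delta> - \<epsilon>) / l) / l"
      proof -
        have "l / 2 * (l / 2) \<le> \<epsilon> * \<delta>" using l by (intro mult_mono) auto
        then have "(\<delta> - \<epsilon>) / (\<epsilon> * \<delta>) \<le> (\<delta> - \<epsilon>) / (l / 2 * (l / 2))"
          using l e by (intro divide_left_mono) auto
        moreover have "1 / \<epsilon> - 1 / \<delta> = (\<delta> - \<epsilon>) / (\<epsilon> * \<delta>)" using e by (simp add: field_simps)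
        ultimately show ?thesis by (simp add: field_simps)
      qed
      have "\<exists>s. 1 / \<delta> < s \<and> s < 1 / \<epsilon> \<and> \<phi> (t * (1 / \<epsilon>)) - \<phi> (t * (1 / \<delta>)) = (1 / \<epsilon> - 1 / \<delta>) * (\<phi>1 (t * s) * t)"
        using inv s by (intro MVT2) (auto intro!: derivative_eq_intros DERIV_chain2[OF D1])
      then obtain s where s1: "1 / \<delta> < s" "s < 1 / \<epsilon>" and
        eq1: "radial_cutoff \<phi> \<epsilon> \<delta> t = (1 / \<epsilon> - 1 / \<delta>) * (\<phi>1 (t * s) * t)"
        by (auto simp: radial_cutoff_def)
      have "\<bar>\<phi>1 (t * s) * t\<bar> \<le> M * (3 * sqrt n * l)"
        using M1[of "t * s"] s[of s] s1 True l M by (auto simp: abs_mult intro!: mult_mono)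
      then have "\<bar>radial_cutoff \<phi> \<epsilon> \<delta> t\<bar> \<le> (4 * ((\<delta> - \<epsilon>) / l) / l) * (M * (3 * sqrt n * l))"
        unfolding eq1 abs_mult[of "1 / \<epsilon> - 1 / \<delta>"] using inv inv' l by (intro mult_mono[OF _ \<open>\<bar>\<phi>1 (t * s) * t\<bar> \<le> _\<close>]) auto
      also have "\<dots> = 12 * sqrt n * M * ((\<delta> - \<epsilon>) / l)" using l by simp
      also have "\<dots> \<le> C * ((\<delta> - \<epsilon>) / l)" using l M unfolding C_def by (intro mult_right_mono) auto
      finally have A: "\<bar>radial_cutoff \<phi> \<epsilon> \<delta> t\<bar> \<le> C * ((\<delta> - \<epsilon>) / l)" .
      \<comment> \<open>For fixed \<open>s\<close>, the derivative of \<open>\<phi> (t * s)\<close>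
        in \<open>t\<close> is \<open>\<phi>1 (t * s) * s\<close>; now this expression is varied in
        \<open>s\<close>.\<close>
      have "\<exists>s. 1 / \<delta> < s \<and> s < 1 / \<epsilon> \<and>
          \<phi>1 (t * (1 / \<epsilon>)) * (1 / \<epsilon>) - \<phi>1 (t * (1 / \<delta>)) * (1 / \<delta>) = (1 / \<epsilon> - 1 / \<delta>) * (\<phi>2 (t * s) * t * s + \<phi>1 (t * s))"
        using inv s by (intro MVT2) (auto intro!: derivative_eq_intros DERIV_chain2[OF D2])
      then obtain s where s2: "1 / \<delta> < s" "s < 1 / \<epsilon>" and
        eq2: "\<phi>1 (t / \<epsilon>) / \<epsilon> - \<phi>1 (t / \<delta>) / \<delta> = (1 / \<epsilon> - 1 / \<delta>) * (\<phi>2 (t * s) * t * s + \<phi>1 (t * s))"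
        by auto
      have "\<bar>\<phi>2 (t * s) * (t * s)\<bar> \<le> M * (6 * sqrt n)"
        using M2[of "t * s"] s[of s] s2 M unfolding abs_mult[of "\<phi>2 (t * s)"] by (intro mult_mono) auto
      moreover have "\<bar>\<phi>1 (t * s)\<bar> \<le> M" using M1[of "t * s"] s[of s] s2 by auto
      ultimately have "\<bar>\<phi>2 (t * s) * t * s + \<phi>1 (t * s)\<bar> \<le> M * (6 * sqrt n) + M"
        by (simp add: mult.assoc)
      then have "\<bar>\<phi>1 (t / \<epsilon>) / \<epsilon> - \<phi>1 (t / \<delta>) / \<delta>\<bar> \<le> (4 * ((\<delta> - \<epsilon>) / l) / l) * (M * (6 * sqrt n) + M)"
        unfolding eq2 abs_mult[of "1 / \<epsilon> - 1 / \<delta>"] using inv inv' l by (intro mult_mono) auto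
      also have "\<dots> = (6 * sqrt n * M + M) * 4 * (((\<delta> - \<epsilon>) / l) / l)" by (simp only: mult_ac times_divide_eq_left times_divide_eq_right)
      also have "\<dots> \<le> C * (((\<delta> - \<epsilon>) / l) / l)" using l M unfolding C_def by (intro mult_right_mono) auto
      finally show ?thesis using A der[OF l(5)] by (auto intro!: exI)
    qed
  qed
  ultimately show ?thesis by blast
qed

text \<open>Both bounds are linear in \<open>(\<delta> - \<epsilon>) / l\<close>, which later allows
  the increments of one scale to be summed.\<close>

definition trunc_kernel_bounded ::
  "real \<Rightarrow> (real \<Rightarrow> real) \<Rightarrow> ((real^'n) \<times> (real^'m) \<Rightarrow> real) \<Rightarrow> bool" where
  "trunc_kernel_bounded C \<phi> K \<longleftrightarrow> (\<forall>\<epsilon> \<delta> l. 0 < l \<and> l / 2 \<le> \<epsilon> \<and> \<epsilon> < \<delta> \<and> \<delta> < l \<longrightarrow>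
     (\<forall>z. \<bar>trunc_kernel \<phi> K \<epsilon> \<delta> z\<bar> \<le> C * ((\<delta> - \<epsilon>) / l) / l ^ CARD('n)) \<and>
     (C * ((\<delta> - \<epsilon>) / l) / l ^ (CARD('n) + 1))-lipschitz_on UNIV (trunc_kernel \<phi> K \<epsilon> \<delta>))"

text \<open>Where the cutoff is not locally zero, \<open>norm z\<close> is at least
  \<open>l\<close>, so the decay of \<open>K\<close> and of its gradient turns into powers of
  \<open>l\<close> and the product rule bounds the derivative. A derivative bound on the whole space
  is a Lipschitz bound.\<close>

lemma trunc_kernel_bounds:
  fixes K :: "(real^'n) \<times> (real^'m) \<Rightarrow> real"
  assumes K: "CZ_kernel CARD('n) c K" and \<phi>: "cutoff_profile CARD('n) \<phi>"
  shows "\<exists>C>0. trunc_kernel_bounded C \<phi> K"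
proof -
  let ?n = "CARD('n)"
  obtain G :: "(real^'n) \<times> (real^'m) \<Rightarrow> (real^'n) \<times> (real^'m)" where
    dK: "\<And>x. x \<noteq> 0 \<Longrightarrow> (K has_derivative (\<lambda>h. G x \<bullet> h)) (at x)" and
    bK: "\<And>x. x \<noteq> 0 \<Longrightarrow> \<bar>K x\<bar> \<le> c / norm x ^ ?n" and
    bG: "\<And>x. x \<noteq> 0 \<Longrightarrow> norm (G x) \<le> c / norm x ^ (?n + 1)"
    using K unfolding CZ_kernel_def by blast
  obtain C where C: "C > 0" and rc: "\<And>\<epsilon> \<delta> l t. 0 < l \<Longrightarrow> l / 2 \<le> \<epsilon> \<Longrightarrow> \<epsilon> < \<delta> \<Longrightarrow> \<delta> < l \<Longrightarrow> 0 < t \<Longrightarrow>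
     \<bar>radial_cutoff \<phi> \<epsilon> \<delta> t\<bar> \<le> C * ((\<delta> - \<epsilon>) / l) \<and>
     (\<exists>D. (radial_cutoff \<phi> \<epsilon> \<delta> has_real_derivative D) (at t) \<and> \<bar>D\<bar> \<le> C * ((\<delta> - \<epsilon>) / l) / l)"
    using radial_cutoff_bounds[OF \<phi>] by blast
  \<comment> \<open>The 2 covers the two terms of the product rule; the \<open>+ 1\<close> keeps the
    constant positive if \<open>c = 0\<close>.\<close>
  define C' where "C' = 2 * C * (\<bar>c\<bar> + 1)"
  have "C' > 0" using C by (simp add: C'_def)
  moreover have "\<bar>trunc_kernel \<phi> K \<epsilon> \<delta> z\<bar> \<le> C' * ((\<delta> - \<epsilon>) / l) / l ^ ?n \<and>
     (\<exists>D. (trunc_kernel \<phi> K \<epsilon> \<delta> has_derivative D) (at z) \<and> onorm D \<le> C' * ((\<delta> - \<epsilon>) / l) / l ^ (?n + 1))"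
    if l: "0 < l" "l / 2 \<le> \<epsilon>" "\<epsilon> < \<delta>" "\<delta> < l" for \<epsilon> \<delta> l z
  proof -
    have e: "0 < \<epsilon>" using l by linarith
    have C'0: "0 \<le> C' * ((\<delta> - \<epsilon>) / l)" using \<open>C' > 0\<close> l by simp
    have n1: "sqrt ?n \<ge> 1" by (simp add: Suc_leI)
    let ?r = "2.1 * sqrt ?n * \<epsilon>"
    show ?thesis
    proof (cases "norm (fst z) < ?r")
      case True
      have zero: "trunc_kernel \<phi> K \<epsilon> \<delta> w = 0" if "norm (fst w) < ?r" for w
        using radial_cutoff_eq_0(1)[OF \<phi> e l(3), of "norm (fst w)"] that by (simp add: trunc_kernel_def)
      have "open {w :: (real^'n) \<times> (real^'m). norm (fst w) < ?r}"
        by (intro open_Collect_less continuous_intros)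
      then have "(trunc_kernel \<phi> K \<epsilon> \<delta> has_derivative (\<lambda>h. 0)) (at z)"
        using has_derivative_transform_within_open[of "\<lambda>w. 0" "\<lambda>h. 0" z UNIV "{w. norm (fst w) < ?r}" "trunc_kernel \<phi> K \<epsilon> \<delta>"]
          True zero by auto
      moreover have "0 \<le> C' * ((\<delta> - \<epsilon>) / l) / l ^ k" for k using C'0 l(1) by (intro divide_nonneg_nonneg) auto
      ultimately show ?thesis using zero[OF True] by (metis abs_zero onorm_zero)
    next
      case False
      \<comment> \<open>Since \<open>l \<le> 2 * \<epsilon>\<close>, the inner radius
        \<open>2.1 * sqrt n * \<epsilon>\<close> exceeds \<open>l\<close>.\<close>
      have "l * 1 \<le> 2.1 * \<epsilon> * sqrt ?n" using l e n1 by (intro mult_mono) auto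
      then have lz: "l \<le> norm (fst z)" using False by (simp add: mult_ac)
      have lz': "l \<le> norm z" using lz norm_fst_le[of "fst z" "snd z"] by simp
      then have z: "z \<noteq> 0" "fst z \<noteq> 0" using lz l by auto
      let ?\<eta> = "(\<delta> - \<epsilon>) / l"
      have c0: "0 \<le> c" 
        using order_trans[OF abs_ge_zero bK[OF z(1)]] z(1)
        by (metis not_le divide_neg_pos zero_less_norm_iff zero_less_power)
      have cl: "c / norm z ^ k \<le> c / l ^ k" for k
        using l(1) lz' c0 z by (intro divide_left_mono power_mono mult_pos_pos zero_less_power) auto
      have bK': "\<bar>K z\<bar> \<le> c / l ^ ?n" "norm (G z) \<le> c / l ^ (?n + 1)"
        by (rule order_trans[OF bK[OF z(1)] cl], rule order_trans[OF bG[OF z(1)] cl])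
      obtain D where D: "(radial_cutoff \<phi> \<epsilon> \<delta> has_real_derivative D) (at (norm (fst z)))" "\<bar>D\<bar> \<le> C * ?\<eta> / l"
        and rb: "\<bar>radial_cutoff \<phi> \<epsilon> \<delta> (norm (fst z))\<bar> \<le> C * ?\<eta>"
        using rc[OF l, of "norm (fst z)"] z by auto
      let ?D = "\<lambda>h. radial_cutoff \<phi> \<epsilon> \<delta> (norm (fst z)) * (G z \<bullet> h) + (D * (sgn (fst z) \<bullet> fst h)) * K z"
      have "\<bar>trunc_kernel \<phi> K \<epsilon> \<delta> z\<bar> \<le> (C * ?\<eta>) * (c / l ^ ?n)"
        unfolding trunc_kernel_def abs_mult using rb bK' C l by (intro mult_mono) auto
      also have "\<dots> \<le> C' * ?\<eta> / l ^ ?n"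
      proof -
        have "C * c \<le> C'" using C c0 unfolding C'_def by (simp add: algebra_simps)
        then have "(C * c) * (?\<eta> / l ^ ?n) \<le> C' * (?\<eta> / l ^ ?n)" using l by (intro mult_right_mono) auto
        then show ?thesis by (simp add: mult_ac)
      qed
      finally have 1: "\<bar>trunc_kernel \<phi> K \<epsilon> \<delta> z\<bar> \<le> C' * ?\<eta> / l ^ ?n" .
      have dn: "((\<lambda>w. norm (fst w)) has_derivative (\<lambda>h. sgn (fst z) \<bullet> fst h)) (at z)"
        using has_derivative_compose[OF bounded_linear_imp_has_derivative[OF bounded_linear_fst] has_derivative_norm[OF z(2)]]
        by (simp add: inner_commute)
      have "(trunc_kernel \<phi> K \<epsilon> \<delta> has_derivative ?D) (at z)"
        unfolding trunc_kernel_def[abs_def]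
        by (intro has_derivative_mult dK z has_derivative_compose[OF dn D(1)[unfolded has_field_derivative_def]])
      moreover have "onorm ?D \<le> C' * ?\<eta> / l ^ (?n + 1)"
      proof (rule onorm_bound)
        show "0 \<le> C' * ?\<eta> / l ^ (?n + 1)" using C'0 l(1) by (intro divide_nonneg_nonneg) auto
        fix h :: "(real^'n) \<times> (real^'m)"
        have "\<bar>radial_cutoff \<phi> \<epsilon> \<delta> (norm (fst z)) * (G z \<bullet> h)\<bar> \<le> (C * ?\<eta>) * (c / l ^ (?n + 1) * norm h)"
          unfolding abs_mult using rb C l c0
          by (intro mult_mono order_trans[OF Cauchy_Schwarz_ineq2] bK') auto
        moreover have "\<bar>(D * (sgn (fst z) \<bullet> fst h)) * K z\<bar> \<le> (C * ?\<eta> / l * (1 * norm h)) * (c / l ^ ?n)"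
          unfolding abs_mult using D(2) C l c0 norm_fst_le[of "fst h" "snd h"]
          by (intro mult_mono order_trans[OF Cauchy_Schwarz_ineq2] bK') (auto simp: norm_sgn)
        ultimately have "norm (?D h) \<le> (C * ?\<eta>) * (c / l ^ (?n + 1) * norm h) + (C * ?\<eta> / l * (1 * norm h)) * (c / l ^ ?n)"
          unfolding real_norm_def by (intro order_trans[OF abs_triangle_ineq add_mono])
        also have "\<dots> = (2 * C * c) * (?\<eta> / l ^ (?n + 1) * norm h)" by simp
        also have "\<dots> \<le> C' * (?\<eta> / l ^ (?n + 1) * norm h)"
        proof (rule mult_right_mono)
          show "2 * C * c \<le> C'" using C c0 unfolding C'_def by simp
          show "0 \<le> ?\<eta> / l ^ (?n + 1) * norm h"
            using l by (intro mult_nonneg_nonneg divide_nonneg_nonneg) auto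
        qed
        finally show "norm (?D h) \<le> C' * ?\<eta> / l ^ (?n + 1) * norm h" by (simp add: mult_ac)
      qed
      ultimately show ?thesis using 1 by blast
    qed
  qed
  moreover have "(C' * ((\<delta> - \<epsilon>) / l) / l ^ (?n + 1))-lipschitz_on UNIV (trunc_kernel \<phi> K \<epsilon> \<delta>)"
    if l: "0 < l" "l / 2 \<le> \<epsilon>" "\<epsilon> < \<delta>" "\<delta> < l" for \<epsilon> \<delta> l
  proof -
    obtain D where "\<And>z. (trunc_kernel \<phi> K \<epsilon> \<delta> has_derivative D z) (at z)"
      "\<And>z. onorm (D z) \<le> C' * ((\<delta> - \<epsilon>) / l) / l ^ (?n + 1)"
      using calculation(2)[OF l] by metis
    then show ?thesis
      using l \<open>C' > 0\<close> by (intro bounded_derivative_imp_lipschitz[of UNIV _ D]) auto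
  qed
  ultimately show ?thesis unfolding trunc_kernel_bounded_def by blast
qed

lemma trunc_kernel_uminus:
  assumes K: "CZ_kernel n c K"
  shows "trunc_kernel \<phi> K \<epsilon> \<delta> (- z) = - trunc_kernel \<phi> K \<epsilon> \<delta> z"
proof (cases "z = 0")
  case True
  \<comment> \<open>The value \<open>K 0\<close> is arbitrary, but at 0 the two dilated profiles
    cancel.\<close>
  then show ?thesis by (simp add: trunc_kernel_def radial_cutoff_def)
next
  case False
  then have "K (- z) = - K z" using K unfolding CZ_kernel_def by blast
  then show ?thesis by (simp add: trunc_kernel_def)
qed

lemma trunc_kernel_eq_0:
  fixes K :: "(real^'n) \<times> (real^'m) \<Rightarrow> real"
  assumes \<phi>: "cutoff_profile CARD('n) \<phi>" and e: "0 < \<epsilon>" "\<epsilon> < \<delta>" "\<delta> < l"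
    and "3 * sqrt CARD('n) * l \<le> norm (fst z)"
  shows "trunc_kernel \<phi> K \<epsilon> \<delta> z = 0"
proof -
  have "3 * sqrt CARD('n) * \<delta> \<le> 3 * sqrt CARD('n) * l" using e by (intro mult_left_mono) auto
  then have "radial_cutoff \<phi> \<epsilon> \<delta> (norm (fst z)) = 0"
    using assms by (intro radial_cutoff_eq_0(2)[OF \<phi> e(1,2)]) linarith
  then show ?thesis by (simp add: trunc_kernel_def)
qed

subsection \<open>Affine planes\<close>

lemma nplanes_closest_point:
  fixes L :: "'a::euclidean_space set"
  assumes "L \<in> nplanes n"
  obtains p where "p \<in> L" "infdist x L = dist x p"
proof -
  have "L \<noteq> {}" "closed L"
    using assms closed_affine_hull[of L] by (auto simp: nplanes_def affine_hull_eq[THEN iffD2])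
  then show thesis using infdist_attains_inf[of L x] that by blast
qed

lemma nplanes_closed: "L \<in> nplanes n \<Longrightarrow> closed (L :: 'a::euclidean_space set)"
  using closed_affine_hull[of L] by (simp add: nplanes_def affine_hull_eq[THEN iffD2])

text \<open>Planes are convex, so the midpoint of the two nearest points is a competitor.\<close>

lemma infdist_midpoint_nplanes_le:
  fixes L :: "'a::euclidean_space set"
  assumes L: "L \<in> nplanes n" and "infdist x L \<le> d" "infdist y L \<le> d"
  shows "infdist (midpoint x y) L \<le> d"
proof -
  obtain p q where p: "p \<in> L" "infdist x L = dist x p" and q: "q \<in> L" "infdist y L = dist y q"
    using nplanes_closest_point[OF L] by metis
  have "affine L" using L by (simp add: nplanes_def)
  then have "midpoint p q \<in> L"
    using p q unfolding midpoint_def affine_def by (simp add: scaleR_right_distrib field_simps)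
  then have "infdist (midpoint x y) L \<le> dist (midpoint x y) (midpoint p q)" by (rule infdist_le)
  also have "\<dots> = norm ((1/2) *\<^sub>R (x - p) + (1/2) *\<^sub>R (y - q))"
    by (simp add: dist_norm midpoint_def algebra_simps)
  also have "\<dots> \<le> d" using norm_triangle_ineq[of "(1/2) *\<^sub>R (x - p)" "(1/2) *\<^sub>R (y - q)"] p q assms
    by (simp add: dist_norm)
  finally show ?thesis .
qed

text \<open>If \<open>u\<close> is a direction of the plane, the directions orthogonal to \<open>u\<close> project onto less than
  \<open>n\<close> dimensions, so some unit vector \<open>e\<close> only sees the \<open>u\<close>-component of a direction. A pair of
  points of the plane that are far apart in direction \<open>e\<close> thus bounds the slope of \<open>u\<close>.\<close>

lemma nplanes_slope_bound:
  fixes L :: "((real^'n) \<times> (real^'m)) set"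
  assumes L: "L \<in> nplanes CARD('n)" and r: "r > 0"
    and spread: "\<And>e. norm e = 1 \<Longrightarrow> \<exists>q1\<in>L. \<exists>q2\<in>L. r \<le> e \<bullet> fst (q2 - q1) \<and> norm (q2 - q1) \<le> B * r"
    and p: "p \<in> L" "q \<in> L"
  shows "norm (p - q) \<le> B * norm (fst (p - q))"
proof (cases "p = q")
  case True
  then show ?thesis by simp
next
  case False
  define u where "u = p - q"
  have u: "u \<noteq> 0" using False by (simp add: u_def)
  define V where "V = (\<lambda>x. x - q) ` L"
  have aff: "affine L" using L by (simp add: nplanes_def)
  have V: "subspace V" "dim V = CARD('n)"
    using affine_diffs_subspace_subtract[OF aff p(2)] aff_dim_dim_affine_diffs[OF aff p(2)] L
    by (simp_all add: V_def nplanes_def)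
  have uV: "u \<in> V" using p by (simp add: u_def V_def)
  define W where "W = {v \<in> V. u \<bullet> v = 0}"
  have W: "subspace W" using V(1) unfolding W_def
    by (auto simp: subspace_def inner_add_right)
  have "W \<subseteq> V" "u \<notin> W" using u by (auto simp: W_def)
  \<comment> \<open>\<open>W\<close> misses \<open>u\<close> and is thus a proper subspace of
    \<open>V\<close>. Its projection cannot fill the base, which leaves a direction \<open>e\<close>
    orthogonal to that projection.\<close>
  then have "dim W < CARD('n)"
    using subspace_dim_equal[OF W V(1)] dim_subset[of W V] V(2) uV by fastforce
  moreover have "dim (fst ` W) \<le> dim W" by (intro dim_image_le linear_fst)
  ultimately have "dim (fst ` W) < DIM(real^'n)" by simp
  then obtain e' where e': "e' \<noteq> 0" "\<And>y. y \<in> span (fst ` W) \<Longrightarrow> orthogonal e' y"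
    using orthogonal_to_subspace_exists[of "fst ` W"] by metis
  define e where "e = sgn e'"
  have e: "norm e = 1" "\<And>w. w \<in> W \<Longrightarrow> e \<bullet> fst w = 0"
    using e'(1) e'(2)[OF span_base] by (auto simp: e_def norm_sgn orthogonal_def sgn_div_norm)
  obtain q1 q2 where q: "q1 \<in> L" "q2 \<in> L" "r \<le> e \<bullet> fst (q2 - q1)" "norm (q2 - q1) \<le> B * r"
    using spread[OF e(1)] by blast
  define v where "v = q2 - q1"
  have "q + 1 *\<^sub>R (q2 - q1) \<in> L" by (rule mem_affine_3_minus[OF aff p(2) q(2,1)])
  then have vV: "v \<in> V" unfolding V_def v_def by (intro image_eqI[of _ _ "q + (q2 - q1)"]) auto
  define a where "a = (u \<bullet> v) / (u \<bullet> u)"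
  have "v - a *\<^sub>R u \<in> W"
    using u vV uV V(1) by (auto simp: W_def a_def inner_diff_right subspace_diff subspace_scale)
  from e(2)[OF this] have ev: "e \<bullet> fst v = a * (e \<bullet> fst u)" by (simp add: inner_diff_right)
  have "\<bar>u \<bullet> v\<bar> \<le> norm u * (B * r)"
    using q(4) by (intro order_trans[OF Cauchy_Schwarz_ineq2] mult_left_mono) (auto simp: v_def)
  then have "\<bar>a\<bar> \<le> norm u * (B * r) / (u \<bullet> u)" by (simp add: a_def divide_right_mono)
  also have "\<dots> = B * r / norm u" using u by (simp add: dot_square_norm power2_eq_square)
  finally have a: "\<bar>a\<bar> \<le> B * r / norm u" .
  \<comment> \<open>The whole spread in direction \<open>e\<close> comes from the
    \<open>u\<close>-component of \<open>v\<close>. As its coefficient \<open>a\<close> is at most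
    \<open>B * r / norm u\<close>, the vector \<open>fst u\<close> cannot be small.\<close>
  have "r \<le> \<bar>a\<bar> * \<bar>e \<bullet> fst u\<bar>" using q(3) ev by (simp add: v_def abs_mult[symmetric])
  also have "\<dots> \<le> (B * r / norm u) * norm (fst u)"
    using a Cauchy_Schwarz_ineq2[of e "fst u"] e(1) by (intro mult_mono) (auto intro: order_trans[OF _ a])
  finally have "r * norm u \<le> r * (B * norm (fst u))" using u by (simp add: field_simps)
  then show ?thesis using r by (simp add: u_def)
qed

section \<open>Plane measures, Lipschitz test functions and avoidance of small sets\<close>

definition plane_measure :: "real \<Rightarrow> ((real^'n) \<times> (real^'m)) set \<Rightarrow> ((real^'n) \<times> (real^'m)) measure" where
  "plane_measure c L = density (hausdorff_measure CARD('n)) (\<lambda>x. ennreal c * indicator L x)"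

lemma sets_plane_measure [simp, measurable_cong]: "sets (plane_measure c L) = sets borel"
  by (simp add: plane_measure_def)

text \<open>The reflection in a point of \<open>L\<close> maps \<open>L\<close> onto itself and
  preserves Hausdorff measure.\<close>

lemma distr_plane_measure_point_reflection:
  fixes L :: "((real^'n) \<times> (real^'m)) set"
  assumes L: "L \<in> nplanes CARD('n)" and p: "p \<in> L"
  shows "distr (plane_measure c L) borel (\<lambda>y. 2 *\<^sub>R p - y) = plane_measure c L"
proof -
  let ?H = "hausdorff_measure CARD('n) :: ((real^'n) \<times> (real^'m)) measure"
  let ?r = "\<lambda>y. 2 *\<^sub>R p - y"
  have [measurable]: "L \<in> sets borel" using nplanes_closed[OF L] by simp
  have aff: "affine L" using L by (simp add: nplanes_def)
  have rL: "?r y \<in> L" if "y \<in> L" for y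
    using mem_affine_3_minus[OF aff p p that, of 1] by (simp add: scaleR_2 algebra_simps)
  have ind: "indicator L (?r y) = (indicator L y :: ennreal)" for y
    using rL[of y] rL[of "?r y"] by (auto simp: indicator_def)
  have "plane_measure c L = density (distr ?H borel ?r) (\<lambda>x. ennreal c * indicator L x)"
    by (simp add: plane_measure_def distr_hausdorff_measure_point_reflection)
  also have "\<dots> = distr (density ?H (\<lambda>x. ennreal c * indicator L (?r x))) borel ?r"
    by (rule density_distr) measurable
  also have "\<dots> = distr (plane_measure c L) borel ?r" by (simp add: ind plane_measure_def)
  finally show ?thesis by simp
qed

text \<open>Division by \<open>M\<close> leads to a 1-Lipschitz test function. Since
  \<open>dist_F\<close> is infinite once a test function fails to be integrable, a finite bound also
  yields integrability.\<close>

lemma dist_F_le_lipschitz: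
  assumes D: "dist_F F \<sigma> \<nu> \<le> ennreal D" "0 \<le> D"
    and M: "M-lipschitz_on UNIV g" "0 < M" and supp: "closure {x. g x \<noteq> 0} \<subseteq> F"
  shows "integrable \<sigma> g" "integrable \<nu> g" "\<bar>(\<integral>x. g x \<partial>\<sigma>) - (\<integral>x. g x \<partial>\<nu>)\<bar> \<le> M * D"
proof -
  define h where "h x = g x / M" for x
  have "1-lipschitz_on UNIV h"
  proof (rule lipschitz_onI)
    show "dist (h x) (h y) \<le> 1 * dist x y" for x y
      using lipschitz_onD[OF M(1), of x y] M(2)
      by (simp add: h_def dist_real_def diff_divide_distrib[symmetric] field_simps)
  qed simp
  moreover have "{x. h x \<noteq> 0} = {x. g x \<noteq> 0}" using M(2) by (simp add: h_def)
  ultimately have "(if integrable \<sigma> h \<and> integrable \<nu> h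
       then ennreal \<bar>(\<integral>x. h x \<partial>\<sigma>) - (\<integral>x. h x \<partial>\<nu>)\<bar> else \<infinity>) \<le> dist_F F \<sigma> \<nu>"
    unfolding dist_F_def using supp by (intro SUP_upper) auto
  then have "(if integrable \<sigma> h \<and> integrable \<nu> h
       then ennreal \<bar>(\<integral>x. h x \<partial>\<sigma>) - (\<integral>x. h x \<partial>\<nu>)\<bar> else \<infinity>) \<le> ennreal D"
    using D(1) by (rule order_trans)
  then have h: "integrable \<sigma> h" "integrable \<nu> h" "\<bar>(\<integral>x. h x \<partial>\<sigma>) - (\<integral>x. h x \<partial>\<nu>)\<bar> \<le> D"
    using D(2) by (auto split: if_splits simp: top_unique)
  have g: "g = (\<lambda>x. M * h x)" using M(2) by (auto simp: h_def)
  show "integrable \<sigma> g" "integrable \<nu> g" unfolding g using h by auto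
  have "(\<integral>x. g x \<partial>\<sigma>) - (\<integral>x. g x \<partial>\<nu>) = M * ((\<integral>x. h x \<partial>\<sigma>) - (\<integral>x. h x \<partial>\<nu>))"
    unfolding g by (simp add: right_diff_distrib)
  then show "\<bar>(\<integral>x. g x \<partial>\<sigma>) - (\<integral>x. g x \<partial>\<nu>)\<bar> \<le> M * D"
    using h(3) M(2) by (simp add: abs_mult)
qed

text \<open>The closed strip of radius \<open>r\<close> absorbs the closure, and the strict
  inequality puts it inside the open strip \<open>B_Q\<close>.\<close>

lemma closure_support_subset_B_Q:
  fixes g :: "(real^'n) \<times> (real^'m) \<Rightarrow> real"
  assumes "\<And>y. dist (fst y) (fst Q) > r \<Longrightarrow> g y = 0" and "r < C * snd Q"
  shows "closure {y. g y \<noteq> 0} \<subseteq> B_Q C Q"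
proof -
  have "closed {y :: (real^'n) \<times> (real^'m). dist (fst y) (fst Q) \<le> r}"
    by (intro closed_Collect_le continuous_intros)
  moreover have "{y. g y \<noteq> 0} \<subseteq> {y. dist (fst y) (fst Q) \<le> r}" using assms(1) by force
  ultimately have "closure {y. g y \<noteq> 0} \<subseteq> {y. dist (fst y) (fst Q) \<le> r}"
    by (rule closure_minimal[rotated])
  then show ?thesis using assms(2) by (auto simp: B_Q_def)
qed

text \<open>The affine map preserves Lebesgue measure, so \<open>E\<close> and its preimage are
  together too small to cover the ball. With \<open>s = 1\<close> this gives pairs with a prescribed
  displacement, with \<open>s = -1\<close> pairs with a prescribed midpoint.\<close>

lemma exists_pair_avoiding:
  fixes E :: "'a::euclidean_space set"
  assumes E: "E \<in> sets borel" and s: "\<bar>s\<bar> = 1" and small: "2 * emeasure lborel E < emeasure lborel (ball c r)"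
  obtains w where "w \<in> ball c r" "w \<notin> E" "t + s *\<^sub>R w \<notin> E"
proof -
  let ?\<tau> = "\<lambda>w. t + s *\<^sub>R w"
  have [measurable]: "?\<tau> \<in> borel_measurable borel"
    by (intro borel_measurable_continuous_onI continuous_intros)
  have "s \<noteq> 0" using s by auto
  then have "lborel = distr lborel borel ?\<tau>"
    using lborel_affine[of s t] s by (simp add: density_1)
  then have "emeasure lborel E = emeasure (distr lborel borel ?\<tau>) E" by simp
  also have "\<dots> = emeasure lborel (?\<tau> -` E)" using E by (simp add: emeasure_distr)
  finally have eq: "emeasure lborel (?\<tau> -` E) = emeasure lborel E" by simp
  have \<tau>E: "?\<tau> -` E \<in> sets borel" using measurable_sets[of ?\<tau> borel borel E] E by simp
  have "\<not> ball c r \<subseteq> E \<union> ?\<tau> -` E"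
  proof
    assume "ball c r \<subseteq> E \<union> ?\<tau> -` E"
    then have "emeasure lborel (ball c r) \<le> emeasure lborel (E \<union> ?\<tau> -` E)"
      using E \<tau>E by (intro emeasure_mono) auto
    also have "\<dots> \<le> 2 * emeasure lborel E"
      using emeasure_subadditive[of E lborel "?\<tau> -` E"] E \<tau>E by (simp add: eq mult_2)
    finally show False using small by simp
  qed
  then show thesis using that by blast
qed

subsection \<open>Measures comparable to Lebesgue measure on a Lipschitz graph\<close>

text \<open>Collects the properties of \<open>\<mu>\<close> behind the estimates: \<open>Cu\<close>
  bounds the mass of vertical strips and \<open>Cl\<close> compares Lebesgue measure on the base
  with \<open>\<mu>\<close>. The constants defined in this context depend only on \<open>Cu\<close>,
  \<open>Cl\<close>, \<Lambda> and the dimension, so they can be fixed before \<open>A\<close> is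
  given.\<close>

locale lipschitz_graph_measure =
  fixes A :: "real^'n \<Rightarrow> real^'m" and \<mu> :: "((real^'n) \<times> (real^'m)) measure" and \<Lambda> Cu Cl C\<Gamma> :: real
  assumes A_lip: "dist (A x) (A y) \<le> \<Lambda> * dist x y" and \<Lambda>: "0 \<le> \<Lambda>"
    and sets_\<mu> [simp, measurable_cong]: "sets \<mu> = sets borel"
    and AE_graph: "AE x in \<mu>. snd x = A (fst x)"
    and upper: "0 < r \<Longrightarrow> emeasure \<mu> {x. dist (fst x) z \<le> r} \<le> ennreal (Cu * r ^ CARD('n))"
    and lower: "E \<in> sets borel \<Longrightarrow> emeasure lborel E \<le> ennreal Cl * emeasure \<mu> (fst -` E)"
    and Cu: "0 < Cu" and Cl: "0 < Cl"
    and C\<Gamma>: "10 * sqrt (real CARD('n)) < C\<Gamma>"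
begin

lemma space_\<mu> [simp]: "space \<mu> = UNIV"
  using sets_eq_imp_space_eq[OF sets_\<mu>] by simp

lemma sqrt_card_ge_1: "1 \<le> sqrt (real CARD('n))"
  by (simp add: Suc_leI)

lemma nn_integral_strip_le:
  assumes r: "0 < r" and M: "0 \<le> M" and g: "\<And>y. g y \<le> M" "\<And>y. r < dist (fst y) z \<Longrightarrow> g y \<le> 0"
  shows "(\<integral>\<^sup>+y. ennreal (g y) \<partial>\<mu>) \<le> ennreal (M * (Cu * r ^ CARD('n)))"
proof -
  have [measurable]: "{x :: (real^'n) \<times> (real^'m). dist (fst x) z \<le> r} \<in> sets borel"
    by (intro borel_closed closed_Collect_le continuous_intros)
  have "(\<integral>\<^sup>+y. ennreal (g y) \<partial>\<mu>) \<le> (\<integral>\<^sup>+y. ennreal M * indicator {x. dist (fst x) z \<le> r} y \<partial>\<mu>)"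
    using g by (intro nn_integral_mono) (auto simp: indicator_def ennreal_leI ennreal_neg)
  also have "\<dots> = ennreal M * emeasure \<mu> {x. dist (fst x) z \<le> r}"
    by (rule nn_integral_cmult_indicator) simp
  also have "\<dots> \<le> ennreal M * ennreal (Cu * r ^ CARD('n))"
    using upper[OF r] by (intro mult_left_mono) auto
  finally show ?thesis using M by (simp add: ennreal_mult')
qed

lemma integral_strip_le:
  assumes r: "0 < r" and M: "0 \<le> M" and g: "\<And>y. \<bar>g y\<bar> \<le> M" "\<And>y. r < dist (fst y) z \<Longrightarrow> g y = 0"
  shows "\<bar>\<integral>y. g y \<partial>\<mu>\<bar> \<le> M * (Cu * r ^ CARD('n))"
proof (cases "integrable \<mu> g")
  case True
  have "ennreal (norm (\<integral>y. g y \<partial>\<mu>)) \<le> (\<integral>\<^sup>+y. ennreal (norm (g y)) \<partial>\<mu>)"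
    by (rule integral_norm_bound_ennreal[OF True])
  also have "\<dots> \<le> ennreal (M * (Cu * r ^ CARD('n)))"
    using g by (intro nn_integral_strip_le[OF r M, where z=z]) auto
  finally show ?thesis using M Cu r by (subst (asm) ennreal_le_iff) auto
next
  \<comment> \<open>A non-integrable function has integral 0 by convention.\<close>
  case False
  then show ?thesis using M Cu r by (simp add: not_integrable_integral_eq)
qed

text \<open>The first term bounds the \<mu>-integral of a tent of height and radius
  \<open>9 * sqrt n * l\<close>, divided by \<open>l ^ (n + 1)\<close>. The \<open>+ 1\<close> pays
  for passing to the plane measure when \<open>a \<le> 1\<close>.\<close>

definition kernel_const :: real where
  "kernel_const = Cu * (9 * sqrt (real CARD('n))) ^ (CARD('n) + 1) + 1"

lemma kernel_const_ge_1: "1 \<le> kernel_const"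
  using Cu sqrt_card_ge_1 by (simp add: kernel_const_def)

text \<open>The trivial bound, size times mass of the support, for cubes at which no good plane is
  available.\<close>

lemma integral_kernel_le_const:
  fixes k :: "(real^'n) \<times> (real^'m) \<Rightarrow> real"
  assumes l: "0 < l" and B: "0 < B"
    and k_bd: "\<And>z. \<bar>k z\<bar> \<le> B / l ^ CARD('n)"
    and k_supp: "\<And>z. 3 * sqrt (real CARD('n)) * l \<le> norm (fst z) \<Longrightarrow> k z = 0"
  shows "\<bar>\<integral>y. k (x - y) \<partial>\<mu>\<bar> \<le> kernel_const * B"
proof -
  let ?n = "CARD('n)" and ?s = "sqrt (real CARD('n))"
  have s1: "1 \<le> ?s" by (rule sqrt_card_ge_1)
  have "\<bar>\<integral>y. k (x - y) \<partial>\<mu>\<bar> \<le> (B / l ^ ?n) * (Cu * (3 * ?s * l) ^ ?n)"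
  proof (rule integral_strip_le[where z="fst x"])
    show "3 * ?s * l < dist (fst y) (fst x) \<Longrightarrow> k (x - y) = 0" for y
      by (rule k_supp) (simp add: dist_norm norm_minus_commute)
  qed (use l B s1 k_bd in auto)
  also have "\<dots> = B * (Cu * (3 * ?s) ^ ?n)" using l by (simp add: power_mult_distrib)
  also have "\<dots> \<le> B * (Cu * (9 * ?s) ^ (?n + 1))"
  proof -
    have "(3 * ?s) ^ ?n \<le> (9 * ?s) ^ (?n + 1)"
      using s1 power_mono[of "3 * ?s" "9 * ?s" ?n] power_increasing[of ?n "?n + 1" "9 * ?s"] by linarith
    then show ?thesis using B Cu by (intro mult_left_mono) auto
  qed
  also have "\<dots> \<le> kernel_const * B" using B by (simp add: kernel_const_def algebra_simps)
  finally show ?thesis .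
qed

text \<open>Let \<open>p\<close> be the point of \<open>L\<close> closest to \<open>x\<close>.
  Folding the plane integral by the reflection in \<open>p\<close> turns the odd kernel into a
  difference of two values at points \<open>2 * infdist x L\<close> apart, which the Lipschitz bound
  controls. The plane mass where this difference matters is bounded by testing with a tent function
  and comparing with \<mu>.\<close>

lemma integral_kernel_le:
  fixes k :: "(real^'n) \<times> (real^'m) \<Rightarrow> real"
  assumes l: "0 < l" and B: "0 < B"
    and k_bd: "\<And>z. \<bar>k z\<bar> \<le> B / l ^ CARD('n)"
    and k_lip: "(B / l ^ (CARD('n) + 1))-lipschitz_on UNIV k"
    and k_supp: "\<And>z. 3 * sqrt (real CARD('n)) * l \<le> norm (fst z) \<Longrightarrow> k z = 0"
    and k_odd: "\<And>z. k (- z) = - k z"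
    and x: "dist (fst x) z \<le> sqrt (real CARD('n)) * l / 2"
    and L: "L \<in> nplanes CARD('n)" and a: "0 \<le> a"
    and D: "dist_F (B_Q C\<Gamma> (z, l)) \<mu> (plane_measure c L) \<le> ennreal (a * l ^ (CARD('n) + 1))"
  shows "\<bar>\<integral>y. k (x - y) \<partial>\<mu>\<bar> \<le> kernel_const * B * min 1 (a + infdist x L / l)"
proof -
  let ?n = "CARD('n)" and ?s = "sqrt (real CARD('n))" and ?\<sigma> = "plane_measure c L"
  let ?h = "infdist x L" and ?M = "B / l ^ (CARD('n) + 1)"
  have s1: "1 \<le> ?s" by (rule sqrt_card_ge_1)
  have M: "0 < ?M" using B l by simp
  have sl: "l \<le> ?s * l" using s1 l by simp
  have C\<Gamma>l: "10 * ?s * l < C\<Gamma> * l" using C\<Gamma> l by simp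
  let ?T = "Cu * (9 * ?s) ^ (?n + 1)"
  have triv: "\<bar>\<integral>y. k (x - y) \<partial>\<mu>\<bar> \<le> kernel_const * B"
    by (rule integral_kernel_le_const[OF l B k_bd k_supp])
  show ?thesis
  proof (cases "a \<le> 1 \<and> ?h \<le> l")
    \<comment> \<open>If \<open>a > 1\<close> or \<open>x\<close> is farther than \<open>l\<close>
      from \<open>L\<close>, the minimum is 1 and the trivial bound applies.\<close>
    case False
    moreover have "0 \<le> ?h / l" using l infdist_nonneg[of x L] by simp
    moreover have "1 \<le> ?h / l" if "l \<le> ?h" using l that by simp
    ultimately have "1 \<le> a + ?h / l" using a by linarith
    then show ?thesis using triv by simp
  next
    case True
    obtain p where p: "p \<in> L" "?h = dist x p" using nplanes_closest_point[OF L] by blast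
    let ?r = "\<lambda>y. 2 *\<^sub>R p - y"
    let ?k = "\<lambda>y. k (x - y)"
    have lip_k: "?M-lipschitz_on UNIV ?k"
    proof (rule lipschitz_onI)
      fix y y'
      have "dist (x - y) (x - y') = dist y y'" by (simp add: dist_norm norm_minus_commute)
      then show "dist (k (x - y)) (k (x - y')) \<le> ?M * dist y y'"
        using lipschitz_onD[OF k_lip, of "x - y" "x - y'"] by (simp only: UNIV_I)
    qed (use M in simp)
    have "closure {y. ?k y \<noteq> 0} \<subseteq> B_Q C\<Gamma> (z, l)"
    \<comment> \<open>The kernel reaches \<open>3 * ?s * l\<close> from \<open>x\<close>, which lies
      within \<open>?s * l / 2\<close> of the centre; 4 is below the 10 in the bound on
      \<open>C\<Gamma>\<close>.\<close>
    proof (rule closure_support_subset_B_Q[where r="4 * ?s * l"])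
      fix y :: "(real^'n) \<times> (real^'m)" assume y: "4 * ?s * l < dist (fst y) (fst (z, l))"
      have "dist (fst y) z \<le> dist (fst y) (fst x) + dist (fst x) z" by (rule dist_triangle)
      then have "3 * ?s * l \<le> dist (fst y) (fst x)" using x y[unfolded fst_conv] sl l by linarith
      then have "3 * ?s * l \<le> norm (fst (x - y))" by (simp add: dist_norm norm_minus_commute)
      then show "?k y = 0" by (rule k_supp)
    qed (unfold snd_conv, use C\<Gamma>l sl l in linarith)
    note k = dist_F_le_lipschitz[OF D _ lip_k M this]
    have D0: "0 \<le> a * l ^ (?n + 1)" using a l by simp
    \<comment> \<open>The radius 9 still fits into \<open>B_Q\<close>. On the support of the folded
      kernel the horizontal distance from \<open>z\<close> is at most
      \<open>3.5 * ?s * l + 2 * l\<close>, so \<open>g\<close> is at least \<open>l\<close>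
      there.\<close>
    define g where "g y = max 0 (9 * ?s * l - dist (fst y) z)" for y :: "(real^'n) \<times> (real^'m)"
    have lip_g: "1-lipschitz_on UNIV g"
    proof (rule lipschitz_onI)
      fix y y' :: "(real^'n) \<times> (real^'m)"
      have "\<bar>dist (fst y) z - dist (fst y') z\<bar> \<le> dist (fst y) (fst y')"
        using abs_dist_diff_le[of "fst y" z "fst y'"] by (simp add: dist_commute)
      also have "\<dots> \<le> dist y y'" by (rule dist_fst_le)
      finally show "dist (g y) (g y') \<le> 1 * dist y y'" unfolding g_def dist_real_def by linarith
    qed simp
    have "closure {y. g y \<noteq> 0} \<subseteq> B_Q C\<Gamma> (z, l)"
    proof (rule closure_support_subset_B_Q[where r="9 * ?s * l"])
      show "9 * ?s * l < C\<Gamma> * snd (z, l)" unfolding snd_conv using C\<Gamma>l sl l by linarith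
    qed (simp add: g_def)
    note g = dist_F_le_lipschitz[OF D D0 lip_g zero_less_one this]
    have "\<bar>\<integral>y. g y \<partial>\<mu>\<bar> \<le> (9 * ?s * l) * (Cu * (9 * ?s * l) ^ ?n)"
      by (rule integral_strip_le[where z=z]) (use l s1 in \<open>auto simp: g_def\<close>)
    also have "\<dots> = ?T * l ^ (?n + 1)" by (simp add: power_mult_distrib)
    finally have "(\<integral>y. g y \<partial>?\<sigma>) \<le> ?T * l ^ (?n + 1) + a * l ^ (?n + 1)"
      using g(3) by linarith
    also have "\<dots> \<le> kernel_const * l ^ (?n + 1)"
      using True l by (simp add: kernel_const_def distrib_right[symmetric] del: power_Suc)
    finally have int_g: "(\<integral>y. g y \<partial>?\<sigma>) \<le> kernel_const * l ^ (?n + 1)" .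
    have r_meas: "?r \<in> borel_measurable borel"
      by (intro borel_measurable_continuous_onI continuous_intros)
    have k_meas: "?k \<in> borel_measurable borel"
      by (intro borel_measurable_continuous_onI lipschitz_on_continuous_on[OF lip_k])
    have ik: "integrable ?\<sigma> ?k" using k(2)[OF D0] .
    have "integrable (distr ?\<sigma> borel ?r) ?k" using ik by (simp add: distr_plane_measure_point_reflection[OF L p(1)])
    then have ikr: "integrable ?\<sigma> (\<lambda>y. ?k (?r y))"
      using r_meas k_meas by (subst (asm) integrable_distr_eq) (auto simp: plane_measure_def)
    have "(\<integral>y. ?k y \<partial>?\<sigma>) = (\<integral>y. ?k y \<partial>distr ?\<sigma> borel ?r)"
      by (simp add: distr_plane_measure_point_reflection[OF L p(1)])
    also have "\<dots> = (\<integral>y. ?k (?r y) \<partial>?\<sigma>)"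
      using r_meas k_meas by (intro integral_distr) (auto simp: plane_measure_def)
    finally have "2 * (\<integral>y. ?k y \<partial>?\<sigma>) = (\<integral>y. ?k y + ?k (?r y) \<partial>?\<sigma>)"
      using ik ikr by simp
    then have "2 * \<bar>\<integral>y. ?k y \<partial>?\<sigma>\<bar> = \<bar>\<integral>y. ?k y + ?k (?r y) \<partial>?\<sigma>\<bar>" by linarith
    \<comment> \<open>The factor \<open>g y / l\<close> is at least 1 wherever the folded kernel is
      nonzero, and it makes the majorant integrable.\<close>
    also have "\<dots> \<le> (\<integral>y. ?M * (2 * ?h) / l * g y \<partial>?\<sigma>)"
    proof (rule integral_abs_bound_integral)
      show "integrable ?\<sigma> (\<lambda>y. ?k y + ?k (?r y))" using ik ikr by simp
      show "integrable ?\<sigma> (\<lambda>y. ?M * (2 * ?h) / l * g y)" using g(2) by simp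
      fix y
      have Mh: "0 \<le> ?M * (2 * ?h) / l" using B l infdist_nonneg[of x L]
        by (intro divide_nonneg_nonneg mult_nonneg_nonneg) auto
      show "\<bar>?k y + ?k (?r y)\<bar> \<le> ?M * (2 * ?h) / l * g y"
      proof (cases "?k y = 0 \<and> ?k (?r y) = 0")
        case True
        moreover have "0 \<le> g y" by (simp add: g_def)
        ultimately show ?thesis using mult_nonneg_nonneg[OF Mh, of "g y"] by simp
      next
        case False
        have d: "dist (fst x) (fst p) \<le> ?h" using p(2) dist_fst_le[of x p] by simp
        have "dist (fst y) (fst x) \<le> 3 * ?s * l + 2 * ?h"
        proof (cases "?k y = 0")
          case False
          then show ?thesis using k_supp[of "x - y"] infdist_nonneg[of x L]
            by (force simp: dist_norm norm_minus_commute)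
        next
          case True
          then have "norm (fst (x - ?r y)) < 3 * ?s * l" using False k_supp[of "x - ?r y"] by force
          moreover have "fst (x - ?r y) = (fst y - fst x) + 2 *\<^sub>R (fst x - fst p)"
            by (simp add: scaleR_2 algebra_simps)
          ultimately have "norm ((fst y - fst x) + 2 *\<^sub>R (fst x - fst p)) < 3 * ?s * l" by (simp only:)
          moreover have "norm (fst y - fst x) \<le> norm ((fst y - fst x) + 2 *\<^sub>R (fst x - fst p)) + norm (2 *\<^sub>R (fst x - fst p))"
            using norm_triangle_ineq4[of "(fst y - fst x) + 2 *\<^sub>R (fst x - fst p)" "2 *\<^sub>R (fst x - fst p)"] by simp
          moreover have "norm (2 *\<^sub>R (fst x - fst p)) \<le> 2 * ?h" using d by (simp add: dist_norm)
          ultimately show ?thesis unfolding dist_norm by linarith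
        qed
        then have "dist (fst y) z \<le> 3 * ?s * l + 2 * ?h + ?s * l / 2"
          using dist_triangle[of "fst y" z "fst x"] x by linarith
        then have gl: "l \<le> g y" using True sl l \<open>a \<le> 1 \<and> ?h \<le> l\<close> unfolding g_def by linarith
        have "?k y + ?k (?r y) = k (x - y) - k (?r y - x)"
          using k_odd[of "?r y - x"] by simp
        also have "\<bar>\<dots>\<bar> \<le> ?M * dist (x - y) (?r y - x)"
          using lipschitz_onD[OF k_lip, of "x - y" "?r y - x"] by (simp add: dist_real_def)
        also have "dist (x - y) (?r y - x) = norm (2 *\<^sub>R (x - p))"
          by (simp add: dist_norm scaleR_2 algebra_simps)
        also have "\<dots> = 2 * ?h" by (simp add: p(2) dist_norm)
        also have "?M * (2 * ?h) = ?M * (2 * ?h) / l * l" using l by simp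
        also have "\<dots> \<le> ?M * (2 * ?h) / l * g y" by (rule mult_left_mono[OF gl Mh])
        finally show ?thesis .
      qed
    qed
    also have "\<dots> = ?M * (2 * ?h) / l * (\<integral>y. g y \<partial>?\<sigma>)" by simp
    also have "\<dots> \<le> ?M * (2 * ?h) / l * (kernel_const * l ^ (?n + 1))"
      using B l infdist_nonneg[of x L] by (intro mult_left_mono[OF int_g] divide_nonneg_nonneg mult_nonneg_nonneg) auto
    also have "\<dots> = 2 * (kernel_const * B * (?h / l))" using l by (simp add: field_simps)
    finally have 1: "\<bar>\<integral>y. ?k y \<partial>?\<sigma>\<bar> \<le> kernel_const * B * (?h / l)" by simp
    have "\<bar>(\<integral>y. ?k y \<partial>\<mu>) - (\<integral>y. ?k y \<partial>?\<sigma>)\<bar> \<le> ?M * (a * l ^ (?n + 1))" by (rule k(3)[OF D0])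
    also have "\<dots> = B * a" using l by simp
    also have "\<dots> \<le> kernel_const * B * a" 
      using mult_right_mono[OF kernel_const_ge_1, of "B * a"] B a by (simp add: mult.assoc)
    finally have "\<bar>\<integral>y. ?k y \<partial>\<mu>\<bar> \<le> kernel_const * B * (a + ?h / l)"
      using 1 by (simp add: distrib_left)
    moreover have "0 \<le> kernel_const * B" using kernel_const_ge_1 B by simp
    ultimately show ?thesis using triv by (simp add: min_def)
  qed
qed

section \<open>Base points over which the graph is far from a plane, and the resulting comparison of
  planes\<close>

text \<open>The radius \<open>2 * sqrt n * l\<close> has room for points within \<open>l\<close> of
  a base point of the cube, and for points less than \<open>2 * l\<close> from
  \<open>z\<close>.\<close>

definition bad_points ::
  "((real^'n) \<times> (real^'m)) set \<Rightarrow> ((real^'n) \<times> (real^'m)) set \<Rightarrow> real^'n \<Rightarrow> real \<Rightarrow> real \<Rightarrow> real \<Rightarrow> (real^'n) set" where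
  "bad_points L L' z l s t = {w. dist w z < 2 * sqrt (real CARD('n)) * l \<and>
     (s < infdist (w, A w) L \<or> t < infdist (w, A w) L')}"

lemma continuous_A: "continuous_on UNIV A"
  using A_lip \<Lambda> by (intro lipschitz_on_continuous_on[of \<Lambda>] lipschitz_onI) auto

lemma bad_points_borel: "bad_points L L' z l s t \<in> sets borel"
proof -
  have "bad_points L L' z l s t = {w. dist w z < 2 * sqrt (real CARD('n)) * l} \<inter>
     ({w. s < infdist (w, A w) L} \<union> {w. t < infdist (w, A w) L'})"
    by (auto simp: bad_points_def)
  moreover have "open \<dots>"
    by (intro open_Int open_Un open_Collect_less continuous_intros continuous_A)
  ultimately show ?thesis by simp
qed

text \<open>Two Markov inequalities. For \<open>L\<close> the test function is a capped distance to
  \<open>L\<close>: its plane integral vanishes, so its \<mu>-integral is at most the distance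
  between the measures. For \<open>L'\<close> the square mean is used. The hypothesis
  \<open>lower\<close> carries the result over to Lebesgue measure.\<close>

lemma emeasure_bad_points_le:
  assumes l: "0 < l" and a: "0 < a" and b: "0 < b" and N: "1 \<le> N" "N * a \<le> 1"
    and D: "dist_F (B_Q C\<Gamma> (z, l)) \<mu> (plane_measure c L) \<le> ennreal (a * l ^ (CARD('n) + 1))"
    and \<beta>: "(\<integral>\<^sup>+y\<in>vcube (z, l) C\<Gamma>. ennreal ((infdist y L' / l)\<^sup>2) \<partial>\<mu>) \<le> ennreal (b\<^sup>2 * l ^ CARD('n))"
    and L: "L \<in> nplanes CARD('n)"
  shows "emeasure lborel (bad_points L L' z l (N * a * l) (N * b * l)) \<le> ennreal (2 * Cl * l ^ CARD('n) / N)"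
proof -
  let ?n = "CARD('n)" and ?s = "sqrt (real CARD('n))" and ?\<sigma> = "plane_measure c L"
  have s1: "1 \<le> ?s" by (rule sqrt_card_ge_1)
  have sl: "l \<le> ?s * l" using s1 l by simp
  have C\<Gamma>l: "10 * ?s * l < C\<Gamma> * l" using C\<Gamma> l by simp
  define U where "U = {y :: (real^'n) \<times> (real^'m). dist (fst y) z < 2 * ?s * l}"
  define S1 where "S1 = U \<inter> {y. N * a * l < infdist y L}"
  define S2 where "S2 = U \<inter> {y. N * b * l < infdist y L'}"
  have "open U" unfolding U_def by (intro open_Collect_less continuous_intros)
  then have S: "S1 \<in> sets borel" "S2 \<in> sets borel"
    unfolding S1_def S2_def by (intro borel_open open_Int open_Collect_less continuous_intros; simp)+
  have "emeasure \<mu> S1 \<le> ennreal (l ^ ?n / N)"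
  proof -
    \<comment> \<open>The cap gives the required support. Over \<open>U\<close> it is at least
      \<open>?s * l\<close>, hence at least \<open>N * a * l\<close> because
      \<open>N * a \<le> 1\<close>.\<close>
    define g where "g y = min (infdist y L) (max 0 (3 * ?s * l - dist (fst y) z))"
      for y :: "(real^'n) \<times> (real^'m)"
    have g0: "0 \<le> g y" for y by (simp add: g_def infdist_nonneg)
    have lip_g: "1-lipschitz_on UNIV g"
    proof (rule lipschitz_onI)
      fix y y' :: "(real^'n) \<times> (real^'m)"
      have "\<bar>dist (fst y) z - dist (fst y') z\<bar> \<le> dist (fst y) (fst y')"
        using abs_dist_diff_le[of "fst y" z "fst y'"] by (simp add: dist_commute)
      also have "\<dots> \<le> dist y y'" by (rule dist_fst_le)
      finally show "dist (g y) (g y') \<le> 1 * dist y y'"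
        using infdist_triangle_abs[of y L y'] unfolding g_def dist_real_def by linarith
    qed simp
    have "closure {y. g y \<noteq> 0} \<subseteq> B_Q C\<Gamma> (z, l)"
    proof (rule closure_support_subset_B_Q[where r="3 * ?s * l"])
      show "3 * ?s * l < C\<Gamma> * snd (z, l)" unfolding snd_conv using C\<Gamma>l sl l by linarith
    qed (simp add: g_def min_absorb2 infdist_nonneg)
    note g = dist_F_le_lipschitz[OF D _ lip_g zero_less_one this]
    have D0: "0 \<le> a * l ^ (?n + 1)" using a l by simp
    have [measurable]: "L \<in> sets borel" using nplanes_closed[OF L] by simp
    have "AE y in ?\<sigma>. g y = 0"
      unfolding plane_measure_def by (subst AE_density) (auto simp: g_def indicator_def)
    then have "(\<integral>y. g y \<partial>?\<sigma>) = 0" by (rule integral_eq_zero_AE)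
    then have int_g: "(\<integral>y. g y \<partial>\<mu>) \<le> a * l ^ (?n + 1)" using g(3)[OF D0] by simp
    have "ennreal (N * a * l) * emeasure \<mu> S1 = (\<integral>\<^sup>+y. ennreal (N * a * l) * indicator S1 y \<partial>\<mu>)"
      using S by (simp add: nn_integral_cmult_indicator)
    also have "\<dots> \<le> (\<integral>\<^sup>+y. ennreal (g y) \<partial>\<mu>)"
    proof (rule nn_integral_mono)
      fix y
      show "ennreal (N * a * l) * indicator S1 y \<le> ennreal (g y)"
      proof (cases "y \<in> S1")
        case True
        have "N * a * l \<le> l" using N(2) l by simp
        then have "N * a * l \<le> g y" using True sl unfolding g_def S1_def U_def by auto
        then show ?thesis using True by (simp add: ennreal_leI)
      qed (simp add: g0)
    qed
    also have "\<dots> = ennreal (\<integral>y. g y \<partial>\<mu>)"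
      using g(1)[OF D0] g0 by (intro nn_integral_eq_integral) auto
    also have "\<dots> \<le> ennreal (a * l ^ (?n + 1))" by (rule ennreal_leI[OF int_g])
    also have "\<dots> = ennreal (N * a * l) * ennreal (l ^ ?n / N)"
      using N a l by (simp add: ennreal_mult'[symmetric] field_simps)
    finally show ?thesis
      using N a l by (subst (asm) ennreal_mult_le_mult_iff) auto
  qed
  moreover have "emeasure \<mu> S2 \<le> ennreal (l ^ ?n / N)"
  proof -
    have "ennreal ((N * b)\<^sup>2) * emeasure \<mu> S2 = (\<integral>\<^sup>+y. ennreal ((N * b)\<^sup>2) * indicator S2 y \<partial>\<mu>)"
      using S by (simp add: nn_integral_cmult_indicator)
    also have "\<dots> \<le> (\<integral>\<^sup>+y\<in>vcube (z, l) C\<Gamma>. ennreal ((infdist y L' / l)\<^sup>2) \<partial>\<mu>)"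
    proof (rule nn_integral_mono)
      fix y
      show "ennreal ((N * b)\<^sup>2) * indicator S2 y \<le> ennreal ((infdist y L' / l)\<^sup>2) * indicator (vcube (z, l) C\<Gamma>) y"
      proof (cases "y \<in> S2")
        case True
        have "\<bar>fst y $ i - z $ i\<bar> < C\<Gamma> * l / 2" for i
        proof -
          have "\<bar>fst y $ i - z $ i\<bar> \<le> dist (fst y) z"
            using component_le_norm_cart[of "fst y - z" i] by (simp add: dist_norm)
          moreover have "dist (fst y) z < 2 * ?s * l" using True by (simp add: S2_def U_def)
          ultimately show ?thesis using C\<Gamma>l sl l by linarith
        qed
        then have "z $ i - C\<Gamma> * l / 2 \<le> fst y $ i \<and> fst y $ i < z $ i + C\<Gamma> * l / 2" for i
          using abs_less_iff[of "fst y $ i - z $ i" "C\<Gamma> * l / 2"] by (smt (verit, best))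
        then have "y \<in> vcube (z, l) C\<Gamma>" by (simp add: vcube_def hcube_def)
        moreover have "N * b \<le> infdist y L' / l" using True l by (simp add: S2_def field_simps)
        ultimately show ?thesis using True N b by (simp add: ennreal_leI power_mono)
      qed simp
    qed
    also have "\<dots> \<le> ennreal (b\<^sup>2 * l ^ ?n)" by (rule \<beta>)
    \<comment> \<open>The square mean would give \<open>1 / N^2\<close>; as \<open>1 \<le> N\<close>
      this is weakened to \<open>1 / N\<close> to match the estimate for \<open>S1\<close>.\<close>
    also have "\<dots> \<le> ennreal ((N * b)\<^sup>2 * (l ^ ?n / N))"
    proof (rule ennreal_leI)
      have "(N * b)\<^sup>2 * (l ^ ?n / N) = N * (b\<^sup>2 * l ^ ?n)"
        using N by (simp add: power2_eq_square)
      then show "b\<^sup>2 * l ^ ?n \<le> (N * b)\<^sup>2 * (l ^ ?n / N)"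
        using N l mult_right_mono[of 1 N "b\<^sup>2 * l ^ ?n"] by simp
    qed
    also have "\<dots> = ennreal ((N * b)\<^sup>2) * ennreal (l ^ ?n / N)"
      by (rule ennreal_mult') simp
    finally show ?thesis
      using N b by (subst (asm) ennreal_mult_le_mult_iff) auto
  qed
  ultimately have S12: "emeasure \<mu> S1 + emeasure \<mu> S2 \<le> ennreal (l ^ ?n / N) + ennreal (l ^ ?n / N)"
    by (rule add_mono)
  let ?E = "bad_points L L' z l (N * a * l) (N * b * l)"
  have "emeasure \<mu> (fst -` ?E) \<le> emeasure \<mu> (S1 \<union> S2)"
  \<comment> \<open>The preimage also contains points off the graph, which form a null set.\<close>
  proof (rule emeasure_mono_AE)
    show "AE x in \<mu>. x \<in> fst -` ?E \<longrightarrow> x \<in> S1 \<union> S2"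
      using AE_graph by eventually_elim (auto simp: bad_points_def S1_def S2_def U_def)
  qed (use S in simp)
  also have "\<dots> \<le> emeasure \<mu> S1 + emeasure \<mu> S2" using S by (intro emeasure_subadditive) auto
  also have "\<dots> \<le> ennreal (2 * l ^ ?n / N)"
    using S12 N l by (simp add: ennreal_plus[symmetric] field_simps del: ennreal_plus)
  finally have "ennreal Cl * emeasure \<mu> (fst -` ?E) \<le> ennreal Cl * ennreal (2 * l ^ ?n / N)"
    by (rule mult_left_mono) simp
  then have "emeasure lborel ?E \<le> ennreal Cl * ennreal (2 * l ^ ?n / N)"
    using lower[OF bad_points_borel] by (rule order_trans[rotated])
  then show ?thesis using Cl by (simp add: ennreal_mult'[symmetric] mult_ac)
qed

text \<open>Chosen so that twice the measure of the bad set is strictly below the volume of a ball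
  of radius \<open>l\<close>; the \<open>+ 1\<close> supplies strictness and the bound from below by
  1.\<close>

definition markov_const :: real where
  "markov_const = 4 * Cl / unit_ball_vol (real CARD('n)) + 1"

text \<open>Graph points over base points at distance \<open>l\<close>, each moved by at most
  \<open>l / 4\<close>, end up at most \<open>l / 2 + (1 + \<Lambda>) * l\<close> apart, which is
  this number times \<open>l / 2\<close>.\<close>

definition plane_slope :: real where
  "plane_slope = 3 + 2 * \<Lambda>"

lemma markov_const_ge_1: "1 \<le> markov_const"
  using Cl by (simp add: markov_const_def)

text \<open>The midpoint of two good points of the graph that lie symmetrically about the vertical line
  through \<open>x\<close> is close to both planes and differs from \<open>x\<close> by a vertical vector, which the bounded
  slope of \<open>L'\<close> controls by the distance from \<open>x\<close> to \<open>L'\<close>.\<close>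

lemma infdist_plane_le:
  assumes l: "0 < l" and a: "0 < a" and b: "0 < b"
    and small: "markov_const * a \<le> 1" "4 * (markov_const * b) \<le> 1"
    and D: "dist_F (B_Q C\<Gamma> (z, l)) \<mu> (plane_measure c L) \<le> ennreal (a * l ^ (CARD('n) + 1))"
    and \<beta>: "(\<integral>\<^sup>+y\<in>vcube (z, l) C\<Gamma>. ennreal ((infdist y L' / l)\<^sup>2) \<partial>\<mu>) \<le> ennreal (b\<^sup>2 * l ^ CARD('n))"
    and L: "L \<in> nplanes CARD('n)" and L': "L' \<in> nplanes CARD('n)"
    and x: "dist (fst x) z \<le> sqrt (real CARD('n)) * l / 2"
  shows "infdist x L \<le> markov_const * a * l + (1 + plane_slope) * (infdist x L' + markov_const * b * l)"
proof -
  let ?n = "CARD('n)" and ?s = "sqrt (real CARD('n))"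
  define N where "N = markov_const"
  let ?E = "bad_points L L' z l (N * a * l) (N * b * l)"
  let ?G = "\<lambda>w. (w, A w)"
  have s1: "1 \<le> ?s" by (rule sqrt_card_ge_1)
  have sl: "l \<le> ?s * l" using s1 l by simp
  have N1: "1 \<le> N" unfolding N_def by (rule markov_const_ge_1)
  have "2 * emeasure lborel ?E \<le> 2 * ennreal (2 * Cl * l ^ ?n / N)"
    using emeasure_bad_points_le[OF l a b N1 _ D \<beta> L] small by (intro mult_left_mono) (auto simp: N_def)
  also have "\<dots> = ennreal (4 * Cl * l ^ ?n / N)"
    using Cl l N1 by (simp add: ennreal_mult'[symmetric] ennreal_numeral[symmetric] del: ennreal_numeral)
  also have "\<dots> < ennreal (unit_ball_vol (real ?n) * l ^ ?n)"
  proof (subst ennreal_less_iff)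
    have "4 * Cl < N * unit_ball_vol (real ?n)" 
    proof -
      have "unit_ball_vol (real ?n) \<noteq> 0" using unit_ball_vol_pos[of "real ?n"] by linarith
      then show ?thesis unfolding N_def markov_const_def distrib_right by simp
    qed
    then have "4 * Cl / N < unit_ball_vol (real ?n)" using N1 by (simp add: field_simps)
    then show "4 * Cl * l ^ ?n / N < unit_ball_vol (real ?n) * l ^ ?n"
      using mult_strict_right_mono[of "4 * Cl / N" "unit_ball_vol (real ?n)" "l ^ ?n"] l by simp
  qed (use Cl l N1 in simp)
  finally have E_small: "2 * emeasure lborel ?E < emeasure lborel (ball w l)" for w :: "real^'n"
    using l by (simp add: emeasure_ball)
  have good: "infdist (?G w) L \<le> N * a * l" "infdist (?G w) L' \<le> N * b * l"
    if "w \<notin> ?E" "dist w z < 2 * ?s * l" for w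
    using that by (auto simp: bad_points_def not_less)
  have slope: "norm (p - q) \<le> plane_slope * norm (fst (p - q))" if pq: "p \<in> L'" "q \<in> L'" for p q
  proof (rule nplanes_slope_bound[OF L' _ _ pq])
    show "0 < l / 2" using l by simp
    fix e :: "real^'n" assume e: "norm e = 1"
    \<comment> \<open>A good pair displaced by \<open>l\<close> in direction \<open>e\<close>.
      Moving both graph points onto \<open>L'\<close> costs at most half of the
      displacement.\<close>
    obtain w where w: "w \<in> ball z l" "w \<notin> ?E" "l *\<^sub>R e + 1 *\<^sub>R w \<notin> ?E"
      using exists_pair_avoiding[OF bad_points_borel _ E_small] by (metis abs_one)
    define w' where "w' = l *\<^sub>R e + w"
    have ww': "norm (w' - w) = l" using e l by (simp add: w'_def)
    have dw: "dist w z < l" using w(1) by (simp add: dist_commute)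
    have "dist w' z \<le> dist w' w + dist w z" by (rule dist_triangle)
    then have dw': "dist w' z < 2 * l" using ww' dw by (simp add: dist_norm)
    have "infdist (?G w) L' \<le> l / 4" "infdist (?G w') L' \<le> l / 4"
    proof -
      have "N * b * l \<le> l / 4" using small(2) mult_right_mono[of "4 * (N * b)" 1 l] l by (simp add: N_def)
      moreover have "dist w z < 2 * ?s * l" "dist w' z < 2 * ?s * l" using dw dw' sl l by linarith+
      moreover have "w' \<notin> ?E" using w(3) by (simp add: w'_def)
      ultimately show "infdist (?G w) L' \<le> l / 4" "infdist (?G w') L' \<le> l / 4"
        using good(2)[OF w(2)] good(2)[of w'] by linarith+
    qed
    then obtain q1 q2 where q: "q1 \<in> L'" "q2 \<in> L'" "norm (?G w - q1) \<le> l / 4" "norm (?G w' - q2) \<le> l / 4"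
      using nplanes_closest_point[OF L'] by (metis dist_norm)
    have d: "norm ((q2 - q1) - (?G w' - ?G w)) \<le> l / 2"
    proof -
      have "(q2 - q1) - (X' - X) = (X - q1) - (X' - q2)" for X X' by (simp add: algebra_simps)
      then show ?thesis using q norm_triangle_ineq4[of "?G w - q1" "?G w' - q2"] by (simp only:)
    qed
    have "norm (?G w' - ?G w) \<le> norm (w' - w) + norm (A w' - A w)"
      using norm_Pair_le[of "w' - w" "A w' - A w"] by simp
    also have "\<dots> \<le> l + \<Lambda> * l" using A_lip[of w' w] ww' by (simp add: dist_norm)
    finally have "norm (q2 - q1) \<le> plane_slope * (l / 2)"
      using d norm_triangle_ineq[of "(q2 - q1) - (?G w' - ?G w)" "?G w' - ?G w"]
      by (simp add: plane_slope_def algebra_simps)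
    moreover have "l / 2 \<le> e \<bullet> fst (q2 - q1)"
    proof -
      have "e \<bullet> fst (q2 - q1) = e \<bullet> (w' - w) + e \<bullet> fst ((q2 - q1) - (?G w' - ?G w))"
        by (simp add: inner_diff_right)
      moreover have "e \<bullet> (w' - w) = l" using e by (simp add: w'_def dot_square_norm)
      moreover have "\<bar>e \<bullet> fst ((q2 - q1) - (?G w' - ?G w))\<bar> \<le> l / 2"
        using Cauchy_Schwarz_ineq2[of e "fst ((q2 - q1) - (?G w' - ?G w))"] e d
          norm_fst_le[of "fst ((q2 - q1) - (?G w' - ?G w))" "snd ((q2 - q1) - (?G w' - ?G w))"]
        by (simp del: fst_diff snd_diff)
      ultimately show ?thesis by linarith
    qed
    ultimately show "\<exists>q1\<in>L'. \<exists>q2\<in>L'. l / 2 \<le> e \<bullet> fst (q2 - q1) \<and> norm (q2 - q1) \<le> plane_slope * (l / 2)"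
      using q by blast
  qed
  obtain w where w: "w \<in> ball (fst x) l" "w \<notin> ?E" "2 *\<^sub>R fst x + (-1) *\<^sub>R w \<notin> ?E"
    using exists_pair_avoiding[OF bad_points_borel _ E_small, of "-1"] by (metis abs_minus_cancel abs_one)
  define w' where "w' = 2 *\<^sub>R fst x - w"
  have "w' - fst x = fst x - w" by (simp add: w'_def scaleR_2)
  then have "dist w (fst x) < l" "dist w' (fst x) < l"
    using w(1) by (simp_all add: dist_norm norm_minus_commute)
  then have dw: "dist w z < 2 * ?s * l" "dist w' z < 2 * ?s * l"
    using dist_triangle[of w z "fst x"] dist_triangle[of w' z "fst x"] x sl l by linarith+
  have w'E: "w' \<notin> ?E" using w(3) by (simp add: w'_def)
  define m where "m = midpoint (?G w) (?G w')"
  have fm: "fst m = fst x" by (simp add: m_def midpoint_def w'_def)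
  have mL: "infdist m L \<le> N * a * l" "infdist m L' \<le> N * b * l"
    unfolding m_def using good[OF w(2) dw(1)] good[OF w'E dw(2)]
    by (auto intro: infdist_midpoint_nplanes_le[OF L] infdist_midpoint_nplanes_le[OF L'])
  obtain p q where p: "p \<in> L'" "infdist x L' = dist x p" and q: "q \<in> L'" "infdist m L' = dist m q"
    using nplanes_closest_point[OF L'] by metis
  let ?t = "infdist x L' + N * b * l"
  have mq: "norm (m - q) \<le> N * b * l" using mL(2) q(2) by (simp add: dist_norm)
  \<comment> \<open>As \<open>m\<close> lies on the vertical line through \<open>x\<close>, the
    horizontal part of \<open>p - q\<close> only sees the two small vectors \<open>m - q\<close> and
    \<open>x - p\<close>.\<close>
  have "fst (p - q) = fst ((m - q) - (x - p))" by (simp add: fm)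
  moreover have "norm (fst v) \<le> norm v" for v :: "(real^'n) \<times> (real^'m)"
    using norm_fst_le[of "fst v" "snd v"] by simp
  ultimately have "norm (fst (p - q)) \<le> norm ((m - q) - (x - p))" by (simp only:)
  also have "\<dots> \<le> ?t" using norm_triangle_ineq4[of "m - q" "x - p"] mq p(2) by (simp add: dist_norm)
  finally have "norm (p - q) \<le> plane_slope * ?t"
    using slope[OF p(1) q(1)] \<Lambda> by (smt (verit) mult_left_mono plane_slope_def)
  moreover have "norm (x - m) \<le> norm (x - p) + norm (p - q) + norm (m - q)"
    using norm_triangle_ineq[of "x - p" "p - q"] norm_triangle_ineq4[of "(x - p) + (p - q)" "m - q"] by simp
  ultimately have "dist x m \<le> (1 + plane_slope) * ?t"
    using mq p(2) by (simp add: dist_norm distrib_right)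
  then show ?thesis using infdist_triangle[of x L m] mL(1) by (simp add: N_def)
qed

end

subsection \<open>Estimates on a single cube\<close>

lemma hcube_borel: "hcube c l \<in> sets borel"
proof -
  have "hcube c l = (\<Inter>i. {x. c $ i - l / 2 \<le> x $ i} \<inter> {x. x $ i < c $ i + l / 2})"
    by (auto simp: hcube_def)
  moreover have "{x. c $ i - l / 2 \<le> x $ i} \<inter> {x. x $ i < c $ i + l / 2} \<in> sets borel" for i
    by (intro sets.Int borel_closed borel_open closed_Collect_le open_Collect_less continuous_intros)
  ultimately show ?thesis by auto
qed

lemma vcube_eq_vimage: "vcube Q s = fst -` hcube (fst Q) (s * snd Q)"
  by (auto simp: vcube_def)

lemma vcube_borel [measurable]: "(vcube Q s :: ((real^'n) \<times> (real^'m)) set) \<in> sets borel"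
proof -
  have "(fst :: (real^'n) \<times> (real^'m) \<Rightarrow> _) \<in> borel_measurable borel"
    by (intro borel_measurable_continuous_onI continuous_intros)
  from measurable_sets[OF this hcube_borel] show ?thesis by (simp add: vcube_eq_vimage)
qed

lemma dist_center_le:
  fixes z :: "real^'n"
  assumes "x \<in> vcube (z, l) 1"
  shows "dist (fst x) z \<le> sqrt (real CARD('n)) * l / 2"
proof -
  have *: "z $ i - l / 2 \<le> fst x $ i" "fst x $ i < z $ i + l / 2" for i
    using assms by (auto simp: vcube_def hcube_def)
  have "\<bar>(fst x - z) $ i\<bar> \<le> l / 2" for i
    unfolding vector_minus_component using *[of i] by linarith
  from norm_le_sqrt_card_component[OF this] show ?thesis by (simp add: dist_norm)
qed

lemma ball_subset_hcube: "ball z (l / 2) \<subseteq> hcube z l" for z :: "real^'n"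
proof
  fix x assume "x \<in> ball z (l / 2)"
  then have *: "\<bar>(x - z) $ i\<bar> < l / 2" for i
    using component_le_norm_cart[of "x - z" i] by (simp add: dist_norm norm_minus_commute)
  have "z $ i - l / 2 \<le> x $ i \<and> x $ i < z $ i + l / 2" for i
    using *[of i] unfolding vector_minus_component by linarith
  then show "x \<in> hcube z l" by (simp add: hcube_def)
qed

lemma borel_measurable_infdist [measurable]: "(\<lambda>x. infdist x S) \<in> borel_measurable borel"
  by (intro borel_measurable_continuous_onI continuous_intros)

text \<open>Replaces the family of all planes by a countable one, so that pointwise infima over it
  remain measurable.\<close>

lemma INF_eq_INF_sequence:
  fixes d :: "'a \<Rightarrow> ennreal"
  assumes "P \<noteq> {}"
  obtains s :: "nat \<Rightarrow> 'a" where "range s \<subseteq> P" "(INF p\<in>P. d p) = (INF i. d (s i))"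
proof -
  obtain f :: "nat \<Rightarrow> ennreal" where f: "range f \<subseteq> d ` P" "Inf (d ` P) = (INF i. f i)"
    using ennreal_Inf_countable_INF[of "d ` P"] assms by auto
  then have "\<forall>i. \<exists>p\<in>P. f i = d p" by blast
  then obtain s where "\<forall>i. s i \<in> P \<and> f i = d (s i)" by metis
  then show thesis using f(2) by (intro that[of s]) auto
qed

lemma nplanes_nonempty:
  assumes "n \<le> DIM('a)"
  shows "(nplanes n :: 'a::euclidean_space set set) \<noteq> {}"
proof -
  obtain T :: "'a set" where "subspace T" "dim T = n"
    using choose_subspace_of_subspace[of n "UNIV :: 'a set"] assms by (metis dim_UNIV)
  then have "T \<in> nplanes n" by (simp add: nplanes_def aff_dim_subspace subspace_imp_affine)
  then show ?thesis by blast
qed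

text \<open>Each normalised increment lies between 0 and 1, hence dominates its square. The
  increments are the lengths of disjoint intervals inside \<open>{0..l}\<close>.\<close>

lemma nn_integral_dyadic_increments_le:
  fixes \<epsilon> :: "int \<Rightarrow> real"
  assumes dec: "\<And>m. \<epsilon> (m + 1) < \<epsilon> m" and l: "l = 2 powr (- real_of_int j)"
  shows "(\<integral>\<^sup>+m. (if \<epsilon> m \<in> dyI j \<and> \<epsilon> (m + 1) \<in> dyI j then ennreal (((\<epsilon> m - \<epsilon> (m + 1)) / l)\<^sup>2) else 0)
           \<partial>count_space UNIV) \<le> 1"
proof -
  have l0: "0 < l" by (simp add: l)
  define X where "X m = (if \<epsilon> m \<in> dyI j \<and> \<epsilon> (m + 1) \<in> dyI j then {\<epsilon> (m + 1)..<\<epsilon> m} else {})" for m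
  have anti: "\<epsilon> m \<le> \<epsilon> k" if "k \<le> m" for k m
  proof -
    have "\<epsilon> (k + int i) \<le> \<epsilon> k" for i
    proof (induction i)
      case (Suc i)
      then show ?case using dec[of "k + int i"] by (simp add: algebra_simps)
    qed simp
    from this[of "nat (m - k)"] that show ?thesis by simp
  qed
  have disj: "disjoint_family X"
    unfolding disjoint_family_on_def
  proof (intro ballI impI)
    fix m k :: int assume "m \<noteq> k"
    then consider "m + 1 \<le> k" | "k + 1 \<le> m" by linarith
    then have "\<epsilon> k \<le> \<epsilon> (m + 1) \<or> \<epsilon> m \<le> \<epsilon> (k + 1)" using anti by cases blast+
    then show "X m \<inter> X k = {}" by (auto simp: X_def)
  qed
  have sub: "(\<Union>m. X m) \<subseteq> {0..l}"
  proof
    fix x assume "x \<in> (\<Union>m. X m)"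
    then obtain m where "2 powr (- real_of_int j - 1) \<le> \<epsilon> (m + 1)" "\<epsilon> (m + 1) \<le> x" "x < \<epsilon> m" "\<epsilon> m < l"
      by (auto simp: X_def dyI_def l split: if_splits)
    moreover have "0 < (2::real) powr (- real_of_int j - 1)" by simp
    ultimately show "x \<in> {0..l}" unfolding atLeastAtMost_iff by linarith
  qed
  have "(\<integral>\<^sup>+m. (if \<epsilon> m \<in> dyI j \<and> \<epsilon> (m + 1) \<in> dyI j then ennreal (((\<epsilon> m - \<epsilon> (m + 1)) / l)\<^sup>2) else 0)
           \<partial>count_space UNIV) \<le> (\<integral>\<^sup>+m. ennreal (1 / l) * emeasure lborel (X m) \<partial>count_space UNIV)"
  proof (rule nn_integral_mono)
    fix m
    show "(if \<epsilon> m \<in> dyI j \<and> \<epsilon> (m + 1) \<in> dyI j then ennreal (((\<epsilon> m - \<epsilon> (m + 1)) / l)\<^sup>2) else 0)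
        \<le> ennreal (1 / l) * emeasure lborel (X m)"
    proof (cases "\<epsilon> m \<in> dyI j \<and> \<epsilon> (m + 1) \<in> dyI j")
      case True
      let ?t = "(\<epsilon> m - \<epsilon> (m + 1)) / l"
      have "0 \<le> \<epsilon> (m + 1)" "\<epsilon> m < l"
        using True powr_ge_zero[of 2 "- real_of_int j - 1"] unfolding dyI_def l atLeastLessThan_iff by linarith+
      then have t: "0 \<le> ?t" "?t \<le> 1" using dec[of m] l0 by (auto simp: field_simps)
      then have "?t\<^sup>2 \<le> ?t" unfolding power2_eq_square by (intro mult_left_le)
      then show ?thesis using True dec[of m] l0
        by (simp add: X_def ennreal_mult'[symmetric] ennreal_leI)
    qed auto
  qed
  also have "\<dots> = ennreal (1 / l) * emeasure lborel (\<Union>m. X m)"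
    using emeasure_UN_countable[of UNIV X lborel] disj
    by (simp add: nn_integral_cmult X_def)
  also have "\<dots> \<le> ennreal (1 / l) * emeasure lborel {0..l}"
    by (intro mult_left_mono emeasure_mono sub) auto
  also have "\<dots> = 1" using l0 by (simp add: ennreal_mult'[symmetric])
  finally show ?thesis .
qed

lemma power2_sum3_le: "(u + v + w)\<^sup>2 \<le> 3 * (u\<^sup>2 + v\<^sup>2 + w\<^sup>2)" for u v w :: real
  using zero_le_power2[of "u - v"] zero_le_power2[of "v - w"] zero_le_power2[of "u - w"]
  by (simp add: power2_eq_square algebra_simps)

context lipschitz_graph_measure begin

definition cube_const :: real where
  "cube_const = 2 ^ CARD('n) / unit_ball_vol (real CARD('n)) * Cl"

lemma cube_const_pos: "0 < cube_const"
  using Cl unit_ball_vol_pos[of "real CARD('n)"] by (simp add: cube_const_def)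

text \<open>The inscribed ball of radius \<open>l / 2\<close> gives the bound. It converts the
  normalisation by \<open>l ^ n\<close> in the beta numbers into the measure of the cube.\<close>

lemma cube_measure_ge:
  assumes l: "0 < l"
  shows "ennreal (l ^ CARD('n)) \<le> ennreal cube_const * emeasure \<mu> (vcube (z, l) 1)"
proof -
  let ?n = "CARD('n)"
  let ?\<omega> = "unit_ball_vol (real ?n)"
  have \<omega>: "0 < ?\<omega>" by simp
  then have \<omega>0: "?\<omega> \<noteq> 0" by linarith
  have "ennreal (l ^ ?n) = ennreal (2 ^ ?n / ?\<omega>) * ennreal (?\<omega> * (l / 2) ^ ?n)"
    using l \<omega>0 by (simp add: ennreal_mult'[symmetric] power_divide)
  also have "ennreal (?\<omega> * (l / 2) ^ ?n) = emeasure lborel (ball z (l / 2))"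
    using l by (simp add: emeasure_ball)
  also have "\<dots> \<le> emeasure lborel (hcube z l)"
    using ball_subset_hcube[of z l] hcube_borel by (intro emeasure_mono) auto
  also have "\<dots> \<le> ennreal Cl * emeasure \<mu> (fst -` hcube z l)" by (rule lower[OF hcube_borel])
  finally have "ennreal (l ^ ?n) \<le> ennreal (2 ^ ?n / ?\<omega>) * (ennreal Cl * emeasure \<mu> (fst -` hcube z l))"
    by (simp add: mult_left_mono)
  also have "\<dots> = ennreal cube_const * emeasure \<mu> (vcube (z, l) 1)"
    unfolding cube_const_def vcube_eq_vimage
    using \<omega> Cl by (subst ennreal_mult') (auto simp: mult.assoc)
  finally show ?thesis .
qed

lemma emeasure_cube_pos: "0 < l \<Longrightarrow> 0 < emeasure \<mu> (vcube (z, l) 1)"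
  using cube_measure_ge[of l z] by (cases "emeasure \<mu> (vcube (z, l) 1) = 0") (auto simp: zero_less_iff_neq_zero)

lemma emeasure_cube_finite: "0 < l \<Longrightarrow> emeasure \<mu> (vcube (z, l) 1) < \<infinity>"
proof -
  assume l: "0 < l"
  have "emeasure \<mu> (vcube (z, l) 1) \<le> emeasure \<mu> {x. dist (fst x) z \<le> sqrt (real CARD('n)) * l / 2}"
    using dist_center_le[of _ z l] by (intro emeasure_mono) (auto intro!: borel_closed closed_Collect_le continuous_intros)
  also have "\<dots> < \<infinity>" using upper[of "sqrt (real CARD('n)) * l / 2" z] l sqrt_card_ge_1
    by (auto simp: less_top[symmetric] top_unique)
  finally show ?thesis .
qed

text \<open>The first summand serves the case where \<open>a\<close> or \<open>b\<close> is not
  small; the others come from squaring the three-term bound for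
  \<open>a + infdist x L / l\<close>.\<close>

definition geometric_const :: real where
  "geometric_const = 16 * markov_const\<^sup>2 + 3 * (1 + markov_const)\<^sup>2
     + 3 * (1 + plane_slope)\<^sup>2 * (markov_const\<^sup>2 + cube_const)"

text \<open>If \<open>a\<close> or \<open>b\<close> is not small, the integrand is at most 1 and the
  constant compensates. Otherwise \<open>infdist_plane_le\<close> replaces the distance to
  \<open>L\<close> by the distance to \<open>L'\<close>, whose square mean is bounded by
  \<open>\<beta>\<close>.\<close>

lemma nn_integral_cube_le:
  assumes l: "0 < l" and a: "0 < a" and b: "0 < b"
    and D: "dist_F (B_Q C\<Gamma> (z, l)) \<mu> (plane_measure c L) \<le> ennreal (a * l ^ (CARD('n) + 1))"
    and \<beta>: "(\<integral>\<^sup>+y\<in>vcube (z, l) C\<Gamma>. ennreal ((infdist y L' / l)\<^sup>2) \<partial>\<mu>) \<le> ennreal (b\<^sup>2 * l ^ CARD('n))"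
    and L: "L \<in> nplanes CARD('n)" and L': "L' \<in> nplanes CARD('n)"
  shows "(\<integral>\<^sup>+x\<in>vcube (z, l) 1. ennreal ((min 1 (a + infdist x L / l))\<^sup>2) \<partial>\<mu>)
    \<le> ennreal (geometric_const * (a\<^sup>2 + b\<^sup>2)) * emeasure \<mu> (vcube (z, l) 1)"
proof -
  let ?n = "CARD('n)" and ?N = markov_const and ?S = plane_slope
  let ?Q = "vcube (z, l) 1 :: ((real^'n) \<times> (real^'m)) set"
  have N: "1 \<le> ?N" by (rule markov_const_ge_1)
  have cc: "0 < cube_const" by (rule cube_const_pos)
  show ?thesis
  proof (cases "?N * a \<le> 1 \<and> 4 * (?N * b) \<le> 1")
    case False
    \<comment> \<open>One of \<open>4 * (?N * a)\<close> and \<open>4 * (?N * b)\<close> is at least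
      1.\<close>
    have "1 \<le> 16 * (?N\<^sup>2 * (a\<^sup>2 + b\<^sup>2))"
    proof -
      have "1 \<le> 4 * (?N * a) \<or> 1 \<le> 4 * (?N * b)" using False by linarith
      then have "1 \<le> (4 * (?N * a))\<^sup>2 \<or> 1 \<le> (4 * (?N * b))\<^sup>2" by (blast intro: one_le_power)
      then have "1 \<le> (4 * (?N * a))\<^sup>2 + (4 * (?N * b))\<^sup>2"
        by (smt (verit) zero_le_power2)
      then show ?thesis by (simp add: power_mult_distrib algebra_simps)
    qed
    also have "\<dots> \<le> geometric_const * (a\<^sup>2 + b\<^sup>2)"
      using N cc unfolding geometric_const_def mult.assoc[symmetric]
      by (intro mult_right_mono) auto
    finally have 1: "1 \<le> geometric_const * (a\<^sup>2 + b\<^sup>2)" .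
    have "(\<integral>\<^sup>+x\<in>?Q. ennreal ((min 1 (a + infdist x L / l))\<^sup>2) \<partial>\<mu>) \<le> (\<integral>\<^sup>+x. indicator ?Q x \<partial>\<mu>)"
    proof (intro nn_integral_mono)
      fix x
      have "0 \<le> a + infdist x L / l" using a l infdist_nonneg[of x L] by simp
      then have "(min 1 (a + infdist x L / l))\<^sup>2 \<le> 1" by (intro power_le_one) auto
      then show "ennreal ((min 1 (a + infdist x L / l))\<^sup>2) * indicator ?Q x \<le> indicator ?Q x"
        by (auto simp: indicator_def)
    qed
    also have "\<dots> = 1 * emeasure \<mu> ?Q" by simp
    also have "\<dots> \<le> ennreal (geometric_const * (a\<^sup>2 + b\<^sup>2)) * emeasure \<mu> ?Q"
      using 1 by (intro mult_right_mono) auto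
    finally show ?thesis .
  next
    case True
    \<comment> \<open>\<open>P\<close> collects the contributions of \<open>a\<close> and
      \<open>b\<close>, and \<open>R\<close> is the coefficient of the squared distance to
      \<open>L'\<close>; the 3 comes from squaring a sum of three terms.\<close>
    define P where "P = 3 * (1 + ?N)\<^sup>2 * a\<^sup>2 + 3 * (1 + ?S)\<^sup>2 * ?N\<^sup>2 * b\<^sup>2"
    define R where "R = 3 * (1 + ?S)\<^sup>2"
    have PR: "0 \<le> P" "0 \<le> R" by (simp_all add: P_def R_def)
    have pt: "(min 1 (a + infdist x L / l))\<^sup>2 \<le> P + R * (infdist x L' / l)\<^sup>2" if "x \<in> ?Q" for x
    proof -
      have "infdist x L \<le> ?N * a * l + (1 + ?S) * (infdist x L' + ?N * b * l)"
        using True by (intro infdist_plane_le[OF l a b _ _ D \<beta> L L'] dist_center_le[OF that]) auto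
      then have "infdist x L / l \<le> (?N * a * l + (1 + ?S) * (infdist x L' + ?N * b * l)) / l"
        using l by (intro divide_right_mono) auto
      also have "\<dots> = ?N * a + (1 + ?S) * (?N * b) + (1 + ?S) * (infdist x L' / l)"
        using l by (simp add: add_divide_distrib distrib_left)
      finally have "min 1 (a + infdist x L / l)
          \<le> (1 + ?N) * a + (1 + ?S) * (?N * b) + (1 + ?S) * (infdist x L' / l)"
        by (simp add: distrib_right)
      moreover have "0 \<le> min 1 (a + infdist x L / l)" using a l infdist_nonneg[of x L] by simp
      ultimately have "(min 1 (a + infdist x L / l))\<^sup>2
          \<le> ((1 + ?N) * a + (1 + ?S) * (?N * b) + (1 + ?S) * (infdist x L' / l))\<^sup>2"
        by (rule power_mono)
      also have "\<dots> \<le> 3 * (((1 + ?N) * a)\<^sup>2 + ((1 + ?S) * (?N * b))\<^sup>2 + ((1 + ?S) * (infdist x L' / l))\<^sup>2)"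
        by (rule power2_sum3_le)
      also have "\<dots> = P + R * (infdist x L' / l)\<^sup>2"
        by (simp only: P_def R_def power_mult_distrib distrib_left mult.assoc)
      finally show ?thesis .
    qed
    have QC: "?Q \<subseteq> vcube (z, l) C\<Gamma>"
    proof -
      have "1 \<le> C\<Gamma>" using C\<Gamma> sqrt_card_ge_1 by linarith
      then have "l \<le> C\<Gamma> * l" using l by simp
      then have "l / 2 \<le> C\<Gamma> * l / 2" by simp
      then have "z $ i - C\<Gamma> * l / 2 \<le> t \<and> t < z $ i + C\<Gamma> * l / 2"
        if "z $ i - l / 2 \<le> t \<and> t < z $ i + l / 2" for i t
        using that by linarith
      then show ?thesis unfolding vcube_def hcube_def by auto
    qed
    have "(\<integral>\<^sup>+x\<in>?Q. ennreal ((min 1 (a + infdist x L / l))\<^sup>2) \<partial>\<mu>)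
        \<le> (\<integral>\<^sup>+x. ennreal P * indicator ?Q x + ennreal R * (ennreal ((infdist x L' / l)\<^sup>2) * indicator (vcube (z, l) C\<Gamma>) x) \<partial>\<mu>)"
    proof (rule nn_integral_mono)
      fix x
      show "ennreal ((min 1 (a + infdist x L / l))\<^sup>2) * indicator ?Q x
        \<le> ennreal P * indicator ?Q x + ennreal R * (ennreal ((infdist x L' / l)\<^sup>2) * indicator (vcube (z, l) C\<Gamma>) x)"
      proof (cases "x \<in> ?Q")
        case True
        then have "ennreal ((min 1 (a + infdist x L / l))\<^sup>2) \<le> ennreal P + ennreal R * ennreal ((infdist x L' / l)\<^sup>2)"
          using pt[OF True] PR by (simp add: ennreal_mult'[symmetric] ennreal_plus[symmetric] ennreal_leI del: ennreal_plus)
        then show ?thesis using True QC by auto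
      qed simp
    qed
    also have "\<dots> = ennreal P * emeasure \<mu> ?Q + ennreal R * (\<integral>\<^sup>+y\<in>vcube (z, l) C\<Gamma>. ennreal ((infdist y L' / l)\<^sup>2) \<partial>\<mu>)"
      by (subst nn_integral_add) (auto simp: nn_integral_cmult)
    also have "\<dots> \<le> ennreal P * emeasure \<mu> ?Q + ennreal R * (ennreal (b\<^sup>2) * (ennreal cube_const * emeasure \<mu> ?Q))"
    proof (intro add_left_mono mult_left_mono)
      have "ennreal (b\<^sup>2 * l ^ ?n) = ennreal (b\<^sup>2) * ennreal (l ^ ?n)" by (rule ennreal_mult') simp
      also have "\<dots> \<le> ennreal (b\<^sup>2) * (ennreal cube_const * emeasure \<mu> ?Q)"
        by (intro mult_left_mono cube_measure_ge l) simp
      finally show "(\<integral>\<^sup>+y\<in>vcube (z, l) C\<Gamma>. ennreal ((infdist y L' / l)\<^sup>2) \<partial>\<mu>) \<le> \<dots>"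
        using \<beta> by (rule order_trans[rotated])
    qed simp
    also have "\<dots> = ennreal (P + R * b\<^sup>2 * cube_const) * emeasure \<mu> ?Q"
    proof -
      have "ennreal (P + R * b\<^sup>2 * cube_const) = ennreal P + ennreal R * (ennreal (b\<^sup>2) * ennreal cube_const)"
        using PR cc by (simp add: ennreal_plus[symmetric] ennreal_mult'[symmetric] mult.assoc del: ennreal_plus)
      then show ?thesis by (simp add: distrib_right mult.assoc)
    qed
    also have "\<dots> \<le> ennreal (geometric_const * (a\<^sup>2 + b\<^sup>2)) * emeasure \<mu> ?Q"
    proof (intro mult_right_mono ennreal_leI)
      have "geometric_const * (a\<^sup>2 + b\<^sup>2) - (P + R * b\<^sup>2 * cube_const)
        = 16 * ?N\<^sup>2 * (a\<^sup>2 + b\<^sup>2) + 3 * (1 + ?N)\<^sup>2 * b\<^sup>2 + R * (?N\<^sup>2 + cube_const) * a\<^sup>2"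
        unfolding geometric_const_def P_def R_def by (simp only: distrib_left distrib_right mult_ac add_ac)
      moreover have "0 \<le> \<dots>" using cc PR by (intro add_nonneg_nonneg mult_nonneg_nonneg) auto
      ultimately have "0 \<le> geometric_const * (a\<^sup>2 + b\<^sup>2) - (P + R * b\<^sup>2 * cube_const)"
        by (simp only:)
      then show "P + R * b\<^sup>2 * cube_const \<le> geometric_const * (a\<^sup>2 + b\<^sup>2)"
        by (simp only: diff_ge_0_iff_ge)
    qed simp
    finally show ?thesis .
  qed
qed

end

subsection \<open>Summation over scales\<close>

lemma ennsqrt_less_ennreal:
  assumes "ennsqrt q < ennreal b"
  shows "q \<le> ennreal (b\<^sup>2)"
proof (cases q)
  case (real r)
  then have "sqrt r < b" using assms by (simp add: ennsqrt_def ennreal_less_iff)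
  moreover have "0 \<le> sqrt r" using real by simp
  ultimately have "(sqrt r)\<^sup>2 \<le> b\<^sup>2" by (intro power_mono) auto
  then show ?thesis using real by (simp add: ennreal_leI)
next
  case top
  then show ?thesis using assms by (simp add: ennsqrt_def)
qed

lemma INF_ennreal_mult_left:
  fixes f :: "'a \<Rightarrow> ennreal"
  assumes "0 < c"
  shows "(INF i\<in>I. ennreal c * f i) = ennreal c * (INF i\<in>I. f i)"
proof (rule antisym)
  have c: "ennreal (1 / c) * (ennreal c * t) = t" "ennreal c * (ennreal (1 / c) * t) = t" for t
    using assms by (simp_all add: mult.assoc[symmetric] ennreal_mult'[symmetric])
  have "ennreal (1 / c) * (INF i\<in>I. ennreal c * f i) \<le> (INF i\<in>I. f i)"
  proof (rule INF_greatest)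
    fix i assume "i \<in> I"
    then have "ennreal (1 / c) * (INF i\<in>I. ennreal c * f i) \<le> ennreal (1 / c) * (ennreal c * f i)"
      by (intro mult_left_mono INF_lower) auto
    then show "ennreal (1 / c) * (INF i\<in>I. ennreal c * f i) \<le> f i" by (simp only: c)
  qed
  from mult_left_mono[OF this, of "ennreal c"] show "(INF i\<in>I. ennreal c * f i) \<le> ennreal c * (INF i\<in>I. f i)"
    by (simp add: c)
  show "ennreal c * (INF i\<in>I. f i) \<le> (INF i\<in>I. ennreal c * f i)"
    by (intro INF_greatest mult_left_mono INF_lower) auto
qed

lemma min_1_ennreal: "min 1 (ennreal r) = ennreal (min 1 r)"
  unfolding ennreal_1[symmetric] by (cases "1 \<le> r") (auto simp: min_def intro: antisym ennreal_leI)

lemma ennreal_divide_scale_le: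
  assumes "ennreal (1 / t) * X \<le> ennreal c" "0 < t"
  shows "X \<le> ennreal (c * t)"
proof -
  have "X = ennreal t * (ennreal (1 / t) * X)"
    using assms(2) by (simp add: mult.assoc[symmetric] ennreal_mult'[symmetric])
  also have "\<dots> \<le> ennreal t * ennreal c" by (rule mult_left_mono[OF assms(1)]) simp
  also have "\<dots> = ennreal (c * t)" using assms(2) by (simp add: ennreal_mult'' mult.commute)
  finally show ?thesis .
qed

section \<open>The dyadic cube of given side length containing a point\<close>

definition dyadic_cube :: "int \<Rightarrow> (real^'n) \<times> (real^'m) \<Rightarrow> (real^'n) \<times> real" where
  "dyadic_cube j x = ((\<chi> i. (real_of_int \<lfloor>fst x $ i * 2 powr real_of_int j\<rfloor> + 1/2) * 2 powr (- real_of_int j)),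
     2 powr (- real_of_int j))"

lemma dyadic_cube_in: "dyadic_cube j x \<in> dyadic_vcubes"
  unfolding dyadic_vcubes_def dyadic_cube_def mem_Collect_eq
  by (intro exI[of _ j] exI[of _ "\<lambda>i. \<lfloor>fst x $ i * 2 powr real_of_int j\<rfloor>"]) simp

lemma in_dyadic_cube: "x \<in> vcube (dyadic_cube j x) 1"
proof -
  let ?p = "2 powr real_of_int j" and ?q = "2 powr (- real_of_int j)"
  have q: "0 < ?q" "?p * ?q = 1" by (simp_all add: powr_add[symmetric])
  have *: "(k + 1/2) * q - q / 2 \<le> t \<and> t < (k + 1/2) * q + q / 2"
    if k: "k \<le> t * p" "t * p < k + 1" and q: "0 < q" "p * q = 1" for k t p q :: real
  proof -
    have "k * q \<le> t * p * q" "t * p * q < (k + 1) * q"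
      using mult_right_mono[OF k(1), of q] mult_strict_right_mono[OF k(2) q(1)] q(1) by simp_all
    moreover have "t * p * q = t" unfolding mult.assoc q(2) by simp
    ultimately have "k * q \<le> t" "t < (k + 1) * q" by (simp_all only:)
    then show ?thesis by (simp add: algebra_simps)
  qed
  have "(real_of_int \<lfloor>t * ?p\<rfloor> + 1/2) * ?q - ?q / 2 \<le> t \<and> t < (real_of_int \<lfloor>t * ?p\<rfloor> + 1/2) * ?q + ?q / 2" for t
    by (rule *[OF _ _ q]) auto
  then show ?thesis by (simp add: vcube_def hcube_def dyadic_cube_def)
qed

text \<open>The side length determines \<open>j\<close>, so a sum over scales at a fixed point is
  dominated by a sum over all dyadic cubes.\<close>

lemma inj_dyadic_cube: "inj (\<lambda>j. dyadic_cube j x)"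
  by (rule injI) (simp add: dyadic_cube_def powr_inj)

lemma snd_dyadic_cube: "snd (dyadic_cube j x) = 2 powr (- real_of_int j)"
  by (simp add: dyadic_cube_def)

lemma countable_dyadic_vcubes: "countable (dyadic_vcubes :: ((real^'n) \<times> real) set)"
proof -
  define F :: "int \<times> ('n \<Rightarrow> int) \<Rightarrow> (real^'n) \<times> real" where
    "F jk = ((\<chi> i. (real_of_int (snd jk i) + 1/2) * 2 powr (- real_of_int (fst jk))), 2 powr (- real_of_int (fst jk)))" for jk
  have "dyadic_vcubes \<subseteq> range F"
  proof
    fix Q :: "(real^'n) \<times> real"
    assume "Q \<in> dyadic_vcubes"
    then obtain j k where "Q = F (j, k)" unfolding dyadic_vcubes_def F_def fst_conv snd_conv by blast
    then show "Q \<in> range F" by (rule range_eqI)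
  qed
  then show ?thesis by (rule countable_subset) (intro countable_image countableI_type)
qed

context lipschitz_graph_measure begin

abbreviation plane_set :: "(real \<times> ((real^'n) \<times> (real^'m)) set) set" where
  "plane_set \<equiv> {(c, L). c \<ge> 0 \<and> L \<in> nplanes CARD('n)}"

definition plane_dist :: "(real^'n) \<times> real \<Rightarrow> real \<times> ((real^'n) \<times> (real^'m)) set \<Rightarrow> ennreal" where
  "plane_dist Q cL = ennreal (1 / snd Q ^ (CARD('n) + 1)) * dist_F (B_Q C\<Gamma> Q) \<mu> (plane_measure (fst cL) (snd cL))"

text \<open>Up to a constant, the majorant of the square function at one scale. The cap at 1 keeps
  it finite when \<open>plane_dist\<close> is infinite.\<close>

definition plane_error :: "(real^'n) \<times> real \<Rightarrow> real \<times> ((real^'n) \<times> (real^'m)) set \<Rightarrow> (real^'n) \<times> (real^'m) \<Rightarrow> ennreal" where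
  "plane_error Q cL x = (min 1 (plane_dist Q cL + ennreal (infdist x (snd cL) / snd Q)))\<^sup>2"

lemma plane_set_nonempty: "plane_set \<noteq> {}"
  using nplanes_nonempty[of "CARD('n)", where 'a="(real^'n) \<times> (real^'m)"] by force

text \<open>The graph point over the centre is in the support, because \<open>lower\<close> gives
  positive mass to every strip around it. Hence the default value 0 in \<open>alpha\<close> never
  occurs.\<close>

lemma cube_meets_support:
  assumes l: "0 < l"
  shows "vcube (z, l) 1 \<inter> measure_support \<mu> \<noteq> {}"
proof -
  let ?x = "(z, A z)"
  have "0 < emeasure \<mu> (ball ?x r)" if r: "0 < r" for r
  proof -
    define \<rho> where "\<rho> = r / (1 + \<Lambda>)"
    have \<rho>: "0 < \<rho>" "(1 + \<Lambda>) * \<rho> = r" using r \<Lambda> by (simp_all add: \<rho>_def)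
    have "AE x in \<mu>. x \<in> fst -` ball z \<rho> \<longrightarrow> x \<in> ball ?x r"
      using AE_graph
    proof eventually_elim
      case (elim x)
      show ?case
      proof
        assume "x \<in> fst -` ball z \<rho>"
        then have d: "dist z (fst x) < \<rho>" by simp
        have "dist ?x x \<le> dist z (fst x) + dist (A z) (snd x)"
          using norm_Pair_le[of "z - fst x" "A z - snd x"] by (cases x) (simp add: dist_norm)
        also have "\<dots> \<le> (1 + \<Lambda>) * dist z (fst x)" using A_lip[of z "fst x"] elim by (simp add: distrib_right)
        also have "\<dots> < r" using mult_strict_left_mono[OF d, of "1 + \<Lambda>"] \<rho>(2) \<Lambda> by simp
        finally show "x \<in> ball ?x r" by simp
      qed
    qed
    then have "emeasure \<mu> (fst -` ball z \<rho>) \<le> emeasure \<mu> (ball ?x r)"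
      by (rule emeasure_mono_AE) simp
    moreover have "emeasure \<mu> (fst -` ball z \<rho>) \<noteq> 0"
    proof
      assume "emeasure \<mu> (fst -` ball z \<rho>) = 0"
      then have "emeasure lborel (ball z \<rho>) = 0" using lower[of "ball z \<rho>"] by simp
      then show False using \<rho>(1) by (simp add: emeasure_ball unit_ball_vol_pos[THEN less_imp_neq, symmetric])
    qed
    ultimately show ?thesis by (metis le_zero_eq zero_less_iff_neq_zero)
  qed
  then have "?x \<in> measure_support \<mu>" by (simp add: measure_support_def)
  moreover have "?x \<in> vcube (z, l) 1" using l by (simp add: vcube_def hcube_def)
  ultimately show ?thesis by blast
qed

lemma alpha_eq_INF:
  assumes "0 < l"
  shows "alpha C\<Gamma> \<mu> (z, l) = (INF cL\<in>plane_set. plane_dist (z, l) cL)"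
proof -
  have "alpha C\<Gamma> \<mu> (z, l) = ennreal (1 / l ^ (CARD('n) + 1)) *
      (INF cL\<in>plane_set. dist_F (B_Q C\<Gamma> (z, l)) \<mu> (plane_measure (fst cL) (snd cL)))"
    using cube_meets_support[OF assms, of z] unfolding alpha_def plane_measure_def by simp
  also have "\<dots> = (INF cL\<in>plane_set. plane_dist (z, l) cL)"
    using assms unfolding plane_dist_def snd_conv by (intro INF_ennreal_mult_left[symmetric]) simp
  finally show ?thesis .
qed

lemma plane_error_measurable: "plane_error Q cL \<in> borel_measurable borel"
  unfolding plane_error_def[abs_def] by measurable

lemma nn_integral_plane_error_le:
  assumes l: "0 < l" and cL: "cL \<in> plane_set" and L': "L' \<in> nplanes CARD('n)"
    and a: "0 < a" "plane_dist (z, l) cL \<le> ennreal a"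
    and b: "0 < b" "ennreal (1 / l ^ CARD('n)) * (\<integral>\<^sup>+y\<in>vcube (z, l) C\<Gamma>. ennreal ((infdist y L' / l)\<^sup>2) \<partial>\<mu>) \<le> ennreal (b\<^sup>2)"
  shows "(\<integral>\<^sup>+x\<in>vcube (z, l) 1. plane_error (z, l) cL x \<partial>\<mu>)
    \<le> ennreal (geometric_const * (a\<^sup>2 + b\<^sup>2)) * emeasure \<mu> (vcube (z, l) 1)"
proof -
  let ?L = "snd cL"
  have L: "?L \<in> nplanes CARD('n)" using cL by auto
  have D: "dist_F (B_Q C\<Gamma> (z, l)) \<mu> (plane_measure (fst cL) ?L) \<le> ennreal (a * l ^ (CARD('n) + 1))"
    using a(2) l unfolding plane_dist_def snd_conv by (intro ennreal_divide_scale_le) auto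
  have \<beta>: "(\<integral>\<^sup>+y\<in>vcube (z, l) C\<Gamma>. ennreal ((infdist y L' / l)\<^sup>2) \<partial>\<mu>) \<le> ennreal (b\<^sup>2 * l ^ CARD('n))"
    using b(2) l by (intro ennreal_divide_scale_le) auto
  have "(\<integral>\<^sup>+x\<in>vcube (z, l) 1. plane_error (z, l) cL x \<partial>\<mu>)
      \<le> (\<integral>\<^sup>+x\<in>vcube (z, l) 1. ennreal ((min 1 (a + infdist x ?L / l))\<^sup>2) \<partial>\<mu>)"
  proof (intro nn_integral_mono mult_right_mono)
    fix x
    have h0: "0 \<le> infdist x ?L / l" by (rule divide_nonneg_pos[OF infdist_nonneg l])
    have "min 1 (plane_dist (z, l) cL + ennreal (infdist x ?L / l)) \<le> min 1 (ennreal a + ennreal (infdist x ?L / l))"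
      using a(2) by (intro min.mono add_right_mono) auto
    also have "\<dots> = ennreal (min 1 (a + infdist x ?L / l))"
      using a(1) h0 by (simp add: ennreal_plus[symmetric] min_1_ennreal del: ennreal_plus)
    finally show "plane_error (z, l) cL x \<le> ennreal ((min 1 (a + infdist x ?L / l))\<^sup>2)"
      using a(1) h0 by (simp add: plane_error_def ennreal_power[symmetric] power_mono)
  qed simp
  also have "\<dots> \<le> ennreal (geometric_const * (a\<^sup>2 + b\<^sup>2)) * emeasure \<mu> (vcube (z, l) 1)"
    by (rule nn_integral_cube_le[OF l a(1) b(1) D \<beta> L L'])
  finally show ?thesis .
qed

lemma geometric_const_pos: "0 < geometric_const"
proof -
  have "0 < 16 * markov_const\<^sup>2" using markov_const_ge_1 by simp
  moreover have "0 \<le> 3 * (1 + plane_slope)\<^sup>2 * (markov_const\<^sup>2 + cube_const)"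
    using cube_const_pos by simp
  ultimately show ?thesis unfolding geometric_const_def
    by (smt (verit) zero_le_power2)
qed

text \<open>The infima in \<open>alpha\<close> and \<open>beta2\<close> need not be attained and may
  be 0, whereas the estimate for fixed planes requires positive bounds. Both are therefore enlarged
  by \<open>e\<close>, which then tends to 0.\<close>

lemma nn_integral_plane_error_INF_le:
  assumes l: "0 < l" and s: "range s \<subseteq> plane_set"
    and INF: "(INF cL\<in>plane_set. plane_dist (z, l) cL) = (INF i. plane_dist (z, l) (s i))"
  shows "(\<integral>\<^sup>+x\<in>vcube (z, l) 1. (INF i. plane_error (z, l) (s i) x) \<partial>\<mu>)
    \<le> ennreal geometric_const * ((alpha C\<Gamma> \<mu> (z, l))\<^sup>2 + (beta2 C\<Gamma> \<mu> (z, l))\<^sup>2) * emeasure \<mu> (vcube (z, l) 1)"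
    (is "?X \<le> _ * (?\<alpha>\<^sup>2 + ?\<beta>\<^sup>2) * ?m")
proof (cases "?\<alpha> = top \<or> ?\<beta> = top")
  case True
  then have sum: "?\<alpha>\<^sup>2 + ?\<beta>\<^sup>2 = top" by (auto simp: power2_eq_square ennreal_mult_eq_top_iff)
  \<comment> \<open>An infinite coefficient makes the right side infinite because the cube has
    positive measure.\<close>
  have "ennreal geometric_const * (?\<alpha>\<^sup>2 + ?\<beta>\<^sup>2) * ?m = top"
    unfolding sum using emeasure_cube_pos[OF l, of z] geometric_const_pos
    by (simp add: ennreal_mult_eq_top_iff zero_less_iff_neq_zero[symmetric])
  then show ?thesis by (simp only: top_greatest)
next
  case False
  obtain \<alpha> where \<alpha>: "0 \<le> \<alpha>" "?\<alpha> = ennreal \<alpha>" using False by (cases ?\<alpha>) auto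
  obtain \<beta> where \<beta>: "0 \<le> \<beta>" "?\<beta> = ennreal \<beta>" using False by (cases ?\<beta>) auto
  obtain m where m: "0 \<le> m" "?m = ennreal m" using emeasure_cube_finite[OF l, of z] by (cases ?m) auto
  have ev: "?X \<le> ennreal (geometric_const * ((\<alpha> + e)\<^sup>2 + (\<beta> + e)\<^sup>2) * m)" if e: "0 < e" for e
  proof -
    have "(INF i. plane_dist (z, l) (s i)) < ennreal (\<alpha> + e)"
      using \<alpha> e by (simp add: alpha_eq_INF[OF l] INF[symmetric] ennreal_less_iff)
    then obtain i where i: "plane_dist (z, l) (s i) < ennreal (\<alpha> + e)" by (auto simp: INF_less_iff)
    have "beta2 C\<Gamma> \<mu> (z, l) < ennreal (\<beta> + e)" using \<beta> e by (simp add: ennreal_less_iff)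
    then obtain L' where L': "L' \<in> nplanes CARD('n)"
      "ennsqrt (ennreal (1 / l ^ CARD('n)) * (\<integral>\<^sup>+y\<in>vcube (z, l) C\<Gamma>. ennreal ((infdist y L' / l)\<^sup>2) \<partial>\<mu>)) < ennreal (\<beta> + e)"
      unfolding beta2_def snd_conv by (auto simp: INF_less_iff)
    have "?X \<le> (\<integral>\<^sup>+x\<in>vcube (z, l) 1. plane_error (z, l) (s i) x \<partial>\<mu>)"
      by (intro nn_integral_mono mult_right_mono INF_lower) auto
    also have "\<dots> \<le> ennreal (geometric_const * ((\<alpha> + e)\<^sup>2 + (\<beta> + e)\<^sup>2)) * ?m"
      using s i \<alpha> \<beta> e by (intro nn_integral_plane_error_le[OF l _ L'(1)] ennsqrt_less_ennreal[OF L'(2)]) (auto simp: less_imp_le)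
    also have "\<dots> = ennreal (geometric_const * ((\<alpha> + e)\<^sup>2 + (\<beta> + e)\<^sup>2) * m)"
      using m geometric_const_pos by (simp add: ennreal_mult')
    finally show ?thesis .
  qed
  have "((\<lambda>e. ennreal (geometric_const * ((\<alpha> + e)\<^sup>2 + (\<beta> + e)\<^sup>2) * m))
      \<longlongrightarrow> ennreal (geometric_const * ((\<alpha> + 0)\<^sup>2 + (\<beta> + 0)\<^sup>2) * m)) (at_right 0)"
    by (intro tendsto_ennrealI tendsto_intros)
  moreover have "\<forall>\<^sub>F e in at_right 0. ?X \<le> ennreal (geometric_const * ((\<alpha> + e)\<^sup>2 + (\<beta> + e)\<^sup>2) * m)"
    using ev by (auto simp: eventually_at_right_field intro!: exI[of _ 1])
  ultimately have "?X \<le> ennreal (geometric_const * (\<alpha>\<^sup>2 + \<beta>\<^sup>2) * m)"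
    by (intro tendsto_lowerbound[where F="at_right 0"]) auto
  also have "\<dots> = ennreal geometric_const * (?\<alpha>\<^sup>2 + ?\<beta>\<^sup>2) * ?m"
    using \<alpha> \<beta> m geometric_const_pos
    by (simp add: ennreal_mult' ennreal_plus[symmetric] ennreal_power del: ennreal_plus)
  finally show ?thesis .
qed

text \<open>Each term is bounded by its normalised increment times the capped error of the plane,
  and the squared increments of one scale sum to at most 1.\<close>

lemma scale_sum_le:
  fixes K :: "(real^'n) \<times> (real^'m) \<Rightarrow> real" and \<epsilon> :: "int \<Rightarrow> real"
  assumes C1: "0 < C1"
    and k: "trunc_kernel_bounded C1 \<phi> K"
    and K: "CZ_kernel CARD('n) CK K" and \<phi>: "cutoff_profile CARD('n) \<phi>"
    and \<epsilon>: "\<And>m. 0 < \<epsilon> m" "\<And>m. \<epsilon> (m + 1) < \<epsilon> m"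
    and l: "l = 2 powr (- real_of_int j)" and x: "x \<in> vcube (z, l) 1" and cL: "cL \<in> plane_set"
  shows "(\<integral>\<^sup>+m. (if \<epsilon> m \<in> dyI j \<and> \<epsilon> (m + 1) \<in> dyI j
            then ennreal ((trunc_conv \<phi> K \<mu> (\<epsilon> (m + 1)) (\<epsilon> m) x)\<^sup>2) else 0) \<partial>count_space UNIV)
    \<le> ennreal ((kernel_const * C1)\<^sup>2) * plane_error (z, l) cL x"
proof -
  have l0: "0 < l" by (simp add: l)
  let ?L = "snd cL"
  have L: "?L \<in> nplanes CARD('n)" using cL by auto
  have h0: "0 \<le> infdist x ?L / l" by (rule divide_nonneg_pos[OF infdist_nonneg l0])
  \<comment> \<open>\<open>t\<close> is the capped error as a real number. A finite plane distance
    allows cancellation; an infinite one gives \<open>t = 1\<close> and the trivial bound.\<close>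
  obtain t where t: "0 \<le> t" "ennreal t = min 1 (plane_dist (z, l) cL + ennreal (infdist x ?L / l))"
    and bound: "\<And>k B. 0 < B \<Longrightarrow> (\<And>z. \<bar>k z\<bar> \<le> B / l ^ CARD('n)) \<Longrightarrow>
      (B / l ^ (CARD('n) + 1))-lipschitz_on UNIV k \<Longrightarrow>
      (\<And>z. 3 * sqrt (real CARD('n)) * l \<le> norm (fst z) \<Longrightarrow> k z = 0) \<Longrightarrow>
      (\<And>z. k (- z) = - k z) \<Longrightarrow> \<bar>\<integral>y. k (x - y) \<partial>\<mu>\<bar> \<le> kernel_const * B * t"
  proof (cases "plane_dist (z, l) cL")
    case (real a)
    have D: "dist_F (B_Q C\<Gamma> (z, l)) \<mu> (plane_measure (fst cL) ?L) \<le> ennreal (a * l ^ (CARD('n) + 1))"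
      using real l0 unfolding plane_dist_def snd_conv by (intro ennreal_divide_scale_le) auto
    show thesis
    proof (rule that)
      show "0 \<le> min 1 (a + infdist x ?L / l)" using real h0 by simp
      show "ennreal (min 1 (a + infdist x ?L / l)) = min 1 (plane_dist (z, l) cL + ennreal (infdist x ?L / l))"
        using real h0 by (simp add: ennreal_plus[symmetric] min_1_ennreal del: ennreal_plus)
    qed (intro integral_kernel_le[OF l0 _ _ _ _ _ dist_center_le[OF x] L _ D] real; assumption)
  next
    case top
    show thesis
      by (rule that[of 1]) (use integral_kernel_le_const[OF l0] top in auto)
  qed
  have "(\<integral>\<^sup>+m. (if \<epsilon> m \<in> dyI j \<and> \<epsilon> (m + 1) \<in> dyI j
            then ennreal ((trunc_conv \<phi> K \<mu> (\<epsilon> (m + 1)) (\<epsilon> m) x)\<^sup>2) else 0) \<partial>count_space UNIV)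
    \<le> (\<integral>\<^sup>+m. ennreal ((kernel_const * C1 * t)\<^sup>2) * (if \<epsilon> m \<in> dyI j \<and> \<epsilon> (m + 1) \<in> dyI j
            then ennreal (((\<epsilon> m - \<epsilon> (m + 1)) / l)\<^sup>2) else 0) \<partial>count_space UNIV)"
  proof (rule nn_integral_mono)
    fix m
    show "(if \<epsilon> m \<in> dyI j \<and> \<epsilon> (m + 1) \<in> dyI j
            then ennreal ((trunc_conv \<phi> K \<mu> (\<epsilon> (m + 1)) (\<epsilon> m) x)\<^sup>2) else 0)
      \<le> ennreal ((kernel_const * C1 * t)\<^sup>2) * (if \<epsilon> m \<in> dyI j \<and> \<epsilon> (m + 1) \<in> dyI j
            then ennreal (((\<epsilon> m - \<epsilon> (m + 1)) / l)\<^sup>2) else 0)"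
    proof (cases "\<epsilon> m \<in> dyI j \<and> \<epsilon> (m + 1) \<in> dyI j")
      case True
      let ?\<epsilon> = "\<epsilon> (m + 1)" and ?\<delta> = "\<epsilon> m"
      let ?B = "C1 * ((?\<delta> - ?\<epsilon>) / l)"
      have "2 powr (- real_of_int j - 1) = l / 2" by (simp add: l powr_diff)
      then have e: "l / 2 \<le> ?\<epsilon>" "?\<epsilon> < ?\<delta>" "?\<delta> < l" using True \<epsilon>(2)[of m] by (auto simp: dyI_def l)
      have B: "0 < ?B" using C1 e l0 by simp
      have "\<bar>\<integral>y. trunc_kernel \<phi> K ?\<epsilon> ?\<delta> (x - y) \<partial>\<mu>\<bar> \<le> kernel_const * ?B * t"
        using k l0 e by (intro bound B trunc_kernel_eq_0[OF \<phi> \<epsilon>(1) e(2,3)] trunc_kernel_uminus[OF K])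
          (auto simp: trunc_kernel_bounded_def)
      also have "\<dots> = kernel_const * C1 * t * ((?\<delta> - ?\<epsilon>) / l)" by simp
      finally have "\<bar>trunc_conv \<phi> K \<mu> ?\<epsilon> ?\<delta> x\<bar> \<le> kernel_const * C1 * t * ((?\<delta> - ?\<epsilon>) / l)"
        by (simp add: trunc_conv_def trunc_kernel_def radial_cutoff_def)
      then have "(trunc_conv \<phi> K \<mu> ?\<epsilon> ?\<delta> x)\<^sup>2 \<le> (kernel_const * C1 * t * ((?\<delta> - ?\<epsilon>) / l))\<^sup>2"
        using power_mono[of "\<bar>trunc_conv \<phi> K \<mu> ?\<epsilon> ?\<delta> x\<bar>" _ 2] by (simp only: power2_abs abs_ge_zero)
      then show ?thesis using True
        by (simp only: if_True simp_thms ennreal_mult'[symmetric] power_mult_distrib[symmetric] ennreal_leI zero_le_power2)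
    qed auto
  qed
  also have "\<dots> = ennreal ((kernel_const * C1 * t)\<^sup>2) * (\<integral>\<^sup>+m. (if \<epsilon> m \<in> dyI j \<and> \<epsilon> (m + 1) \<in> dyI j
            then ennreal (((\<epsilon> m - \<epsilon> (m + 1)) / l)\<^sup>2) else 0) \<partial>count_space UNIV)"
    by (rule nn_integral_cmult) simp
  also have "\<dots> \<le> ennreal ((kernel_const * C1 * t)\<^sup>2) * 1"
    by (intro mult_left_mono nn_integral_dyadic_increments_le \<epsilon> l) simp
  also have "\<dots> = ennreal ((kernel_const * C1)\<^sup>2) * plane_error (z, l) cL x"
    using t(1) unfolding plane_error_def snd_conv t(2)[symmetric] by (simp add: power_mult_distrib ennreal_mult' ennreal_power)
  finally show ?thesis .
qed

text \<open>The supremum over sequences of radii is bounded pointwise by a measurable sum over cubes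
  that does not involve the sequence; Tonelli is applied to this sum only.\<close>

lemma nn_integral_S_sq_le:
  fixes K :: "(real^'n) \<times> (real^'m) \<Rightarrow> real"
  assumes C1: "0 < C1"
    and k: "trunc_kernel_bounded C1 \<phi> K"
    and K: "CZ_kernel CARD('n) CK K" and \<phi>: "cutoff_profile CARD('n) \<phi>"
  shows "(\<integral>\<^sup>+x. S_sq \<phi> K \<mu> x \<partial>\<mu>) \<le> ennreal ((kernel_const * C1)\<^sup>2 * geometric_const) *
    (\<integral>\<^sup>+Q. ((alpha C\<Gamma> \<mu> Q)\<^sup>2 + (beta2 C\<Gamma> \<mu> Q)\<^sup>2) * emeasure \<mu> (vcube Q 1) \<partial>count_space dyadic_vcubes)"
proof -
  let ?D = "dyadic_vcubes :: ((real^'n) \<times> real) set"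
  let ?\<kappa> = "ennreal ((kernel_const * C1)\<^sup>2)"
  have "\<exists>s :: nat \<Rightarrow> _. range s \<subseteq> plane_set \<and>
      (INF cL\<in>plane_set. plane_dist Q cL) = (INF i. plane_dist Q (s i))" for Q
    using INF_eq_INF_sequence[OF plane_set_nonempty] by metis
  \<comment> \<open>The planes depend on the cube only, not on \<open>x\<close>, which makes the
    infimum \<open>G\<close> measurable in \<open>x\<close>.\<close>
  then obtain s :: "(real^'n) \<times> real \<Rightarrow> nat \<Rightarrow> _" where s: "\<And>Q. range (s Q) \<subseteq> plane_set"
    "\<And>Q. (INF cL\<in>plane_set. plane_dist Q cL) = (INF i. plane_dist Q (s Q i))"
    by metis
  define G where "G Q x = (INF i. plane_error Q (s Q i) x)" for Q x
  have G_meas [measurable]: "G Q \<in> borel_measurable borel" for Q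
    unfolding G_def[abs_def]
    by (intro borel_measurable_INF plane_error_measurable) simp
  have pointwise: "S_sq \<phi> K \<mu> x \<le> (\<integral>\<^sup>+Q. ?\<kappa> * (G Q x * indicator (vcube Q 1) x) \<partial>count_space ?D)" for x
    unfolding S_sq_def
  proof (rule SUP_least)
    fix \<epsilon> :: "int \<Rightarrow> real"
    assume "\<epsilon> \<in> {\<epsilon>. (\<forall>m. 0 < \<epsilon> m) \<and> (\<forall>m. \<epsilon> (m + 1) < \<epsilon> m)}"
    then have \<epsilon>: "\<And>m. 0 < \<epsilon> m" "\<And>m. \<epsilon> (m + 1) < \<epsilon> m" by auto
    let ?g = "\<lambda>Q. ?\<kappa> * (G Q x * indicator (vcube Q 1) x)"
    have "(\<integral>\<^sup>+m. (if \<epsilon> m \<in> dyI j \<and> \<epsilon> (m + 1) \<in> dyI j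
            then ennreal ((trunc_conv \<phi> K \<mu> (\<epsilon> (m + 1)) (\<epsilon> m) x)\<^sup>2) else 0) \<partial>count_space UNIV)
        \<le> ?g (dyadic_cube j x)" for j
    proof -
      let ?Q = "dyadic_cube j x"
      have xQ: "x \<in> vcube (fst ?Q, snd ?Q) 1" using in_dyadic_cube[of x j] by simp
      have *: "(\<integral>\<^sup>+m. (if \<epsilon> m \<in> dyI j \<and> \<epsilon> (m + 1) \<in> dyI j
            then ennreal ((trunc_conv \<phi> K \<mu> (\<epsilon> (m + 1)) (\<epsilon> m) x)\<^sup>2) else 0) \<partial>count_space UNIV)
          \<le> ?\<kappa> * plane_error ?Q cL x" if "cL \<in> plane_set" for cL
        using scale_sum_le[where \<epsilon>=\<epsilon> and j=j, OF C1 k K \<phi> \<epsilon> snd_dyadic_cube[of j x] xQ that] by simp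
      have "(\<integral>\<^sup>+m. (if \<epsilon> m \<in> dyI j \<and> \<epsilon> (m + 1) \<in> dyI j
            then ennreal ((trunc_conv \<phi> K \<mu> (\<epsilon> (m + 1)) (\<epsilon> m) x)\<^sup>2) else 0) \<partial>count_space UNIV)
          \<le> (INF i. ?\<kappa> * plane_error ?Q (s ?Q i) x)"
        by (intro INF_greatest * subsetD[OF s(1) rangeI])
      also have "\<dots> = ?\<kappa> * G ?Q x" unfolding G_def using kernel_const_ge_1 C1 by (intro INF_ennreal_mult_left) simp
      finally show ?thesis using in_dyadic_cube[of x j] by simp
    qed
    then have "(\<integral>\<^sup>+j. (\<integral>\<^sup>+m. (if \<epsilon> m \<in> dyI j \<and> \<epsilon> (m + 1) \<in> dyI j
            then ennreal ((trunc_conv \<phi> K \<mu> (\<epsilon> (m + 1)) (\<epsilon> m) x)\<^sup>2) else 0) \<partial>count_space UNIV) \<partial>count_space UNIV)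
        \<le> (\<integral>\<^sup>+j. ?g (dyadic_cube j x) \<partial>count_space UNIV)"
      by (intro nn_integral_mono) auto
    \<comment> \<open>Reindexing by the cubes around \<open>x\<close> is possible by injectivity;
      afterwards the sum is enlarged to all dyadic cubes.\<close>
    also have "\<dots> = (\<integral>\<^sup>+Q. ?g Q \<partial>count_space (range (\<lambda>j. dyadic_cube j x)))"
      by (intro nn_integral_bij_count_space inj_on_imp_bij_betw inj_dyadic_cube)
    also have "\<dots> = (\<integral>\<^sup>+Q. ?g Q * indicator (range (\<lambda>j. dyadic_cube j x)) Q \<partial>count_space UNIV)"
      by (subst nn_integral_count_space_indicator) auto
    also have "\<dots> \<le> (\<integral>\<^sup>+Q. ?g Q * indicator ?D Q \<partial>count_space UNIV)"
      using dyadic_cube_in[of _ x] by (intro nn_integral_mono mult_left_mono) (auto simp: indicator_def)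
    also have "\<dots> = (\<integral>\<^sup>+Q. ?g Q \<partial>count_space ?D)"
      by (subst (2) nn_integral_count_space_indicator) auto
    finally show "(\<integral>\<^sup>+j. (\<integral>\<^sup>+m. (if \<epsilon> m \<in> dyI j \<and> \<epsilon> (m + 1) \<in> dyI j
            then ennreal ((trunc_conv \<phi> K \<mu> (\<epsilon> (m + 1)) (\<epsilon> m) x)\<^sup>2) else 0) \<partial>count_space UNIV) \<partial>count_space UNIV)
        \<le> (\<integral>\<^sup>+Q. ?g Q \<partial>count_space ?D)" .
  qed
  have "(\<integral>\<^sup>+x. S_sq \<phi> K \<mu> x \<partial>\<mu>) \<le> (\<integral>\<^sup>+x. (\<integral>\<^sup>+Q. ?\<kappa> * (G Q x * indicator (vcube Q 1) x) \<partial>count_space ?D) \<partial>\<mu>)"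
    by (intro nn_integral_mono pointwise)
  also have "\<dots> = (\<integral>\<^sup>+Q. (\<integral>\<^sup>+x. ?\<kappa> * (G Q x * indicator (vcube Q 1) x) \<partial>\<mu>) \<partial>count_space ?D)"
    by (rule nn_integral_count_space_nn_integral[OF countable_dyadic_vcubes]) measurable
  also have "\<dots> \<le> (\<integral>\<^sup>+Q. ennreal ((kernel_const * C1)\<^sup>2 * geometric_const) *
      (((alpha C\<Gamma> \<mu> Q)\<^sup>2 + (beta2 C\<Gamma> \<mu> Q)\<^sup>2) * emeasure \<mu> (vcube Q 1)) \<partial>count_space ?D)"
  proof (rule nn_integral_mono)
    fix Q assume "Q \<in> space (count_space ?D)"
    then have l: "0 < snd Q" by (auto simp: dyadic_vcubes_def)
    have "(\<integral>\<^sup>+x. ?\<kappa> * (G Q x * indicator (vcube Q 1) x) \<partial>\<mu>) = ?\<kappa> * (\<integral>\<^sup>+x\<in>vcube Q 1. G Q x \<partial>\<mu>)"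
      by (rule nn_integral_cmult) measurable
    also have "\<dots> \<le> ?\<kappa> * (ennreal geometric_const * ((alpha C\<Gamma> \<mu> Q)\<^sup>2 + (beta2 C\<Gamma> \<mu> Q)\<^sup>2) * emeasure \<mu> (vcube Q 1))"
      using nn_integral_plane_error_INF_le[OF l, of "s Q" "fst Q"] s[of Q]
      unfolding G_def by (intro mult_left_mono) auto
    also have "\<dots> = ennreal ((kernel_const * C1)\<^sup>2 * geometric_const) *
      (((alpha C\<Gamma> \<mu> Q)\<^sup>2 + (beta2 C\<Gamma> \<mu> Q)\<^sup>2) * emeasure \<mu> (vcube Q 1))"
      using geometric_const_pos by (simp add: ennreal_mult' mult.assoc)
    finally show "(\<integral>\<^sup>+x. ?\<kappa> * (G Q x * indicator (vcube Q 1) x) \<partial>\<mu>) \<le> \<dots>" .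
  qed
  also have "\<dots> = ennreal ((kernel_const * C1)\<^sup>2 * geometric_const) *
    (\<integral>\<^sup>+Q. ((alpha C\<Gamma> \<mu> Q)\<^sup>2 + (beta2 C\<Gamma> \<mu> Q)\<^sup>2) * emeasure \<mu> (vcube Q 1) \<partial>count_space ?D)"
    by (rule nn_integral_cmult) simp
  finally show ?thesis .
qed

end

section \<open>Hausdorff measure on a Lipschitz graph, and the proof of the theorem\<close>

text \<open>The constant \<open>M\<close> bounds the difference quotients, so the supremum in
  \<open>lip\<close> is a genuine least upper bound.\<close>

lemma dist_le_lip:
  fixes A :: "'a::metric_space \<Rightarrow> 'b::metric_space"
  assumes "M-lipschitz_on UNIV A"
  shows "dist (A x) (A y) \<le> lip A * dist x y"
proof (cases "x = y")
  case False
  have "bdd_above {dist (A x) (A y) / dist x y | x y. x \<noteq> y}"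
    using lipschitz_onD[OF assms] by (intro bdd_aboveI[of _ M]) (auto simp: pos_divide_le_eq)
  then have "dist (A x) (A y) / dist x y \<le> lip A"
    unfolding lip_def using False by (intro cSup_upper) auto
  then show ?thesis using False by (simp add: pos_divide_le_eq)
qed simp

lemma lip_nonneg:
  fixes A :: "real^'n \<Rightarrow> 'b::metric_space"
  assumes "M-lipschitz_on UNIV A"
  shows "0 \<le> lip A"
proof -
  have "0 \<le> dist (A 0) (A 1)" by simp
  also have "\<dots> \<le> lip A * dist (0 :: real^'n) 1" by (rule dist_le_lip[OF assms])
  finally show ?thesis by (simp add: zero_le_mult_iff)
qed

lemma graph_borel:
  fixes A :: "'a::metric_space \<Rightarrow> 'b::metric_space"
  assumes "M-lipschitz_on UNIV A"
  shows "{(x, A x) | x. True} \<in> sets borel"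
proof -
  have \<Gamma>: "{(x, A x) | x. True} = {x. snd x = A (fst x)}" by auto
  have "continuous_on UNIV (\<lambda>x :: 'a \<times> 'b. A (fst x))"
    using lipschitz_on_continuous_on[OF assms]
    by (rule continuous_on_compose2) (auto intro: continuous_intros)
  then have "closed {(x, A x) | x. True}"
    unfolding \<Gamma> by (intro closed_Collect_eq continuous_intros)
  then show ?thesis by simp
qed

text \<open>The upper bound comes from covering the graph over a grid. For the lower bound, the
  nonexpansive projection \<open>fst\<close> maps the part of the graph above \<open>E\<close> onto
  \<open>E\<close>, and Lebesgue measure is at most \<open>2 ^ n\<close> times the Hausdorff outer
  measure there.\<close>

lemma lipschitz_graph_measure_hausdorff:
  fixes A :: "real^'n \<Rightarrow> real^'m" and f :: "(real^'n) \<times> (real^'m) \<Rightarrow> real"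
  assumes \<Gamma>: "\<Gamma> = {(x, A x) | x. True}"
    and H: "measure_space UNIV (sets borel) (hausdorff_outer CARD('n) :: ((real^'n) \<times> (real^'m)) set \<Rightarrow> ennreal)"
    and A: "\<And>x y. dist (A x) (A y) \<le> \<Lambda> * dist x y" and \<Lambda>: "0 \<le> \<Lambda>"
    and f: "f \<in> borel_measurable borel" "\<And>x. 1 / C \<le> f x" "\<And>x. f x \<le> C" and C: "1 \<le> C"
    and C\<Gamma>: "10 * sqrt (real CARD('n)) < C\<Gamma>"
  shows "lipschitz_graph_measure A
     (density (hausdorff_measure CARD('n)) (\<lambda>x. ennreal (f x) * indicator \<Gamma> x)) \<Lambda>
     (C * (unit_ball_vol (real CARD('n)) * (2 * (1 + \<Lambda>) * sqrt (real CARD('n))) ^ CARD('n)))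
     (2 ^ CARD('n) * C) C\<Gamma>"
proof
  let ?n = "CARD('n)"
  let ?H = "hausdorff_measure ?n :: ((real^'n) \<times> (real^'m)) measure"
  let ?\<mu> = "density ?H (\<lambda>x. ennreal (f x) * indicator \<Gamma> x)"
  have [measurable]: "\<Gamma> \<in> sets borel"
    unfolding \<Gamma> using A \<Lambda> by (intro graph_borel lipschitz_onI)
  have in_\<Gamma>: "x \<in> \<Gamma> \<longleftrightarrow> snd x = A (fst x)" for x by (cases x) (auto simp: \<Gamma>)
  note f(1) [measurable]
  show "dist (A x) (A y) \<le> \<Lambda> * dist x y" for x y by (rule A)
  show "0 \<le> \<Lambda>" "10 * sqrt (real ?n) < C\<Gamma>" by fact+
  show "sets ?\<mu> = sets borel" by simp
  show "AE x in ?\<mu>. snd x = A (fst x)"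
    by (subst AE_density) (measurable, auto simp: in_\<Gamma>[symmetric] indicator_def)
  show "0 < C * (unit_ball_vol (real ?n) * (2 * (1 + \<Lambda>) * sqrt (real ?n)) ^ ?n)"
    using C \<Lambda> unit_ball_vol_pos[of "real ?n"] by (intro mult_pos_pos zero_less_power) auto
  show "0 < 2 ^ ?n * C" using C by simp
  show "emeasure ?\<mu> {x. dist (fst x) z \<le> r}
      \<le> ennreal (C * (unit_ball_vol (real ?n) * (2 * (1 + \<Lambda>) * sqrt (real ?n)) ^ ?n) * r ^ ?n)" if r: "0 < r" for r z
  proof -
    let ?S = "{x :: (real^'n) \<times> (real^'m). dist (fst x) z \<le> r}"
    have [measurable]: "?S \<in> sets borel"
      by (intro borel_closed closed_Collect_le continuous_intros)
    have "emeasure ?\<mu> ?S = (\<integral>\<^sup>+x. ennreal (f x) * indicator \<Gamma> x * indicator ?S x \<partial>?H)"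
      by (rule emeasure_density) measurable
    also have "\<dots> \<le> (\<integral>\<^sup>+x. ennreal C * indicator (\<Gamma> \<inter> ?S) x \<partial>?H)"
      using f(3) by (intro nn_integral_mono) (auto simp: indicator_def ennreal_leI)
    also have "\<dots> = ennreal C * emeasure ?H (\<Gamma> \<inter> ?S)"
      by (rule nn_integral_cmult_indicator) measurable
    also have "\<dots> \<le> ennreal C * ennreal (unit_ball_vol (real ?n) * (2 * (1 + \<Lambda>) * sqrt (real ?n) * r) ^ ?n)"
    proof (rule mult_left_mono)
      have "\<Gamma> \<inter> ?S = {x. snd x = A (fst x) \<and> dist (fst x) z \<le> r}" by (auto simp: in_\<Gamma>)
      then show "emeasure ?H (\<Gamma> \<inter> ?S) \<le> ennreal (unit_ball_vol (real ?n) * (2 * (1 + \<Lambda>) * sqrt (real ?n) * r) ^ ?n)"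
        using order_trans[OF emeasure_hausdorff_measure_le hausdorff_outer_graph_le[OF A \<Lambda> r]] by simp
    qed simp
    also have "\<dots> = ennreal (C * (unit_ball_vol (real ?n) * (2 * (1 + \<Lambda>) * sqrt (real ?n)) ^ ?n) * r ^ ?n)"
      using C by (simp add: ennreal_mult'[symmetric] power_mult_distrib mult_ac)
    finally show ?thesis .
  qed
  show "emeasure lborel E \<le> ennreal (2 ^ ?n * C) * emeasure ?\<mu> (fst -` E)" if E: "E \<in> sets borel" for E
  proof -
    let ?S = "fst -` E :: ((real^'n) \<times> (real^'m)) set"
    have "(fst :: (real^'n) \<times> (real^'m) \<Rightarrow> _) \<in> borel_measurable borel"
      by (intro borel_measurable_continuous_onI continuous_intros)
    from measurable_sets[OF this E] have [measurable]: "?S \<in> sets borel" by simp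
    have "E = fst ` (\<Gamma> \<inter> ?S)" by (force simp: \<Gamma>)
    then have "hausdorff_outer ?n E \<le> hausdorff_outer ?n (\<Gamma> \<inter> ?S)"
      using hausdorff_outer_nonexpansive_image[of fst ?n "\<Gamma> \<inter> ?S"] dist_fst_le by metis
    also have "\<dots> = emeasure ?H (\<Gamma> \<inter> ?S)"
      by (rule emeasure_hausdorff_measure[OF H, symmetric]) measurable
    also have "\<dots> = (\<integral>\<^sup>+x. indicator (\<Gamma> \<inter> ?S) x \<partial>?H)" by simp
    also have "\<dots> \<le> (\<integral>\<^sup>+x. ennreal C * (ennreal (f x) * indicator \<Gamma> x * indicator ?S x) \<partial>?H)"
    proof (rule nn_integral_mono)
      fix x
      have "1 \<le> C * f x" using f(2)[of x] C by (simp add: pos_divide_le_eq mult.commute)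
      then have "1 \<le> ennreal C * ennreal (f x)" using C by (simp add: ennreal_mult'[symmetric])
      then show "indicator (\<Gamma> \<inter> ?S) x \<le> ennreal C * (ennreal (f x) * indicator \<Gamma> x * indicator ?S x)"
        by (auto simp: indicator_def)
    qed
    also have "\<dots> = ennreal C * (\<integral>\<^sup>+x. ennreal (f x) * indicator \<Gamma> x * indicator ?S x \<partial>?H)"
      by (rule nn_integral_cmult) measurable
    also have "(\<integral>\<^sup>+x. ennreal (f x) * indicator \<Gamma> x * indicator ?S x \<partial>?H) = emeasure ?\<mu> ?S"
      by (rule emeasure_density[symmetric]) measurable
    finally have "2 ^ ?n * hausdorff_outer ?n E \<le> 2 ^ ?n * (ennreal C * emeasure ?\<mu> ?S)"
      by (rule mult_left_mono) simp
    then have "emeasure lborel E \<le> 2 ^ ?n * (ennreal C * emeasure ?\<mu> ?S)"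
      using lborel_le_hausdorff_outer[OF E] by (simp add: order_trans)
    also have "\<dots> = ennreal (2 ^ ?n * C) * emeasure ?\<mu> ?S"
    proof -
      have "(2::ennreal) ^ ?n = ennreal (2 ^ ?n)" by (simp add: ennreal_power[symmetric])
      then show ?thesis using C by (simp add: ennreal_mult' mult.assoc)
    qed
    finally show ?thesis .
  qed
qed

theorem theorem3p2:
  fixes K :: "(real^'n) \<times> (real^'m) \<Rightarrow> real"
    and \<phi> :: "real \<Rightarrow> real"
    and CK C0 L C\<Gamma> :: real
  assumes K: "CZ_kernel CARD('n) CK K"
    and \<phi>: "cutoff_profile CARD('n) \<phi>"
    and C0: "C0 > 0"
    and C\<Gamma>: "C\<Gamma> > 10 * sqrt (real CARD('n)) * (1 + L)"
  shows "\<exists>C>0. \<forall>(p :: real^'n) (l :: real) (A :: real^'n \<Rightarrow> real^'m) (f :: (real^'n) \<times> (real^'m) \<Rightarrow> real).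
     l > 0 \<and>
     (\<exists>M. M-lipschitz_on UNIV A) \<and> lip A = L \<and>
     (\<forall>x. x \<notin> ccube p l \<longrightarrow> A x = 0) \<and>
     f \<in> borel_measurable borel \<and>
     (\<forall>x. fst x \<notin> ccube p l \<longrightarrow> f x = 1) \<and>
     (\<forall>x. fst x \<in> ccube p l \<longrightarrow> 1 / C0 \<le> f x \<and> f x \<le> C0)
     \<longrightarrow>
     (let \<Gamma> = {(x, A x) | x. True};
          \<mu> = density (hausdorff_measure CARD('n)) (\<lambda>x. ennreal (f x) * indicator \<Gamma> x)
      in (\<integral>\<^sup>+ x. S_sq \<phi> K \<mu> x \<partial>\<mu>)
         \<le> ennreal C * (\<integral>\<^sup>+ Q. (alpha C\<Gamma> \<mu> Q ^ 2 + beta2 C\<Gamma> \<mu> Q ^ 2) * emeasure \<mu> (vcube Q 1)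
                           \<partial>count_space dyadic_vcubes))"
proof -
  obtain C1 where C1: "C1 > 0" "trunc_kernel_bounded C1 \<phi> K"
    using trunc_kernel_bounds[OF K \<phi>] by blast
  \<comment> \<open>With this choice \<open>1 / C\<close> and \<open>C\<close> also enclose the
    value 1 that \<open>f\<close> takes outside the cube.\<close>
  define C where "C = max 1 C0"
  define Cu where "Cu = C * (unit_ball_vol (real CARD('n)) * (2 * (1 + L) * sqrt (real CARD('n))) ^ CARD('n))"
  define Cl where "Cl = 2 ^ CARD('n) * C"
  \<comment> \<open>The constant is assembled from the exported definitions before \<open>A\<close>
    and \<open>f\<close> are introduced, which is the required uniformity.\<close>
  define B where "B = (lipschitz_graph_measure.kernel_const TYPE('n) Cu * C1)\<^sup>2
    * lipschitz_graph_measure.geometric_const TYPE('n) L Cl"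
  show ?thesis
  \<comment> \<open>The sign of \<open>L\<close> is unknown until some \<open>A\<close> is given, so
    positivity is secured by the maximum with 1.\<close>
  proof (intro exI[of _ "max 1 B"] conjI allI impI)
    fix p :: "real^'n" and l :: real and A :: "real^'n \<Rightarrow> real^'m" and f :: "(real^'n) \<times> (real^'m) \<Rightarrow> real"
    assume hyp: "l > 0 \<and>
     (\<exists>M. M-lipschitz_on UNIV A) \<and> lip A = L \<and>
     (\<forall>x. x \<notin> ccube p l \<longrightarrow> A x = 0) \<and>
     f \<in> borel_measurable borel \<and>
     (\<forall>x. fst x \<notin> ccube p l \<longrightarrow> f x = 1) \<and>
     (\<forall>x. fst x \<in> ccube p l \<longrightarrow> 1 / C0 \<le> f x \<and> f x \<le> C0)"
    then obtain M where M: "M-lipschitz_on UNIV A" and L: "lip A = L" by blast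
    have A: "dist (A x) (A y) \<le> L * dist x y" for x y using dist_le_lip[OF M] L by simp
    have L0: "0 \<le> L" using lip_nonneg[OF M] L by simp
    have f_meas [measurable]: "f \<in> borel_measurable borel" using hyp by blast
    define \<Gamma> where "\<Gamma> = {(x, A x) | x. True}"
    have [measurable]: "\<Gamma> \<in> sets borel" unfolding \<Gamma>_def by (rule graph_borel[OF M])
    define \<mu> where "\<mu> = density (hausdorff_measure CARD('n)) (\<lambda>x. ennreal (f x) * indicator \<Gamma> x)"
    let ?rhs = "\<integral>\<^sup>+ Q. (alpha C\<Gamma> \<mu> Q ^ 2 + beta2 C\<Gamma> \<mu> Q ^ 2) * emeasure \<mu> (vcube Q 1) \<partial>count_space dyadic_vcubes"
    have "(\<integral>\<^sup>+ x. S_sq \<phi> K \<mu> x \<partial>\<mu>) \<le> ennreal (max 1 B) * ?rhs"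
    proof (cases "measure_space UNIV (sets borel) (hausdorff_outer CARD('n) :: ((real^'n) \<times> (real^'m)) set \<Rightarrow> ennreal)")
      case True
      have C: "1 \<le> C" "1 / C \<le> 1" "1 / C \<le> 1 / C0" "C0 \<le> C"
        using C0 by (auto simp: C_def intro!: divide_left_mono)
      have f: "1 / C \<le> f x" "f x \<le> C" for x
      proof -
        have "1 / C0 \<le> f x \<and> f x \<le> C0 \<or> f x = 1" using hyp by blast
        then show "1 / C \<le> f x" "f x \<le> C" using C by linarith+
      qed
      have "10 * sqrt (real CARD('n)) * 1 \<le> 10 * sqrt (real CARD('n)) * (1 + L)"
        using L0 by (intro mult_left_mono) auto
      then have "10 * sqrt (real CARD('n)) < C\<Gamma>"
        using C\<Gamma> unfolding mult_1_right by (rule order.strict_trans1)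
      then interpret lipschitz_graph_measure A \<mu> L Cu Cl C\<Gamma>
        unfolding \<mu>_def Cu_def Cl_def
        by (intro lipschitz_graph_measure_hausdorff \<Gamma>_def True A L0 f_meas f C(1))
      have "(\<integral>\<^sup>+ x. S_sq \<phi> K \<mu> x \<partial>\<mu>) \<le> ennreal B * ?rhs"
        unfolding B_def by (rule nn_integral_S_sq_le[OF C1 K \<phi>])
      also have "\<dots> \<le> ennreal (max 1 B) * ?rhs"
        by (intro mult_right_mono ennreal_leI) auto
      finally show ?thesis .
    next
      \<comment> \<open>In the degenerate case \<mu> is the null measure and the left side is
        0.\<close>
      case False
      have "AE x in (hausdorff_measure CARD('n) :: ((real^'n) \<times> (real^'m)) measure). False"
        using emeasure_hausdorff_measure_degenerate[OF False, of UNIV] by (intro AE_I[of _ _ UNIV]) auto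
      then have "AE x in \<mu>. S_sq \<phi> K \<mu> x \<le> 0"
        unfolding \<mu>_def by (subst AE_density) (measurable, auto)
      then have "(\<integral>\<^sup>+ x. S_sq \<phi> K \<mu> x \<partial>\<mu>) \<le> (\<integral>\<^sup>+ x. 0 \<partial>\<mu>)" by (rule nn_integral_mono_AE)
      then show ?thesis by simp
    qed
    then show "let \<Gamma> = {(x, A x) | x. True};
          \<mu> = density (hausdorff_measure CARD('n)) (\<lambda>x. ennreal (f x) * indicator \<Gamma> x)
      in (\<integral>\<^sup>+ x. S_sq \<phi> K \<mu> x \<partial>\<mu>)
         \<le> ennreal (max 1 B) * (\<integral>\<^sup>+ Q. (alpha C\<Gamma> \<mu> Q ^ 2 + beta2 C\<Gamma> \<mu> Q ^ 2) * emeasure \<mu> (vcube Q 1)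
                           \<partial>count_space dyadic_vcubes)"
      unfolding Let_def \<mu>_def \<Gamma>_def .
  qed simp
qed

end
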